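(* The following decision problem is in $\mathsf{P}$ (deterministic polynomial time). Input: a dimension $n\in\mathbb{N}$, a prime $p$ given in binary, and matrices $C_1,\ldots,C_k\in H_n^{(p)}$. Question: do there exist $Z_1,\ldots,Z_k\in H_n^{(p)}$ with $\prod_{i=1}^k Z_i^{-1}C_iZ_i=I$?
   Context: For $n\geq 2$ and a prime $p$, the generalized Heisenberg group $H_n^{(p)}$ of dimension $n$ over $\mathbb{Z}_p=\mathbb{Z}/p\mathbb{Z}$ is the group of all $n\times n$ block matrices $$\begin{pmatrix}1&\alpha_1&a_2\\0&I&\alpha_3\\0&0&1\end{pmatrix},\qquad \alpha_1^T,\alpha_3\in\mathbb{Z}_p^{n-2},\ a_2\in\mathbb{Z}_p,$$ where $I$ in the middle block is the identity matrix of size $n-2$. The dimension $n$ is given in unary; matrix entries are given in binary. Both $n$ and $p$ are part of the input. In the equation, $I$ denotes the $n\times n$ identity matrix. *)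

theory Defs
  imports
    "Jordan_Normal_Form.Matrix"
    "HOL-Computational_Algebra.Primes"
    "HOL-Computational_Algebra.Polynomial"
begin

section \<open>Deterministic polynomial time\<close>

text \<open>
  Deterministic Turing machines with a fixed positive number of two-way infinite tapes. States and
  tape symbols are natural numbers from finite sets; symbol \<open>0\<close> is the blank, and \<open>1\<close>, \<open>2\<close> stand for
  the input bits \<open>False\<close>, \<open>True\<close>. Only the values of \<open>delta\<close> at the finitely many arguments
  constrained in \<open>turing_machine\<close> can influence a run.
\<close>

datatype dir = Move_Left | Stay | Move_Right

record tm =
  tapes :: nat
  states :: "nat set"
  symbols :: "nat set"
  start :: nat
  accept :: nat
  reject :: nat
  delta :: "nat \<Rightarrow> nat list \<Rightarrow> nat \<times> (nat \<times> dir) list"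

definition turing_machine :: "tm \<Rightarrow> bool" where
  "turing_machine M \<longleftrightarrow>
     tapes M \<ge> 1 \<and> finite (states M) \<and> finite (symbols M) \<and>
     {0, 1, 2} \<subseteq> symbols M \<and> {start M, accept M, reject M} \<subseteq> states M \<and> accept M \<noteq> reject M \<and>
     (\<forall>q \<in> states M. \<forall>xs. length xs = tapes M \<and> set xs \<subseteq> symbols M \<longrightarrow>
        (case delta M q xs of (q', acts) \<Rightarrow>
           q' \<in> states M \<and> length acts = tapes M \<and> fst ` set acts \<subseteq> symbols M))"

text \<open>A tape is its content together with the position of the head.\<close>

type_synonym tape = "(int \<Rightarrow> nat) \<times> int"
type_synonym config = "nat \<times> tape list"

fun read_tape :: "tape \<Rightarrow> nat" where
  "read_tape (f, h) = f h"

fun move_head :: "dir \<Rightarrow> int \<Rightarrow> int" where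
  "move_head Move_Left h = h - 1"
| "move_head Stay h = h"
| "move_head Move_Right h = h + 1"

fun act_tape :: "nat \<times> dir \<Rightarrow> tape \<Rightarrow> tape" where
  "act_tape (a, d) (f, h) = (f(h := a), move_head d h)"

fun tm_step :: "tm \<Rightarrow> config \<Rightarrow> config" where
  "tm_step M (q, ts) =
     (if q \<in> {accept M, reject M} then (q, ts)
      else case delta M q (map read_tape ts) of (q', acts) \<Rightarrow> (q', map2 act_tape acts ts))"

definition input_tape :: "bool list \<Rightarrow> tape" where
  "input_tape w =
     (\<lambda>i. if 0 \<le> i \<and> i < int (length w) then (if w ! nat i then 2 else 1) else 0, 0)"

definition blank_tape :: tape where
  "blank_tape = (\<lambda>_. 0, 0)"

definition init_config :: "tm \<Rightarrow> bool list \<Rightarrow> config" where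
  "init_config M w = (start M, input_tape w # replicate (tapes M - 1) blank_tape)"

text \<open>Halting configurations are fixed points of \<open>tm_step\<close>, so \<open>T\<close> bounds the running time.\<close>

definition decides_in_time :: "tm \<Rightarrow> bool list set \<Rightarrow> (nat \<Rightarrow> nat) \<Rightarrow> bool" where
  "decides_in_time M L T \<longleftrightarrow>
     (\<forall>w. fst ((tm_step M ^^ T (length w)) (init_config M w)) = (if w \<in> L then accept M else reject M))"

definition PTIME :: "bool list set set" where
  "PTIME = {L. \<exists>M (q :: nat poly). turing_machine M \<and> decides_in_time M L (poly q)}"

text \<open>
  A decision problem is given by its set of instances, an encoding of instances as bit strings and
  the property asked for. As usual, the input is known to be an instance, so nothing is required
  of the answer on strings that do not encode one.
\<close>

definition in_P :: "'a set \<Rightarrow> ('a \<Rightarrow> bool list) \<Rightarrow> ('a \<Rightarrow> bool) \<Rightarrow> bool" where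
  "in_P instances enc yes \<longleftrightarrow> (\<exists>L \<in> PTIME. \<forall>x \<in> instances. enc x \<in> L \<longleftrightarrow> yes x)"


section \<open>Generalized Heisenberg groups\<close>

text \<open>Elements of \<open>\<int>/p\<int>\<close> are represented by the integers \<open>0, \<dots>, p - 1\<close>.\<close>

definition heis_mat :: "nat \<Rightarrow> int vec \<Rightarrow> int \<Rightarrow> int vec \<Rightarrow> int mat" where
  "heis_mat n a1 a2 a3 = mat n n (\<lambda>(i, j).
     if i = j then 1
     else if i = 0 \<and> j = n - 1 then a2
     else if i = 0 then a1 $ (j - 1)
     else if j = n - 1 then a3 $ (i - 1)
     else 0)"

definition residue_vecs :: "nat \<Rightarrow> nat \<Rightarrow> int vec set" where
  "residue_vecs m p = {v \<in> carrier_vec m. \<forall>i < m. v $ i \<in> {0..<int p}}"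

definition heisenberg :: "nat \<Rightarrow> nat \<Rightarrow> int mat monoid" where
  "heisenberg n p =
     \<lparr>carrier = {heis_mat n a1 a2 a3 | a1 a2 a3.
        a1 \<in> residue_vecs (n - 2) p \<and> a2 \<in> {0..<int p} \<and> a3 \<in> residue_vecs (n - 2) p},
      monoid.mult = (\<lambda>A B. map_mat (\<lambda>x. x mod int p) (A * B)),
      one = 1\<^sub>m n\<rparr>"

text \<open>The structure is a group, so that \<open>inv\<close> is the inverse matrix modulo \<open>p\<close>.\<close>

lemma heis_mat_carrier: "heis_mat n a1 a2 a3 \<in> carrier_mat n n"
  by (simp add: heis_mat_def)

lemma heis_mat_mult:
  assumes n: "n \<ge> 2" and a: "a1 \<in> carrier_vec (n-2)" "a3 \<in> carrier_vec (n-2)"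
    "b1 \<in> carrier_vec (n-2)" "b3 \<in> carrier_vec (n-2)"
  shows "heis_mat n a1 a2 a3 * heis_mat n b1 b2 b3 =
    heis_mat n (a1 + b1) (a2 + b2 + a1 \<bullet> b3) (a3 + b3)"
proof (rule eq_matI; (simp add: heis_mat_def; fail)?)
  fix i j assume "i < dim_row (heis_mat n (a1 + b1) (a2 + b2 + a1 \<bullet> b3) (a3 + b3))"
    "j < dim_col (heis_mat n (a1 + b1) (a2 + b2 + a1 \<bullet> b3) (a3 + b3))"
  hence ij: "i < n" "j < n" by (simp_all add: heis_mat_def)
  obtain m where m: "n = Suc (Suc m)" using le_Suc_ex[OF n] by auto
  let ?A = "\<lambda>i k. heis_mat n a1 a2 a3 $$ (i,k)" and ?B = "\<lambda>k j. heis_mat n b1 b2 b3 $$ (k,j)"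
  have "(heis_mat n a1 a2 a3 * heis_mat n b1 b2 b3) $$ (i, j) = (\<Sum>k<n. ?A i k * ?B k j)"
    using ij by (simp add: heis_mat_def scalar_prod_def atLeast0LessThan)
  also have "\<dots> = ?A i 0 * ?B 0 j + (\<Sum>k<m. ?A i (Suc k) * ?B (Suc k) j) + ?A i (Suc m) * ?B (Suc m) j"
    by (simp only: m sum.lessThan_Suc[of _ "Suc m"] sum.lessThan_Suc_shift[of _ m])
  also have "(\<Sum>k<m. ?A i (Suc k) * ?B (Suc k) j) =
     (if i = 0 \<and> j = Suc m then a1 \<bullet> b3 else if i = 0 \<and> j > 0 then a1 $ (j - 1)
      else if i > 0 \<and> i < Suc m then ?B i j else 0)" (is "?l = ?r")
  proof -
    consider "i = 0" "j = Suc m" | "i = 0" "j = 0" | j' where "i = 0" "j = Suc j'" "j' < m"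
      | i' where "i = Suc i'" "i' < m" | "i = Suc m" using ij m
      by (cases i; cases j) (auto simp: less_Suc_eq)
    thus ?thesis
    proof cases
      case 1 thus ?thesis using a m by (auto simp: heis_mat_def scalar_prod_def atLeast0LessThan intro!: sum.cong)
    next
      case 2 thus ?thesis using m by (auto simp: heis_mat_def)
    next
      case 3
      have "?l = (\<Sum>k<m. if k = j' then a1 $ j' else 0)"
        using 3 m by (intro sum.cong) (auto simp: heis_mat_def)
      thus ?thesis using 3 by simp
    next
      case 4
      have "?l = (\<Sum>k<m. if k = i' then ?B i j else 0)"
        using 4 m by (intro sum.cong) (auto simp: heis_mat_def)
      thus ?thesis using 4 by simp
    next
      case 5
      have "?l = (\<Sum>k<m. 0)"
        using 5 m by (intro sum.cong) (auto simp: heis_mat_def)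
      thus ?thesis using 5 by simp
    qed
  qed
  finally show "(heis_mat n a1 a2 a3 * heis_mat n b1 b2 b3) $$ (i, j) =
      heis_mat n (a1 + b1) (a2 + b2 + a1 \<bullet> b3) (a3 + b3) $$ (i, j)"
    using ij m a by (auto simp: heis_mat_def)
qed

lemma heis_mat_mod:
  assumes "n \<ge> 2" "p > 1" "a1 \<in> carrier_vec (n-2)" "a3 \<in> carrier_vec (n-2)"
  shows "map_mat (\<lambda>x. x mod p) (heis_mat n a1 a2 a3) =
    heis_mat n (map_vec (\<lambda>x. x mod p) a1) (a2 mod p) (map_vec (\<lambda>x. x mod p) a3)"
  using assms by (auto simp: heis_mat_def map_mat_def intro!: eq_matI)

lemma heis_mult_closed_form:
  assumes "n \<ge> 2" "p \<ge> 2" "a1 \<in> carrier_vec (n-2)" "a3 \<in> carrier_vec (n-2)"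
    "b1 \<in> carrier_vec (n-2)" "b3 \<in> carrier_vec (n-2)"
  shows "heis_mat n a1 a2 a3 \<otimes>\<^bsub>heisenberg n p\<^esub> heis_mat n b1 b2 b3 =
    heis_mat n (map_vec (\<lambda>x. x mod int p) (a1 + b1)) ((a2 + b2 + a1 \<bullet> b3) mod int p)
      (map_vec (\<lambda>x. x mod int p) (a3 + b3))"
  using assms by (simp add: heisenberg_def heis_mat_mult heis_mat_mod)

lemma map_mat_mod_mult:
  assumes "A \<in> carrier_mat n n" "B \<in> carrier_mat n n"
  shows "map_mat (\<lambda>x. x mod p) (map_mat (\<lambda>x. x mod p) A * B) = map_mat (\<lambda>x. x mod (p::int)) (A * B)"
    "map_mat (\<lambda>x. x mod p) (A * map_mat (\<lambda>x. x mod p) B) = map_mat (\<lambda>x. x mod (p::int)) (A * B)"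
proof -
  have "(\<Sum>k<n. (A $$ (i,k) mod p) * B $$ (k,j)) mod p = (\<Sum>k<n. A $$ (i,k) * B $$ (k,j)) mod p"
    "(\<Sum>k<n. A $$ (i,k) * (B $$ (k,j) mod p)) mod p = (\<Sum>k<n. A $$ (i,k) * B $$ (k,j)) mod p" for i j
    by (subst (1 2) mod_sum_eq[symmetric]; simp add: mod_simps)+
  thus "map_mat (\<lambda>x. x mod p) (map_mat (\<lambda>x. x mod p) A * B) = map_mat (\<lambda>x. x mod (p::int)) (A * B)"
    "map_mat (\<lambda>x. x mod p) (A * map_mat (\<lambda>x. x mod p) B) = map_mat (\<lambda>x. x mod (p::int)) (A * B)"
    using assms by (auto simp: scalar_prod_def atLeast0LessThan intro!: eq_matI)
qed

lemma group_heisenberg: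
  assumes n: "n \<ge> 2" and p: "p \<ge> 2"
  shows "group (heisenberg n p)"
proof (rule groupI)
  let ?G = "heisenberg n p"
  have mv: "map_vec (\<lambda>x. x mod int p) v \<in> residue_vecs m p" if "v \<in> carrier_vec m" for v m
    using that p by (auto simp: residue_vecs_def)
  have car: "v \<in> carrier_vec m" if "v \<in> residue_vecs m p" for v m
    using that by (simp add: residue_vecs_def)
  have oneeq: "\<one>\<^bsub>?G\<^esub> = heis_mat n (0\<^sub>v (n-2)) 0 (0\<^sub>v (n-2))"
    using n by (auto simp: heisenberg_def heis_mat_def intro!: eq_matI)
  have z: "0\<^sub>v m \<in> residue_vecs m p" for m using p by (auto simp: residue_vecs_def)
  have carI: "heis_mat n a1 a2 a3 \<in> carrier ?G"
    if "a1 \<in> residue_vecs (n-2) p" "a2 \<in> {0..<int p}" "a3 \<in> residue_vecs (n-2) p" for a1 a2 a3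
    using that unfolding heisenberg_def by auto
  show "\<one>\<^bsub>?G\<^esub> \<in> carrier ?G" unfolding oneeq using z p by (intro carI) auto
  show "x \<otimes>\<^bsub>?G\<^esub> y \<in> carrier ?G" if x: "x \<in> carrier ?G" and y: "y \<in> carrier ?G" for x y
  proof -
    obtain a1 a2 a3 where a: "x = heis_mat n a1 a2 a3" "a1 \<in> residue_vecs (n-2) p" "a3 \<in> residue_vecs (n-2) p"
      using x by (auto simp: heisenberg_def)
    obtain b1 b2 b3 where b: "y = heis_mat n b1 b2 b3" "b1 \<in> residue_vecs (n-2) p" "b3 \<in> residue_vecs (n-2) p"
      using y by (auto simp: heisenberg_def)
    show ?thesis unfolding a(1) b(1)
      by (subst heis_mult_closed_form[OF n p])
        (use a b car mv p in \<open>auto intro!: carI mv\<close>)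
  qed
  have carm: "x \<in> carrier_mat n n" if "x \<in> carrier ?G" for x
    using that heis_mat_carrier by (auto simp: heisenberg_def)
  show "x \<otimes>\<^bsub>?G\<^esub> y \<otimes>\<^bsub>?G\<^esub> z = x \<otimes>\<^bsub>?G\<^esub> (y \<otimes>\<^bsub>?G\<^esub> z)"
    if "x \<in> carrier ?G" "y \<in> carrier ?G" "z \<in> carrier ?G" for x y z
    using that[THEN carm] by (simp add: heisenberg_def map_mat_mod_mult[where n = n])
  show "\<one>\<^bsub>?G\<^esub> \<otimes>\<^bsub>?G\<^esub> x = x" if x: "x \<in> carrier ?G" for x
  proof -
    obtain a1 a2 a3 where a: "x = heis_mat n a1 a2 a3" "a1 \<in> residue_vecs (n-2) p" "a3 \<in> residue_vecs (n-2) p"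
      "a2 \<in> {0..<int p}"
      using x by (auto simp: heisenberg_def)
    have m: "map_vec (\<lambda>x. x mod int p) v = v" if "v \<in> residue_vecs m p" for v m
      using that by (auto simp: residue_vecs_def intro!: eq_vecI)
    show ?thesis unfolding oneeq a(1)
      by (subst heis_mult_closed_form[OF n p]) (use a m[OF a(2)] m[OF a(3)] car[OF a(2)] car[OF a(3)] in auto)
  qed
  show "\<exists>y\<in>carrier ?G. y \<otimes>\<^bsub>?G\<^esub> x = \<one>\<^bsub>?G\<^esub>" if x: "x \<in> carrier ?G" for x
  proof -
    obtain a1 a2 a3 where a: "x = heis_mat n a1 a2 a3" "a1 \<in> residue_vecs (n-2) p" "a3 \<in> residue_vecs (n-2) p"
      using x by (auto simp: heisenberg_def)
    let ?m = "map_vec (\<lambda>x. x mod int p)"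
    let ?y = "heis_mat n (?m (- a1)) ((- a2 - ?m (-a1) \<bullet> a3) mod int p) (?m (- a3))"
    have y: "?y \<in> carrier ?G" using p a car by (auto intro!: carI mv)
    have m: "?m (?m (- v) + v) = 0\<^sub>v (n-2)" if "v \<in> carrier_vec (n-2)" for v
    proof (rule eq_vecI)
      fix i assume "i < dim_vec (0\<^sub>v (n-2))"
      moreover have "((- t) mod int p + t) mod int p = 0" for t
        by (subst mod_add_left_eq) simp
      ultimately show "?m (?m (- v) + v) $ i = 0\<^sub>v (n-2) $ i" using that by auto
    qed (use that in auto)
    have s: "((- a2 - s) mod int p + a2 + s) mod int p = 0" for s
    proof -
      have "((- a2 - s) mod int p + (a2 + s)) mod int p = 0"
        by (subst mod_add_left_eq) simp
      thus ?thesis by (simp only: add.assoc)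
    qed
    have "?y \<otimes>\<^bsub>?G\<^esub> x = \<one>\<^bsub>?G\<^esub>"
      unfolding a(1) oneeq
      by (subst heis_mult_closed_form[OF n p])
        (simp_all only: m[OF car[OF a(2)]] m[OF car[OF a(3)]] s map_carrier_vec uminus_carrier_vec
          car[OF a(2)] car[OF a(3)])
    with y show ?thesis by blast
  qed
qed



section \<open>Spherical equations\<close>

text \<open>An instance \<open>(n, p, Cs)\<close> consists of the dimension, the modulus and the list of the coefficients.\<close>

type_synonym instance_data = "nat \<times> nat \<times> int mat list"

definition spherical_instances :: "instance_data set" where
  "spherical_instances =
     {(n, p, Cs). n \<ge> 2 \<and> prime p \<and> set Cs \<subseteq> carrier (heisenberg n p)}"

definition list_prod :: "('a, 'b) monoid_scheme \<Rightarrow> 'a list \<Rightarrow> 'a" where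
  "list_prod G xs = foldr (monoid.mult G) xs \<one>\<^bsub>G\<^esub>"

definition spherical_solvable :: "instance_data \<Rightarrow> bool" where
  "spherical_solvable = (\<lambda>(n, p, Cs). let G = heisenberg n p in
     \<exists>Zs. length Zs = length Cs \<and> set Zs \<subseteq> carrier G \<and>
       list_prod G (map2 (\<lambda>Z C. inv\<^bsub>G\<^esub> Z \<otimes>\<^bsub>G\<^esub> C \<otimes>\<^bsub>G\<^esub> Z) Zs Cs) = 1\<^sub>m n)"

text \<open>
  Binary digits are listed from the least significant one. Each digit \<open>b\<close> is written as
  \<open>[True, b]\<close> and a number ends with \<open>[False]\<close>, so that codes can be concatenated. Matrices are listed
  row by row. Since the dimension is known, their number is determined by the length of the input.
\<close>

fun binary_digits :: "nat \<Rightarrow> bool list" where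
  "binary_digits m = (if m = 0 then [] else odd m # binary_digits (m div 2))"

declare binary_digits.simps [simp del]

definition enc_unary :: "nat \<Rightarrow> bool list" where
  "enc_unary m = replicate m True @ [False]"

definition enc_binary :: "nat \<Rightarrow> bool list" where
  "enc_binary m = concat (map (\<lambda>b. [True, b]) (binary_digits m)) @ [False]"

definition enc_mat :: "int mat \<Rightarrow> bool list" where
  "enc_mat A = concat [enc_binary (nat (A $$ (i, j))). i \<leftarrow> [0..<dim_row A], j \<leftarrow> [0..<dim_col A]]"

definition enc_instance :: "instance_data \<Rightarrow> bool list" where
  "enc_instance = (\<lambda>(n, p, Cs). enc_unary n @ enc_binary p @ concat (map enc_mat Cs))"

end

(*
  In a Heisenberg group, conjugating (a, b, c) by (z1, z2, z3) fixes a and c and adds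
  a.z3 - z1.c to the corner b. Hence the entries of the product outside the corner are the sums of
  those of the coefficients, while its corner can be adjusted to any residue as soon as one
  coefficient has a nonzero entry a or c. So the equation is solvable if and only if all sums of
  entries off the diagonal and the corner vanish modulo p and, in addition, one of these entries is
  nonzero or the sum of the corners vanishes modulo p.

  For the time bound, a small imperative language whose programs act on tapes is compiled to Turing
  machines, one machine step per program step. The procedure reads the entries once and keeps the
  sum modulo p for each of the n^2 positions, so that every entry costs polynomial time.
*)
theory Submission
  imports Defs
begin

section \<open>Structured programs on tapes\<close>

text \<open>\<open>decides_in_time\<close> wants a timely answer on every bit string. So all run
  lemmas describe arbitrary tape contents, \<open>accepts\<close> is defined on arbitrary symbol
  lists, and encodings of instances enter only after membership in \<open>PTIME\<close> is settled.
  The number of matrices is nowhere written in the input; a word of \<open>n * n\<close> position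
  types, kept on a tape, tells where an entry belongs and when a matrix ends, so one pass from left
  to right suffices. Multiplying out the matrices also puts the cross terms a_i.c_j with i < j into
  the corner, yet the criterion does not mention them. If some a or c is nonzero, the shift by a
  conjugator absorbs them, because a nonzero residue modulo a prime is invertible; otherwise they
  all vanish. Hence plain sums modulo p and one flag are enough. All accumulators have the width of
  p, so heads on accumulators and types advance together. Reduction modulo p needs no separate
  comparison: the last carry is the sign of a + e - p.\<close>

text \<open>
  A tape is represented by the symbols to the left of the head, nearest first, and the symbols
  from the head on; blanks beyond the end of a list are implicit.
\<close>

type_synonym zipper = "nat list \<times> nat list"
type_synonym store = "nat \<Rightarrow> zipper"
type_synonym updates = "(nat \<times> ((nat \<Rightarrow> nat) \<Rightarrow> nat) \<times> dir) list"

definition hd0 :: "nat list \<Rightarrow> nat" where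
  "hd0 xs = (case xs of [] \<Rightarrow> 0 | x # _ \<Rightarrow> x)"

lemma hd0_simps [simp]: "hd0 [] = 0" "hd0 (x # xs) = x"
  by (simp_all add: hd0_def)

text \<open>A blank next to an empty half is dropped, so that an erased tape is again exactly
  \<open>([], [])\<close> and stores can be described by equations.\<close>

definition push :: "nat \<Rightarrow> nat list \<Rightarrow> nat list" where
  "push a xs = (if a = 0 \<and> xs = [] then [] else a # xs)"

lemma push_simps [simp]:
  "push 0 [] = []" "push (Suc a) xs = Suc a # xs" "push (numeral m) xs = numeral m # xs"
  "push 1 xs = 1 # xs" "push a (x # xs) = a # x # xs"
  by (simp_all add: push_def)

fun zact :: "nat \<Rightarrow> dir \<Rightarrow> zipper \<Rightarrow> zipper" where
  "zact a Move_Right (l, r) = (push a l, tl r)"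
| "zact a Stay (l, r) = (l, push a (tl r))"
| "zact a Move_Left (l, r) = (tl l, push (hd0 l) (push a (tl r)))"

definition zread :: "zipper \<Rightarrow> nat" where
  "zread z = hd0 (snd z)"

lemma zread_pair [simp]: "zread (l, r) = hd0 r"
  by (simp add: zread_def)

abbreviation reads :: "store \<Rightarrow> nat \<Rightarrow> nat" where
  "reads s \<equiv> \<lambda>i. zread (s i)"

text \<open>Every action uses the old content \<open>s j\<close>, and the first of several actions
  on one tape wins, as in \<open>map_of\<close>: this is one simultaneous step on all tapes.\<close>

fun upd :: "updates \<Rightarrow> (nat \<Rightarrow> nat) \<Rightarrow> store \<Rightarrow> store" where
  "upd [] v s = s"
| "upd ((j, f, d) # us) v s = (upd us v s)(j := zact (f v) d (s j))"

datatype com =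
    Skip
  | Act updates
  | Seq com com (infixr ";;" 60)
  | Cond "(nat \<Rightarrow> nat) \<Rightarrow> bool" com com
  | Loop "(nat \<Rightarrow> nat) \<Rightarrow> bool" com

text \<open>The number in \<open>exec c s t s'\<close> is an upper bound of the running time.\<close>

inductive exec :: "com \<Rightarrow> store \<Rightarrow> nat \<Rightarrow> store \<Rightarrow> bool" where
  exec_Skip: "exec Skip s t s"
| exec_Act: "1 \<le> t \<Longrightarrow> s' = upd us (reads s) s \<Longrightarrow> exec (Act us) s t s'"
| exec_Seq: "exec a s t1 s1 \<Longrightarrow> exec b s1 t2 s2 \<Longrightarrow> t1 + t2 + 1 \<le> t \<Longrightarrow> exec (a ;; b) s t s2"
| exec_CondT: "P (reads s) \<Longrightarrow> exec a s t1 s1 \<Longrightarrow> t1 + 1 \<le> t \<Longrightarrow> exec (Cond P a b) s t s1"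
| exec_CondF: "\<not> P (reads s) \<Longrightarrow> exec b s t1 s1 \<Longrightarrow> t1 + 1 \<le> t \<Longrightarrow> exec (Cond P a b) s t s1"
| exec_LoopF: "\<not> P (reads s) \<Longrightarrow> 1 \<le> t \<Longrightarrow> exec (Loop P a) s t s"
| exec_LoopT: "P (reads s) \<Longrightarrow> exec a s t1 s1 \<Longrightarrow> exec (Loop P a) s1 t2 s2 \<Longrightarrow> t1 + t2 + 2 \<le> t \<Longrightarrow>
    exec (Loop P a) s t s2"

lemma exec_mono: "exec c s t s' \<Longrightarrow> t \<le> t' \<Longrightarrow> exec c s t' s'"
  by (induction arbitrary: t' rule: exec.induct) (blast intro: exec.intros le_trans)+

text \<open>Removing a finished \<open>Skip\<close> and unfolding a loop are steps of their own.
  They account for the \<open>+ 1\<close> in \<open>exec_Seq\<close> and the \<open>+ 2\<close> in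
  \<open>exec_LoopT\<close>.\<close>

fun small_step :: "com \<Rightarrow> (nat \<Rightarrow> nat) \<Rightarrow> com \<times> updates" where
  "small_step Skip v = (Skip, [])"
| "small_step (Act us) v = (Skip, us)"
| "small_step (a ;; b) v =
     (if a = Skip then (b, []) else (fst (small_step a v) ;; b, snd (small_step a v)))"
| "small_step (Cond P a b) v = (if P v then a else b, [])"
| "small_step (Loop P a) v = (if P v then a ;; Loop P a else Skip, [])"

fun zstep :: "com \<times> store \<Rightarrow> com \<times> store" where
  "zstep (c, s) = (fst (small_step c (reads s)), upd (snd (small_step c (reads s))) (reads s) s)"

lemma zstep_Skip: "(zstep ^^ n) (Skip, s) = (Skip, s)"
  by (induction n) auto

text \<open>\<open>zstep\<close> idles on \<open>Skip\<close>, so \<open>a\<close> may have finished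
  before step \<open>n\<close>, whereas \<open>a ;; b\<close> would go on with \<open>b\<close>.
  Hence only some \<open>m \<le> n\<close>.\<close>

lemma zstep_Seq:
  "(zstep ^^ n) (a, s) = (Skip, s1) \<Longrightarrow> \<exists>m\<le>n. (zstep ^^ m) (a ;; b, s) = (Skip ;; b, s1)"
proof (induction n arbitrary: a s)
  case (Suc n)
  show ?case
  proof (cases "a = Skip")
    case True
    then show ?thesis using Suc.prems zstep_Skip[of "Suc n" s] by (auto intro: exI[of _ 0])
  next
    case False
    obtain a' s' where a': "zstep (a, s) = (a', s')" by fastforce
    then have "(zstep ^^ n) (a', s') = (Skip, s1)"
      using Suc.prems by (simp only: funpow_Suc_right o_apply)
    from Suc.IH[OF this] obtain m where m: "m \<le> n" "(zstep ^^ m) (a' ;; b, s') = (Skip ;; b, s1)"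
      by blast
    have "zstep (a ;; b, s) = (a' ;; b, s')" using False a' by simp
    then have "(zstep ^^ Suc m) (a ;; b, s) = (Skip ;; b, s1)"
      using m(2) by (simp only: funpow_Suc_right o_apply)
    with m(1) show ?thesis by (intro exI[of _ "Suc m"]) simp
  qed
qed (auto intro: exI[of _ 0])

lemma exec_zstep: "exec c s t s' \<Longrightarrow> \<exists>n\<le>t. (zstep ^^ n) (c, s) = (Skip, s')"
proof (induction rule: exec.induct)
  case (exec_Seq a s t1 s1 b t2 s2 t)
  then obtain n1 n2 where n: "n1 \<le> t1" "(zstep ^^ n1) (a, s) = (Skip, s1)"
    "n2 \<le> t2" "(zstep ^^ n2) (b, s1) = (Skip, s2)" by blast
  from zstep_Seq[OF n(2)] obtain m where m: "m \<le> n1" "(zstep ^^ m) (a ;; b, s) = (Skip ;; b, s1)"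
    by blast
  have "(zstep ^^ (n2 + Suc m)) (a ;; b, s) = (Skip, s2)"
    by (simp only: funpow_add o_apply funpow.simps m(2)) (simp add: n(4))
  then show ?case using m(1) n(1,3) exec_Seq.hyps by (intro exI[of _ "n2 + Suc m"]) simp
next
  case (exec_LoopT P s a t1 s1 t2 s2 t)
  then obtain n1 n2 where n: "n1 \<le> t1" "(zstep ^^ n1) (a, s) = (Skip, s1)"
    "n2 \<le> t2" "(zstep ^^ n2) (Loop P a, s1) = (Skip, s2)" by blast
  from zstep_Seq[OF n(2)] obtain m
    where m: "m \<le> n1" "(zstep ^^ m) (a ;; Loop P a, s) = (Skip ;; Loop P a, s1)"
    by blast
  have "zstep (Loop P a, s) = (a ;; Loop P a, s)" using exec_LoopT.hyps(1) by simp
  then have "(zstep ^^ Suc m) (Loop P a, s) = (Skip ;; Loop P a, s1)"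
    by (simp only: funpow_Suc_right o_apply m(2))
  then have "(zstep ^^ (n2 + Suc (Suc m))) (Loop P a, s) = (Skip, s2)"
    by (simp only: funpow_add o_apply funpow.simps(2)[of "Suc m"]) (simp add: n(4))
  then show ?case using m(1) n(1,3) exec_LoopT.hyps by (intro exI[of _ "n2 + Suc (Suc m)"]) simp
next
  case (exec_CondT P s a t1 s1 t b)
  then obtain n where "n \<le> t1" "(zstep ^^ n) (a, s) = (Skip, s1)" by blast
  then show ?case using exec_CondT.hyps
    by (intro exI[of _ "Suc n"]) (simp only: funpow_Suc_right o_apply, simp)
next
  case (exec_CondF P s b t1 s1 t a)
  then obtain n where "n \<le> t1" "(zstep ^^ n) (b, s) = (Skip, s1)" by blast
  then show ?case using exec_CondF.hyps
    by (intro exI[of _ "Suc n"]) (simp only: funpow_Suc_right o_apply, simp)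
next
  case (exec_Act t s' us s)
  then show ?case by (intro exI[of _ 1]) simp
next
  case (exec_LoopF P s t a)
  then show ?case by (intro exI[of _ 1]) simp
qed (auto intro: exI[of _ 0])

subsection \<open>Compilation to Turing machines\<close>

text \<open>
  The control states of the machine are the programs that remain to be executed; there are only
  finitely many of them.
\<close>

fun residuals :: "com \<Rightarrow> com set" where
  "residuals Skip = {Skip}"
| "residuals (Act us) = {Act us, Skip}"
| "residuals (a ;; b) = (\<lambda>x. x ;; b) ` residuals a \<union> residuals b"
| "residuals (Cond P a b) = {Cond P a b} \<union> residuals a \<union> residuals b"
| "residuals (Loop P a) = {Loop P a, Skip} \<union> (\<lambda>x. x ;; Loop P a) ` residuals a"

lemma residuals_refl: "c \<in> residuals c"
  by (induction c) auto

lemma finite_residuals: "finite (residuals c)"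
  by (induction c) auto

text \<open>A loop unfolds to \<open>a ;; Loop P a\<close> and falls back to
  \<open>Loop P a\<close>, so no step leaves the finite set of residuals.\<close>

lemma small_step_residuals: "x \<in> residuals c \<Longrightarrow> fst (small_step x v) \<in> residuals c"
  by (induction c arbitrary: x) (auto simp: residuals_refl split: if_splits)

definition writes_below :: "nat \<Rightarrow> ((nat \<Rightarrow> nat) \<Rightarrow> nat) \<Rightarrow> bool" where
  "writes_below K f \<longleftrightarrow> (\<forall>v. (\<forall>i. v i < K) \<longrightarrow> f v < K)"

primrec wf_com :: "nat \<Rightarrow> nat \<Rightarrow> com \<Rightarrow> bool" where
  "wf_com k K Skip \<longleftrightarrow> True"
| "wf_com k K (Act us) \<longleftrightarrow>
(\<forall>(j, f, d) \<in> set us. j < k \<and> writes_below K f)"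
| "wf_com k K (a ;; b) \<longleftrightarrow> wf_com k K a \<and> wf_com k K b"
| "wf_com k K (Cond P a b) \<longleftrightarrow> wf_com k K a \<and> wf_com k K b"
| "wf_com k K (Loop P a) \<longleftrightarrow> wf_com k K a"

lemma wf_residuals: "wf_com k K c \<Longrightarrow> x \<in> residuals c \<Longrightarrow> wf_com k K x"
proof (induction c arbitrary: x)
  case (Seq a b)
  have ab: "wf_com k K a" "wf_com k K b" using Seq.prems(1) by simp_all
  have "wf_com k K y" if "y \<in> residuals a" for y using Seq.IH(1)[OF ab(1) that] .
  moreover have "wf_com k K y" if "y \<in> residuals b" for y using Seq.IH(2)[OF ab(2) that] .
  ultimately show ?case using Seq.prems(2) ab by auto
next
  case (Cond P a b)
  have ab: "wf_com k K a" "wf_com k K b" using Cond.prems(1) by simp_all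
  have "wf_com k K y" if "y \<in> residuals a" for y using Cond.IH(1)[OF ab(1) that] .
  moreover have "wf_com k K y" if "y \<in> residuals b" for y using Cond.IH(2)[OF ab(2) that] .
  ultimately show ?case using Cond.prems ab by auto
next
  case (Loop P a)
  have a: "wf_com k K a" using Loop.prems(1) by simp
  have "wf_com k K y" if "y \<in> residuals a" for y using Loop.IH[OF a that] .
  then show ?case using Loop.prems a by auto
qed auto

lemma wf_small_step:
  "wf_com k K c \<Longrightarrow> (j, f, d) \<in> set (snd (small_step c v)) \<Longrightarrow>
j < k \<and> writes_below K f"
  by (induction c) (auto split: if_splits)

definition nth0 :: "nat list \<Rightarrow> nat \<Rightarrow> nat" where
  "nth0 xs j = (if j < length xs then xs ! j else 0)"

lemma nth0_0: "nth0 xs 0 = hd0 xs"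
  by (cases xs) (auto simp: nth0_def)

lemma nth0_push: "nth0 (push a xs) j = (case j of 0 \<Rightarrow> a | Suc j \<Rightarrow> nth0 xs j)"
  by (auto simp: nth0_def push_def split: nat.splits)

lemma hd0_push [simp]: "hd0 (push a xs) = a"
  by (simp add: push_def)

lemma nth0_tl: "nth0 (tl xs) j = nth0 xs (Suc j)"
  by (cases xs) (auto simp: nth0_def)

fun represents :: "tape \<Rightarrow> zipper \<Rightarrow> bool" where
  "represents (f, h) (l, r) \<longleftrightarrow>
     (\<forall>j. f (h + int j) = nth0 r j) \<and> (\<forall>j. f (h - 1 - int j) = nth0 l j)"

lemma represents_read: "represents t z \<Longrightarrow> read_tape t = zread z"
  by (cases t; cases z) (auto simp: nth0_0[symmetric] dest!: spec[of _ 0])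

lemma act_tape_read: "act_tape (read_tape t, Stay) t = t"
  by (cases t) simp

lemma represents_act: "represents t z \<Longrightarrow> represents (act_tape (a, d) t) (zact a d z)"
proof -
  assume rep: "represents t z"
  obtain f h l r where tz: "t = (f, h)" "z = (l, r)" by fastforce
  have r: "f (h + int j) = nth0 r j" and l: "f (h - 1 - int j) = nth0 l j" for j
    using rep tz by auto
  show ?thesis
  proof (cases d)
    case Move_Right
    have "f (h + 1 + int j) = nth0 r (Suc j)" for j
      using r[of "Suc j"] by (simp add: algebra_simps)
    moreover have "(f(h := a)) (h + 1 - 1 - int j) = nth0 (push a l) j" for j
      using l[of "j - 1"] by (cases j) (auto simp: nth0_push algebra_simps)
    ultimately show ?thesis using Move_Right tz by (auto simp: nth0_tl)
  next
    case Stay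
    have "(f(h := a)) (h + int j) = nth0 (push a (tl r)) j" for j
      using r[of j] by (cases j) (auto simp: nth0_push nth0_tl)
    then show ?thesis using Stay tz l by auto
  next
    case Move_Left
    have "(f(h := a)) (h - 1 + int j) = nth0 (push (hd0 l) (push a (tl r))) j" for j
      using r[of "j - 1"] l[of 0]
      by (cases j; cases "j - 1") (auto simp: nth0_push nth0_tl nth0_0 hd0_push algebra_simps)
    moreover have "f (h - 1 - 1 - int j) = nth0 l (Suc j)" for j
      using l[of "Suc j"] by (simp add: algebra_simps)
    ultimately show ?thesis using Move_Left tz by (auto simp: nth0_tl)
  qed
qed

text \<open>A machine acts on every tape; one that is absent from \<open>us\<close> gets back the
  symbol just read.\<close>

definition action :: "updates \<Rightarrow> (nat \<Rightarrow> nat) \<Rightarrow> nat \<Rightarrow> nat \<times> dir" where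
  "action us v i = (case map_of us i of None \<Rightarrow> (v i, Stay) | Some (f, d) \<Rightarrow> (f v, d))"

lemma upd_action:
  "upd us v s i = (case map_of us i of None \<Rightarrow> s i | Some (f, d) \<Rightarrow> zact (f v) d (s i))"
  by (induction us) auto

definition symbols_read :: "nat list \<Rightarrow> nat \<Rightarrow> nat" where
  "symbols_read xs i = (if i < length xs then xs ! i else 0)"

definition init_store :: "bool list \<Rightarrow> store" where
  "init_store w = (\<lambda>_. ([], []))(0 := ([], map (\<lambda>b. if b then 2 else 1) w))"

text \<open>Tape \<open>r\<close> carries the verdict when the program ends, \<open>K\<close> is the
  size of the alphabet, and \<open>idx\<close> numbers the control states.\<close>

locale compiled_program =
  fixes prog :: com and k K r :: nat and idx :: "com \<Rightarrow> nat"
  assumes wf: "wf_com k K prog" and K: "3 \<le> K" and r: "r < k"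
    and idx: "inj_on idx (residuals prog)"
begin

text \<open>The numbers 0 and 1 are reserved for acceptance and rejection.\<close>

definition code :: "com \<Rightarrow> nat" where
  "code c = idx c + 2"

definition decode :: "nat \<Rightarrow> com" where
  "decode q = the_inv_into (residuals prog) code q"

lemma decode_code: "c \<in> residuals prog \<Longrightarrow> decode (code c) = c"
  unfolding decode_def using idx
  by (intro the_inv_into_f_f) (auto simp: code_def inj_on_def)

text \<open>At \<open>Skip\<close> one further step turns the symbol on tape \<open>r\<close> into a
  halting state; this is the \<open>+ 1\<close> in \<open>machine_run\<close>. The states 0 and 1
  have values too, since \<open>turing_machine\<close> asks for well-formed ones at every
  state.\<close>

definition machine :: tm where
  "machine = \<lparr>tapes = k, states = {0, 1} \<union> code ` residuals prog, symbols = {..<K},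
     start = code prog, accept = 0, reject = 1,
     delta = (\<lambda>q xs. let v = symbols_read xs; c = decode q in
       if q \<in> {0, 1} then (q, map (action [] v) [0..<k])
       else if c = Skip then (if v r = 0 then 0 else 1, map (action [] v) [0..<k])
       else (code (fst (small_step c v)), map (action (snd (small_step c v)) v) [0..<k]))\<rparr>"

lemma turing_machine_machine: "turing_machine machine"
proof -
  have act: "fst ` set (map (action us v) [0..<k]) \<subseteq> {..<K}"
    if "\<forall>i. v i < K" "\<And>j f d. (j, f, d) \<in> set us \<Longrightarrow> f v < K" for us v
    using that by (auto simp: action_def split: option.splits dest!: map_of_SomeD)
  have "case delta machine q xs of (q', acts) \<Rightarrow>
      q' \<in> states machine \<and> length acts = tapes machine \<and> fst ` set acts \<subseteq> symbols machine"
    if q: "q \<in> states machine" and xs: "length xs = tapes machine" "set xs \<subseteq> symbols machine" for q xs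
  proof -
    let ?v = "symbols_read xs"
    have v: "\<forall>i. ?v i < K"
    proof
      fix i
      show "?v i < K"
        using xs K by (auto simp: machine_def symbols_read_def dest: nth_mem)
    qed
    show ?thesis
    proof (cases "q \<in> {0, 1}")
      case True
      then show ?thesis using act[OF v, of "[]"] by (auto simp: machine_def Let_def)
    next
      case False
      then obtain c where c: "c \<in> residuals prog" "q = code c"
        using q by (auto simp: machine_def)
      have "wf_com k K c" using wf_residuals wf c(1) .
      then have "fst ` set (map (action (snd (small_step c ?v)) ?v) [0..<k]) \<subseteq> {..<K}"
        using v by (intro act) (auto dest!: wf_small_step simp: writes_below_def)
moreover have "fst ` set (map (action [] ?v) [0..<k]) \<subseteq> {..<K}"
        using v by (intro act) auto
      ultimately show ?thesis
        using False c small_step_residuals[OF c(1)] by (simp add: machine_def Let_def decode_code)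
    qed
  qed
  moreover have "tapes machine \<ge> 1" using r by (simp add: machine_def)
  ultimately show ?thesis
    using K finite_residuals residuals_refl by (auto simp: turing_machine_def machine_def)
qed

text \<open>A store has infinitely many tapes, the machine only \<open>k\<close>. Keeping the others
  blank makes \<open>reads s\<close> equal to \<open>symbols_read\<close> at every index.\<close>

definition simulates :: "config \<Rightarrow> com \<times> store \<Rightarrow> bool" where
  "simulates = (\<lambda>(q, ts) (c, s). c \<in> residuals prog \<and> q = code c \<and> length ts = k \<and>
     (\<forall>i<k. represents (ts ! i) (s i)) \<and> (\<forall>i\<ge>k. s i = ([], [])))"

lemma symbols_read_simulates:
  assumes "simulates (q, ts) (c, s)"
  shows "symbols_read (map read_tape ts) = reads s"
proof
  fix i
  show "symbols_read (map read_tape ts) i = reads s i"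
    using assms represents_read[of "ts ! i" "s i"]
    by (cases "i < k") (auto simp: simulates_def symbols_read_def)
qed

lemma simulates_step:
  assumes sim: "simulates cf (c, s)" and c: "c \<noteq> Skip"
  shows "simulates (tm_step machine cf) (zstep (c, s))"
proof -
  obtain q ts where cf: "cf = (q, ts)" by fastforce
  let ?us = "snd (small_step c (reads s))"
  have q: "q = code c" "c \<in> residuals prog" "length ts = k"
    and rep: "\<And>i. i < k \<Longrightarrow> represents (ts ! i) (s i)"
    and blank: "\<And>i. i \<ge> k \<Longrightarrow> s i = ([], [])"
    using sim by (auto simp: simulates_def cf)
  have v: "symbols_read (map read_tape ts) = reads s"
    using symbols_read_simulates sim cf by blast
  have step: "tm_step machine cf = (code (fst (small_step c (reads s))),
     map2 act_tape (map (action ?us (reads s)) [0..<k]) ts)"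
    using q c by (simp add: cf machine_def v decode_code Let_def) (simp add: code_def)
  have "represents (act_tape (action ?us (reads s) i) (ts ! i)) (upd ?us (reads s) s i)" if i: "i < k" for i
  proof (cases "map_of ?us i")
    case None
    have "act_tape (zread (s i), Stay) (ts ! i) = ts ! i"
      using act_tape_read[of "ts ! i"] represents_read[OF rep[OF i]] by simp
    then show ?thesis using None rep[OF i] by (simp add: action_def upd_action)
  next
    case (Some fd)
    then show ?thesis using represents_act[OF rep[OF i]]
      by (auto simp: action_def upd_action split: prod.splits)
  qed
  \<comment> \<open>Well-formed programs act on tapes below \<open>k\<close> only, so the tapes
    beyond stay blank.\<close>
  moreover have "map_of ?us i = None" if "i \<ge> k" for i
    using wf_small_step[OF wf_residuals[OF wf q(2)]] that
    by (cases "map_of ?us i") (auto dest!: map_of_SomeD, force)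
  ultimately show ?thesis
    using q blank small_step_residuals[OF q(2)] unfolding step
    by (auto simp: simulates_def upd_action[of _ _ _ i for i])
qed

lemma simulates_steps:
  "simulates cf (c, s) \<Longrightarrow> (zstep ^^ n) (c, s) = (Skip, s') \<Longrightarrow>
    \<exists>m\<le>n. simulates ((tm_step machine ^^ m) cf) (Skip, s')"
proof (induction n arbitrary: cf c s)
  case (Suc n)
  show ?case
  proof (cases "c = Skip")
    case True
    then show ?thesis using Suc.prems zstep_Skip[of "Suc n" s] by (auto intro: exI[of _ 0])
  next
    case False
    obtain c1 s1 where 1: "zstep (c, s) = (c1, s1)" by fastforce
    then have "(zstep ^^ n) (c1, s1) = (Skip, s')"
      using Suc.prems(2) by (simp only: funpow_Suc_right o_apply)
    moreover have "simulates (tm_step machine cf) (c1, s1)"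
      using simulates_step[OF Suc.prems(1) False] 1 by simp
    ultimately obtain m where "m \<le> n" "simulates ((tm_step machine ^^ m) (tm_step machine cf)) (Skip, s')"
      using Suc.IH by blast
    then show ?thesis
      by (intro exI[of _ "Suc m"]) (simp only: funpow_Suc_right o_apply, simp)
  qed
qed (auto intro: exI[of _ 0])

lemma represents_init: 
  "i < k \<Longrightarrow> represents ((input_tape w # replicate (k - 1) blank_tape) ! i) (init_store w i)"
  by (cases i) (auto simp: init_store_def input_tape_def blank_tape_def nth0_def)

lemma machine_run:
  assumes "exec prog (init_store w) t s'" and "t + 1 \<le> T"
  shows "fst ((tm_step machine ^^ T) (init_config machine w)) = (if zread (s' r) = 0 then 0 else 1)"
proof -
  obtain n where n: "n \<le> t" "(zstep ^^ n) (prog, init_store w) = (Skip, s')"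
    using exec_zstep[OF assms(1)] by blast
  have "simulates (init_config machine w) (prog, init_store w)"
    using r represents_init residuals_refl
    by (auto simp: simulates_def init_config_def machine_def init_store_def)
  from simulates_steps[OF this n(2)] obtain m
    where m: "m \<le> n" "simulates ((tm_step machine ^^ m) (init_config machine w)) (Skip, s')"
    by blast
  obtain q ts where cf: "(tm_step machine ^^ m) (init_config machine w) = (q, ts)" by fastforce
  have q: "q = code Skip" "Skip \<in> residuals prog" using m(2) by (auto simp: cf simulates_def)
  have "symbols_read (map read_tape ts) = reads s'"
    using symbols_read_simulates m(2) cf by metis
  then have "fst ((tm_step machine ^^ Suc m) (init_config machine w)) = (if zread (s' r) = 0 then 0 else 1)"
    using cf q by (simp add: machine_def Let_def decode_code) (simp add: code_def)
  moreover have halted: "fst ((tm_step machine ^^ j) cf') = fst cf'" if "fst cf' \<in> {0, 1}" for j cf'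
  proof -
    have "tm_step machine cf' = cf'" using that by (cases cf') (auto simp: machine_def)
    then have "(tm_step machine ^^ j) cf' = cf'" by (induction j) auto
    then show ?thesis by simp
  qed
  moreover obtain j where j: "T = j + Suc m"
    using le_Suc_ex[of "Suc m" T] assms(2) n(1) m(1) by (auto simp: add.commute)
  have "(tm_step machine ^^ T) (init_config machine w) =
      (tm_step machine ^^ j) ((tm_step machine ^^ Suc m) (init_config machine w))"
    by (simp only: j funpow_add o_apply)
  ultimately show ?thesis by (metis insertI1 insertI2)
qed

end

text \<open>\<open>run\<close> ranges over all words, not only over encodings, because the machine
  has to halt in time on each of them. The bound becomes \<open>q + 1\<close> to include the verdict
  step.\<close>

theorem program_PTIME:
  fixes q :: "nat poly"
  assumes prog: "wf_com k K prog" "3 \<le> K" "r < k"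
    and run: "\<And>w. \<exists>s'. exec prog (init_store w) (poly q (length w)) s' \<and> (zread (s' r) = 0 \<longleftrightarrow> P w)"
  shows "{w. P w} \<in> PTIME"
proof -
  obtain idx :: "com \<Rightarrow> nat" where idx: "inj_on idx (residuals prog)"
    using finite_imp_inj_to_nat_seg[OF finite_residuals] by blast
  note comp = compiled_program.intro[OF prog idx]
  define M where "M = compiled_program.machine prog k K r idx"
  have M: "turing_machine M"
    unfolding M_def by (rule compiled_program.turing_machine_machine[OF comp])
  have "decides_in_time M {w. P w} (poly (q + 1))"
    unfolding decides_in_time_def
  proof
    fix w
    from run[of w] obtain s'
      where s': "exec prog (init_store w) (poly q (length w)) s'" "zread (s' r) = 0 \<longleftrightarrow> P w"
      by (elim exE conjE)
    have "fst ((tm_step M ^^ poly (q + 1) (length w)) (init_config M w)) = (if zread (s' r) = 0 then 0 else 1)"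
      unfolding M_def by (rule compiled_program.machine_run[OF comp s'(1)]) simp
    moreover have "accept M = 0" "reject M = 1"
      by (simp_all add: M_def compiled_program.machine_def[OF comp])
    ultimately show "fst ((tm_step M ^^ poly (q + 1) (length w)) (init_config M w)) =
       (if w \<in> {w. P w} then accept M else reject M)"
      using s'(2) by simp
  qed
  with M show ?thesis unfolding PTIME_def by blast
qed

section \<open>Building blocks\<close>

text \<open>
  Tapes of the decision procedure: 0 input, erased while it is read; 1 modulus; 2 accumulators;
  3 current entry; 4 carry; 5 flag; 6 verdict, where blank means acceptance; 7 and 8 the dimension
  in unary; 9 types of the entries.
\<close>

lemma exec_Loop_Act:
  assumes "P (reads s)" "exec (Loop P (Act us)) (upd us (reads s) s) t s'" "t + 3 \<le> T"
  shows "exec (Loop P (Act us)) s T s'"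
  \<comment> \<open>A round costs 1 for the action and 2 for the loop, which explains the many
    bounds of the form \<open>3 * m + 1\<close>.\<close>
  by (rule exec_LoopT[where ?t1.0 = 1 and ?t2.0 = t])
    (use assms in \<open>auto intro: exec_Act\<close>)

lemma exec_LoopF': "\<not> P (reads s) \<Longrightarrow> s' = s \<Longrightarrow> 1 \<le> t \<Longrightarrow> exec (Loop P a) s t s'"
  by (simp add: exec_LoopF)

lemma exec_Seq': "exec a s t1 s1 \<Longrightarrow> exec b s1 t2 s2 \<Longrightarrow> exec (a ;; b) s (t1 + t2 + 1) s2"
  by (rule exec_Seq) auto

text \<open>A tape used as a register: the head stays on the only cell.\<close>

definition reg :: "nat \<Rightarrow> zipper" where
  "reg v = ([], push v [])"

lemma zread_reg [simp]: "zread (reg v) = v"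
  by (simp add: reg_def push_def)

lemma zact_reg [simp]: "zact a Stay (reg v) = reg a"
  by (simp add: reg_def push_def)

lemma reg_0: "reg 0 = ([], [])"
  by (simp add: reg_def)

lemma push_pos [simp]: "a \<noteq> 0 \<Longrightarrow> push a xs = a # xs"
  by (simp add: push_def)

lemma push_hd0_tl [simp]: "0 \<notin> set r \<Longrightarrow> push (hd0 r) (tl r) = r"
  by (cases r) auto

lemma tl_push [simp]: "tl (push a r) = r"
  by (simp add: push_def)

abbreviation copy :: "nat \<Rightarrow> dir \<Rightarrow> nat \<times> ((nat \<Rightarrow> nat) \<Rightarrow> nat) \<times> dir" where
  "copy t d \<equiv> (t, \<lambda>x. x t, d)"

abbreviation put :: "nat \<Rightarrow> nat \<Rightarrow> dir \<Rightarrow> nat \<times> ((nat \<Rightarrow> nat) \<Rightarrow> nat) \<times> dir" where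
  "put t a d \<equiv> (t, \<lambda>_. a, d)"

text \<open>The head may already stand on the blank behind the word, so a move precedes the first
  test. The loop ends on the blank in front of the word, and the last move steps back onto its first
  symbol.\<close>

definition rewind :: "nat \<Rightarrow> com" where
  "rewind t = Act [copy t Move_Left] ;; Loop (\<lambda>x. x t \<noteq> 0) (Act [copy t Move_Left]) ;;
     Act [copy t Move_Right]"

text \<open>\<open>q\<close> lists the symbols still to be passed, starting with the one under the
  head; \<open>q = []\<close> is the blank in front of the word.\<close>

lemma rewind_loop:
  assumes "s t = (tl q, push (hd0 q) r)" "0 \<notin> set q" "s' = s(t := ([], push 0 (rev q @ r)))"
    "3 * length q + 1 \<le> T"
  shows "exec (Loop (\<lambda>x. x t \<noteq> 0) (Act [copy t Move_Left])) s T s'"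
  using assms
proof (induction q arbitrary: s r T)
  case Nil
  then show ?case by (intro exec_LoopF') (auto simp: fun_eq_iff)
next
  case (Cons x q)
  show ?case
    by (rule exec_Loop_Act[OF _ Cons.IH[where r = "x # r" and T = "3 * length q + 1"]])
      (use Cons.prems in \<open>auto simp: fun_eq_iff\<close>)
qed

lemma exec_rewind:
  assumes "s t = (l, r)" "0 \<notin> set l" "0 \<notin> set r" "s' = s(t := ([], rev l @ r))"
    "3 * length l + 6 \<le> T"
  shows "exec (rewind t) s T s'"
proof -
  have "exec (rewind t) s (1 + ((3 * length l + 1) + 1 + 1) + 1) s'"
    unfolding rewind_def
  proof (intro exec_Seq')
    show "exec (Act [copy t Move_Left]) s 1 (s(t := (tl l, push (hd0 l) r)))"
      by (rule exec_Act) (use assms in auto)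
    show "exec (Loop (\<lambda>x. x t \<noteq> 0) (Act [copy t Move_Left])) (s(t := (tl l, push (hd0 l) r)))
        (3 * length l + 1) (s(t := ([], push 0 (rev l @ r))))"
      by (rule rewind_loop) (use assms in auto)
    show "exec (Act [copy t Move_Right]) (s(t := ([], push 0 (rev l @ r)))) 1 s'"
      by (rule exec_Act) (use assms in auto)
  qed
  then show ?thesis by (rule exec_mono) (use assms in simp)
qed

text \<open>Tape 2 moves left in lockstep with tape 1, as it carries no end marker of its own.\<close>

definition rewind_both :: com where
  "rewind_both = Act [copy 1 Move_Left] ;;
     Loop (\<lambda>x. x 1 \<noteq> 0) (Act [copy 1 Move_Left, copy 2 Move_Left]) ;; Act [copy 1 Move_Right]"

lemma rewind_both_loop:
  assumes "s 1 = (tl q, push (hd0 q) r)" "s 2 = (q2 @ l2, r2)" "length q2 = length q"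
    "0 \<notin> set q" "0 \<notin> set q2" "0 \<notin> set r2"
    "s' = s(1 := ([], push 0 (rev q @ r)), 2 := (l2, rev q2 @ r2))" "3 * length q + 1 \<le> T"
  shows "exec (Loop (\<lambda>x. x 1 \<noteq> 0) (Act [copy 1 Move_Left, copy 2 Move_Left])) s T s'"
  using assms
proof (induction q arbitrary: s r q2 r2 T)
  case Nil
  then show ?case by (intro exec_LoopF') (auto simp: fun_eq_iff)
next
  case (Cons x q)
  then obtain y q2' where q2: "q2 = y # q2'" by (cases q2) auto
  show ?case
    by (rule exec_Loop_Act[OF _ Cons.IH[where r = "x # r" and ?q2.0 = q2' and ?r2.0 = "y # r2"
            and T = "3 * length q + 1"]])
      (use Cons.prems q2 in \<open>auto simp: fun_eq_iff\<close>)
qed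

text \<open>Only tape 1 makes the extra moves before and after the loop. Thus tape 2 goes back by
  exactly \<open>length ps\<close> cells, the width of one accumulator.\<close>

lemma exec_rewind_both:
  assumes "s 1 = (rev ps, [])" "s 2 = (rev ds @ l2, r2)" "length ds = length ps"
    "0 \<notin> set ps" "0 \<notin> set ds" "0 \<notin> set r2"
    "s' = s(1 := ([], ps), 2 := (l2, ds @ r2))" "3 * length ps + 6 \<le> T"
  shows "exec rewind_both s T s'"
proof -
  let ?s1 = "s(1 := (tl (rev ps), push (hd0 (rev ps)) []))"
  let ?s2 = "s(1 := ([], push 0 ps), 2 := (l2, ds @ r2))"
  have "exec rewind_both s (1 + ((3 * length ps + 1) + 1 + 1) + 1) s'"
    unfolding rewind_both_def
  proof (intro exec_Seq')
    show "exec (Act [copy 1 Move_Left]) s 1 ?s1"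
      by (rule exec_Act) (use assms in auto)
    show "exec (Loop (\<lambda>x. x 1 \<noteq> 0) (Act [copy 1 Move_Left, copy 2 Move_Left])) ?s1
        (3 * length ps + 1) ?s2"
      by (rule rewind_both_loop[where q = "rev ps" and ?q2.0 = "rev ds" and r = "[]"])
        (use assms in \<open>auto simp: fun_eq_iff\<close>)
    show "exec (Act [copy 1 Move_Right]) ?s2 1 s'"
      by (rule exec_Act) (use assms in \<open>auto simp: fun_eq_iff\<close>)
  qed
  then show ?thesis by (rule exec_mono) (use assms in simp)
qed

definition erase :: "nat \<Rightarrow> com" where
  "erase t = Loop (\<lambda>x. x t \<noteq> 0) (Act [put t 0 Move_Right])"

lemma exec_erase:
  assumes "s t = ([], r)" "0 \<notin> set r" "s' = s(t := ([], []))" "3 * length r + 1 \<le> T"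
  shows "exec (erase t) s T s'"
  using assms unfolding erase_def
proof (induction r arbitrary: s T)
  case Nil
  then show ?case by (intro exec_LoopF') (auto simp: fun_eq_iff)
next
  case (Cons x r)
  show ?case
    by (rule exec_Loop_Act[OF _ Cons.IH[where T = "3 * length r + 1"]])
      (use Cons.prems in \<open>auto simp: fun_eq_iff\<close>)
qed

text \<open>The number is copied twice because the types are written by two nested loops. Blanking
  the cells read keeps the left half of tape 0 empty.\<close>

definition read_unary :: com where
  "read_unary = Loop (\<lambda>x. x 0 = 2)
     (Act [put 0 0 Move_Right, put 7 1 Move_Right, put 8 1 Move_Right])"

lemma exec_read_unary:
  assumes "s 0 = ([], r)" "s 7 = (l, [])" "s 8 = (l', [])" "n = length (takeWhile (\<lambda>x. x = 2) r)"
    "s' = s(0 := ([], drop n r), 7 := (replicate n 1 @ l, []), 8 := (replicate n 1 @ l', []))"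
    "3 * n + 1 \<le> T"
  shows "exec read_unary s T s'"
  using assms unfolding read_unary_def
proof (induction r arbitrary: s l l' T n)
  case Nil
  then show ?case by (intro exec_LoopF') (auto simp: fun_eq_iff)
next
  case (Cons x r)
  show ?case
  proof (cases "x = 2")
    case True
    let ?n = "length (takeWhile (\<lambda>x. x = 2) r)"
    show ?thesis
      by (rule exec_Loop_Act[OF _ Cons.IH[where l = "1 # l" and l' = "1 # l'" and n = ?n and T = "3 * ?n + 1"]])
        (use Cons.prems True in \<open>auto simp: fun_eq_iff replicate_app_Cons_same\<close>)
  next
    case False
    then show ?thesis using Cons.prems by (intro exec_LoopF') (auto simp: fun_eq_iff)
  qed
qed

text \<open>On tapes 1 to 3 a bit is the digit \<open>1\<close> or \<open>2\<close>, since \<open>0\<close> is the blank.\<close>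

definition digit :: "nat \<Rightarrow> nat" where
  "digit x = (if x = 2 then 2 else 1)"

lemma digit_pos [simp]: "digit x \<noteq> 0" "0 < digit x"
  by (simp_all add: digit_def)

text \<open>The terminator stays in front of the rest and is skipped by the caller. The case
  \<open>[x]\<close> is a truncated code, possible on words that encode nothing; the missing digit
  is a blank and read as 0.\<close>

fun split_number :: "nat list \<Rightarrow> nat list \<times> nat list" where
  "split_number (x # y # r) =
     (if x = 2 then (digit y # fst (split_number r), snd (split_number r)) else ([], x # y # r))"
| "split_number [x] = (if x = 2 then ([1], []) else ([], [x]))"
| "split_number [] = ([], [])"

text \<open>The flag is raised in passing, when a digit \<open>True\<close> of an entry of type 4 is
  read. While the modulus is read, tape 9 is still blank and the flag keeps its value.\<close>

definition read_number :: "nat \<Rightarrow> com" where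
  "read_number t = Loop (\<lambda>x. x 0 = 2)
     (Act [put 0 0 Move_Right] ;;
      Act [put 0 0 Move_Right, (t, \<lambda>x. digit (x 0), Move_Right),
           (5, \<lambda>x. if x 0 = 2 \<and> x 9 = 4 then 1 else x 5, Stay)])"

lemma exec_read_number:
  assumes "s 0 = ([], r)" "s t = (l, [])" "s 5 = reg fl" "t \<notin> {0, 5, 9}"
    "s' = s(0 := ([], snd (split_number r)), t := (rev (fst (split_number r)) @ l, []),
       5 := reg (if zread (s 9) = 4 \<and> 2 \<in> set (fst (split_number r)) then 1 else fl))"
    "5 * length (fst (split_number r)) + 1 \<le> T"
  shows "exec (read_number t) s T s'"
  using assms unfolding read_number_def
proof (induction r arbitrary: s l fl T rule: split_number.induct)
  case (1 x y r)
  show ?case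
  proof (cases "x = 2")
    case True
    let ?s1 = "s(0 := ([], y # r))"
    let ?s2 = "s(0 := ([], r), t := (digit y # l, []),
       5 := reg (if y = 2 \<and> zread (s 9) = 4 then 1 else fl))"
    show ?thesis
    proof (rule exec_LoopT)
      show "exec (Act [put 0 0 Move_Right] ;;
          Act [put 0 0 Move_Right, (t, \<lambda>x. digit (x 0), Move_Right),
           (5, \<lambda>x. if x 0 = 2 \<and> x 9 = 4 then 1 else x 5, Stay)]) s (1 + 1 + 1) ?s2"
      proof (rule exec_Seq')
        show "exec (Act [put 0 0 Move_Right]) s 1 ?s1"
          by (rule exec_Act) (use 1 True in auto)
        show "exec (Act [put 0 0 Move_Right, (t, \<lambda>x. digit (x 0), Move_Right),
           (5, \<lambda>x. if x 0 = 2 \<and> x 9 = 4 then 1 else x 5, Stay)]) ?s1 1 ?s2"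
          by (rule exec_Act) (use 1 True in \<open>auto simp: fun_eq_iff\<close>)
      qed
      show "exec (Loop (\<lambda>x. x 0 = 2)
         (Act [put 0 0 Move_Right] ;;
          Act [put 0 0 Move_Right, (t, \<lambda>x. digit (x 0), Move_Right),
               (5, \<lambda>x. if x 0 = 2 \<and> x 9 = 4 then 1 else x 5, Stay)])) ?s2
         (5 * length (fst (split_number r)) + 1) s'"
        by (rule 1(1)[OF True])
          (use 1(2-) True in \<open>auto simp: fun_eq_iff digit_def\<close>)
    qed (use 1 True in auto)
  next
    case False
    then show ?thesis using 1 by (intro exec_LoopF') (auto simp: fun_eq_iff)
  qed
next
  case (2 x)
  show ?case
  proof (cases "x = 2")
    case True
    let ?s1 = "s(0 := ([], []))"
    let ?s2 = "s(0 := ([], []), t := (1 # l, []))"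
    show ?thesis
    proof (rule exec_LoopT)
      show "exec (Act [put 0 0 Move_Right] ;;
          Act [put 0 0 Move_Right, (t, \<lambda>x. digit (x 0), Move_Right),
           (5, \<lambda>x. if x 0 = 2 \<and> x 9 = 4 then 1 else x 5, Stay)]) s (1 + 1 + 1) ?s2"
      proof (rule exec_Seq')
        show "exec (Act [put 0 0 Move_Right]) s 1 ?s1"
          by (rule exec_Act) (use 2 True in auto)
        show "exec (Act [put 0 0 Move_Right, (t, \<lambda>x. digit (x 0), Move_Right),
           (5, \<lambda>x. if x 0 = 2 \<and> x 9 = 4 then 1 else x 5, Stay)]) ?s1 1 ?s2"
          by (rule exec_Act) (use 2 True in \<open>auto simp: fun_eq_iff digit_def\<close>)
      qed
      show "exec (Loop (\<lambda>x. x 0 = 2)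
         (Act [put 0 0 Move_Right] ;;
          Act [put 0 0 Move_Right, (t, \<lambda>x. digit (x 0), Move_Right),
               (5, \<lambda>x. if x 0 = 2 \<and> x 9 = 4 then 1 else x 5, Stay)])) ?s2 1 s'"
        by (rule exec_LoopF') (use 2 True in \<open>auto simp: fun_eq_iff\<close>)
    qed (use 2 True in auto)
  next
    case False
    then show ?thesis using 2 by (intro exec_LoopF') (auto simp: fun_eq_iff)
  qed
next
  case 3
  then show ?case by (intro exec_LoopF') (auto simp: fun_eq_iff)
qed

section \<open>Modular addition\<close>

definition bit_value :: "nat \<Rightarrow> int" where
  "bit_value x = (if x = 2 then 1 else 0)"

lemma bit_value_bounds: "0 \<le> bit_value x" "bit_value x \<le> 1"
  by (simp_all add: bit_value_def)

text \<open>
  One pass replaces the accumulator \<open>a\<close> by \<open>a + e - p\<close> or by \<open>a + p\<close>; the signed carry \<open>c\<close>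
  from \<open>{-1, 0, 1}\<close> is kept on tape 4 as \<open>c + 1\<close>.
\<close>

definition column :: "bool \<Rightarrow> nat \<Rightarrow> nat \<Rightarrow> nat \<Rightarrow> int \<Rightarrow> int" where
  "column b p e a c = bit_value a + (if b then bit_value e - bit_value p else bit_value p) + c"

text \<open>As \<open>div\<close> rounds down, \<open>d = d mod 2 + 2 * (d div 2)\<close> holds for
  negative columns too: the parity is the digit, the quotient the signed carry.\<close>

definition result_digit :: "int \<Rightarrow> nat" where
  "result_digit d = (if odd d then 2 else 1)"

lemma result_digit_pos [simp]: "result_digit d \<noteq> 0" "0 < result_digit d"
  by (simp_all add: result_digit_def)

text \<open>The pass is as long as the modulus, and missing digits of the other operands are blanks
  of value 0. So the accumulators start on an empty tape without initialisation.\<close>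

fun add_pass :: "bool \<Rightarrow> nat list \<Rightarrow> nat list \<Rightarrow> nat list \<Rightarrow> int \<Rightarrow> nat list \<times> int" where
  "add_pass b [] es r c = ([], c)"
| "add_pass b (p # ps) es r c =
     (result_digit (column b p (hd0 es) (hd0 r) c) #
        fst (add_pass b ps (tl es) (tl r) (column b p (hd0 es) (hd0 r) c div 2)),
      snd (add_pass b ps (tl es) (tl r) (column b p (hd0 es) (hd0 r) c div 2)))"

lemma length_add_pass [simp]: "length (fst (add_pass b ps es r c)) = length ps"
  by (induction ps arbitrary: es r c) auto

lemma add_pass_nonzero [simp]: "0 \<notin> set (fst (add_pass b ps es r c))"
  by (induction ps arbitrary: es r c) auto

text \<open>The second pass does not depend on the accumulators further right on tape 2, nor on what
  remains on tape 3.\<close>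

lemma add_pass_False: "length ds = length ps \<Longrightarrow> add_pass False ps es (ds @ r) c = add_pass False ps [] ds c"
proof (induction ps arbitrary: es ds c)
  case (Cons p ps)
  then obtain d ds' where "ds = d # ds'" "length ds' = length ps" by (cases ds) auto
  then show ?case using Cons.IH by (simp add: column_def)
qed simp

definition pass :: "bool \<Rightarrow> com" where
  "pass b = Loop (\<lambda>x. x 1 \<noteq> 0)
     (Act [copy 1 Move_Right,
           (2, \<lambda>x. result_digit (column b (x 1) (x 3) (x 2) (int (x 4) - 1)), Move_Right),
           put 3 0 Move_Right,
           (4, \<lambda>x. nat (column b (x 1) (x 3) (x 2) (int (x 4) - 1) div 2 + 1), Stay)])"

lemma exec_pass:
  assumes "s 1 = (l1, ps)" "0 \<notin> set ps" "s 2 = (l2, r)" "s 3 = ([], es)" "s 4 = reg (nat (c + 1))"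
    "- 1 \<le> c" "A = add_pass b ps es r c"
    "s' = s(1 := (rev ps @ l1, []), 2 := (rev (fst A) @ l2, drop (length ps) r),
       3 := ([], drop (length ps) es), 4 := reg (nat (snd A + 1)))"
    "3 * length ps + 1 \<le> T"
  shows "exec (pass b) s T s'"
  using assms unfolding pass_def
proof (induction ps arbitrary: s l1 l2 r es c T A)
  case Nil
  then show ?case by (intro exec_LoopF') (auto simp: fun_eq_iff)
next
  case (Cons p ps)
  let ?d = "column b p (hd0 es) (hd0 r) c"
  have d: "- 1 \<le> ?d div 2"
    using Cons.prems(6) bit_value_bounds[of "hd0 r"] bit_value_bounds[of "hd0 es"] bit_value_bounds[of p]
    by (auto simp: column_def)
  have c: "0 \<le> c + 1" using Cons.prems(6) by simp
  show ?case
    by (rule exec_Loop_Act[OF _ Cons.IH[where c = "?d div 2" and ?l1.0 = "p # l1" and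
          ?l2.0 = "result_digit ?d # l2" and r = "tl r" and es = "tl es" and T = "3 * length ps + 1"]])
      (use Cons.prems(1-5,7-) c d in \<open>auto simp: fun_eq_iff drop_Suc\<close>)
qed

text \<open>For \<open>a\<close> and \<open>e\<close> below \<open>p\<close>, the final carry is -1
  exactly if \<open>a + e - p\<close> is negative. Then the subtraction is undone by adding
  \<open>p\<close> modulo a power of 2.\<close>

definition add_mod :: "nat list \<Rightarrow> nat list \<Rightarrow> nat list \<Rightarrow> nat list" where
  "add_mod ps es r = (if snd (add_pass True ps es r 0) = -1
     then fst (add_pass False ps [] (fst (add_pass True ps es r 0)) 0)
     else fst (add_pass True ps es r 0))"

lemma length_add_mod [simp]: "length (add_mod ps es r) = length ps"
  by (simp add: add_mod_def)

lemma add_mod_nonzero [simp]: "0 \<notin> set (add_mod ps es r)"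
  by (simp add: add_mod_def)

text \<open>The carry -1 is stored as the symbol 0, hence the test. \<open>erase 3\<close> clears
  what is left of an entry with more digits than the modulus, as some words that encode no instance
  contain.\<close>

definition accumulate :: com where
  "accumulate = Act [put 4 1 Stay] ;; pass True ;;
     Cond (\<lambda>x. x 4 = 0) (rewind_both ;; Act [put 4 1 Stay] ;; pass False) Skip ;;
     rewind 1 ;; erase 3"

lemma drop_nonzero: "0 \<notin> set r \<Longrightarrow> 0 \<notin> set (drop n r)" for r :: "nat list"
  by (meson in_set_dropD)

lemma exec_accumulate:
  assumes s: "s 1 = ([], ps)" "0 \<notin> set ps" "s 2 = (l2, r)" "0 \<notin> set r" "s 3 = ([], es)" "0 \<notin> set es"
    "s 4 = reg v" and T: "12 * length ps + 3 * length es + 40 \<le> T"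
  shows "\<exists>v'. exec accumulate s T
    (s(2 := (rev (add_mod ps es r) @ l2, drop (length ps) r), 3 := ([], []), 4 := reg v'))"
proof -
  let ?w = "length ps"
  let ?A = "add_pass True ps es r 0"
  let ?B = "add_pass False ps [] (fst ?A) 0"
  let ?s0 = "s(4 := reg 1)"
  let ?s1 = "s(1 := (rev ps, []), 2 := (rev (fst ?A) @ l2, drop ?w r), 3 := ([], drop ?w es),
     4 := reg (nat (snd ?A + 1)))"
  have 1: "exec (Act [put 4 1 Stay]) s 1 ?s0"
    by (rule exec_Act) (use s in auto)
  have 2: "exec (pass True) ?s0 (3 * ?w + 1) ?s1"
    by (rule exec_pass[where c = 0 and A = ?A]) (use s in \<open>auto simp: fun_eq_iff\<close>)
  \<comment> \<open>With -1 as the least carry, \<open>snd ?A \<noteq> -1\<close> means that tape 4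
    shows a nonzero symbol.\<close>
  have carry: "- 1 \<le> snd (add_pass b ps es r c)" if "- 1 \<le> c" for b ps es r c
    using that
  proof (induction ps arbitrary: es r c)
    case (Cons p ps)
    have "- 1 \<le> column b p (hd0 es) (hd0 r) c div 2"
      using Cons.prems bit_value_bounds[of "hd0 r"] bit_value_bounds[of "hd0 es"] bit_value_bounds[of p]
      by (auto simp: column_def)
    then show ?case using Cons.IH by simp
  qed simp
  \<comment> \<open>\<open>k\<close> is \<open>?w\<close> or \<open>?w + ?w\<close>, since the
    second pass also moves along tape 3; the final erasing removes the difference.\<close>
  have "\<exists>k v'. exec (Cond (\<lambda>x. x 4 = 0) (rewind_both ;; Act [put 4 1 Stay] ;; pass False) Skip) ?s1
     (6 * ?w + 20) (s(1 := (rev ps, []), 2 := (rev (add_mod ps es r) @ l2, drop ?w r),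
       3 := ([], drop k es), 4 := reg v'))"
  proof (cases "snd ?A = -1")
    case True
    let ?s2 = "?s1(1 := ([], ps), 2 := (l2, fst ?A @ drop ?w r))"
    let ?s3 = "?s2(4 := reg 1)"
    let ?s4 = "s(1 := (rev ps, []), 2 := (rev (add_mod ps es r) @ l2, drop ?w r),
       3 := ([], drop (?w + ?w) es), 4 := reg (nat (snd ?B + 1)))"
    have "exec (rewind_both ;; Act [put 4 1 Stay] ;; pass False) ?s1
       ((3 * ?w + 6) + (1 + (3 * ?w + 1) + 1) + 1) ?s4"
    proof (intro exec_Seq')
      show "exec rewind_both ?s1 (3 * ?w + 6) ?s2"
        by (rule exec_rewind_both[where ps = ps and ds = "fst ?A" and ?l2.0 = l2 and ?r2.0 = "drop ?w r"])
          (use s drop_nonzero[OF s(4)] in \<open>auto simp: fun_eq_iff\<close>)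
      show "exec (Act [put 4 1 Stay]) ?s2 1 ?s3"
        by (rule exec_Act) auto
      show "exec (pass False) ?s3 (3 * ?w + 1) ?s4"
        by (rule exec_pass[where c = 0 and A = ?B and ps = ps and r = "fst ?A @ drop ?w r"
              and es = "drop ?w es" and ?l1.0 = "[]" and ?l2.0 = l2])
          (use s True in \<open>auto simp: fun_eq_iff add_pass_False add_mod_def\<close>)
    qed
    then have "exec (Cond (\<lambda>x. x 4 = 0) (rewind_both ;; Act [put 4 1 Stay] ;; pass False) Skip) ?s1
       (6 * ?w + 20) ?s4"
      by (rule exec_CondT[rotated]) (use True in auto)
    then show ?thesis by blast
  next
    case False
    with carry[of 0 True ps es r] have "snd ?A + 1 > 0" by simp
    then have "exec (Cond (\<lambda>x. x 4 = 0) (rewind_both ;; Act [put 4 1 Stay] ;; pass False) Skip) ?s1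
       (6 * ?w + 20) ?s1"
      by (intro exec_CondF[OF _ exec_Skip[of _ 0]]) auto
    moreover have "?s1 = s(1 := (rev ps, []), 2 := (rev (add_mod ps es r) @ l2, drop ?w r),
       3 := ([], drop ?w es), 4 := reg (nat (snd ?A + 1)))"
      using False by (simp add: add_mod_def)
    ultimately show ?thesis by metis
  qed
  then obtain k v' where 3: "exec (Cond (\<lambda>x. x 4 = 0) (rewind_both ;; Act [put 4 1 Stay] ;; pass False) Skip) ?s1
     (6 * ?w + 20) (s(1 := (rev ps, []), 2 := (rev (add_mod ps es r) @ l2, drop ?w r),
       3 := ([], drop k es), 4 := reg v'))" (is "exec _ _ _ ?s5") by blast
  let ?s6 = "?s5(1 := ([], ps))"
  have 4: "exec (rewind 1) ?s5 (3 * ?w + 6) ?s6"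
    by (rule exec_rewind[where l = "rev ps" and r = "[]"]) (use s in auto)
  have 5: "exec (erase 3) ?s6 (3 * length es + 1)
      (s(2 := (rev (add_mod ps es r) @ l2, drop ?w r), 3 := ([], []), 4 := reg v'))"
    by (rule exec_erase[where r = "drop k es"]) (use s drop_nonzero[OF s(6)] in \<open>auto simp: fun_eq_iff\<close>)
  have "exec accumulate s (1 + ((3 * ?w + 1) + ((6 * ?w + 20) + ((3 * ?w + 6) +
      (3 * length es + 1) + 1) + 1) + 1) + 1)
      (s(2 := (rev (add_mod ps es r) @ l2, drop ?w r), 3 := ([], []), 4 := reg v'))"
    unfolding accumulate_def by (intro exec_Seq') (rule 1 2 3 4 5)+
  then show ?thesis using T by (intro exI[of _ v']) (erule exec_mono, simp)
qed

section \<open>Processing the entries\<close>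

text \<open>
  Tape 2 holds one accumulator of \<open>length ps\<close> digits for every entry of a matrix, tape 9 the
  types of the entries: 3 on the diagonal, 5 in the corner and 4 elsewhere. A state consists of
  what is to the left and to the right of the heads on these tapes and of the flag recording a
  nonzero entry of type 4.
\<close>

type_synonym state = "nat list \<times> nat list \<times> nat list \<times> nat list \<times> nat"

text \<open>Reaching the last type means that a matrix is complete. Both tapes are then rewound, and
  the next matrix is added to the same accumulators.\<close>

fun entry_step :: "nat list \<Rightarrow> state \<Rightarrow> nat list \<Rightarrow> state" where
  "entry_step ps (a1, a2, t1, t2, fl) es =
     (let a1' = a1 @ add_mod ps es a2; a2' = drop (length ps) a2;
          fl' = (if hd0 t2 = 4 \<and> 2 \<in> set es then 1 else fl)
      in if tl t2 = [] then ([], a1' @ a2', [], t1 @ t2, fl')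
         else (a1', a2', t1 @ [hd0 t2], tl t2, fl'))"

definition entry_body :: com where
  "entry_body = read_number 3 ;; Act [put 0 0 Move_Right] ;; rewind 3 ;; accumulate ;;
     Act [copy 9 Move_Right] ;; Cond (\<lambda>x. x 9 = 0) (rewind 9 ;; rewind 2) Skip"

text \<open>Blanks are excluded because loops and rewinds stop at them;
  \<open>t2 \<noteq> []\<close> says that the head on tape 9 stands on a type. Tapes 7 and 8 are
  left free.\<close>

fun state_ok :: "nat list \<Rightarrow> nat list \<Rightarrow> state \<Rightarrow> store \<Rightarrow> bool" where
  "state_ok ps r (a1, a2, t1, t2, fl) s \<longleftrightarrow>
     s 0 = ([], r) \<and> s 1 = ([], ps) \<and> s 2 = (rev a1, a2) \<and> s 3 = ([], []) \<and> (\<exists>v. s 4 = reg v) \<and>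
     s 5 = reg fl \<and> s 6 = reg 0 \<and> s 9 = (rev t1, t2) \<and>
     0 \<notin> set r \<and> 0 \<notin> set ps \<and> 0 \<notin> set a1 \<and> 0 \<notin> set a2 \<and> 0 \<notin> set t1 \<and> 0 \<notin> set t2 \<and> t2 \<noteq> []"

lemma split_number_nonzero: "0 \<notin> set (fst (split_number r))"
  by (induction r rule: split_number.induct) auto

lemma set_split_number: "set (snd (split_number r)) \<subseteq> set r"
  by (induction r rule: split_number.induct) auto

lemma length_split_number: "length (fst (split_number r)) + length (snd (split_number r)) \<le> length r"
  by (induction r rule: split_number.induct) auto

text \<open>The 11 per input symbol is 5 for reading a digit, 3 for rewinding tape 3 and 3 for
  erasing it. The terms in \<open>a1\<close> and \<open>t1\<close> pay for the rewinds at the end of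
  a matrix.\<close>

lemma exec_entry_body:
  assumes ok: "state_ok ps r (a1, a2, t1, t2, fl) s"
    and T: "12 * length ps + 11 * length r + 3 * (length a1 + length ps) + 3 * length t1 + 80 \<le> T"
  shows "\<exists>s'. exec entry_body s T s' \<and> state_ok ps (tl (snd (split_number r)))
     (entry_step ps (a1, a2, t1, t2, fl) (fst (split_number r))) s'"
proof -
  let ?es = "fst (split_number r)" and ?r' = "snd (split_number r)" and ?w = "length ps"
  let ?fl = "if hd0 t2 = 4 \<and> 2 \<in> set ?es then 1 else fl"
  let ?a = "rev (add_mod ps ?es a2) @ rev a1"
  note es0 = split_number_nonzero[of r]
  have s: "s 0 = ([], r)" "s 1 = ([], ps)" "s 2 = (rev a1, a2)" "s 3 = ([], [])" "s 5 = reg fl"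
    "s 6 = reg 0" "s 9 = (rev t1, t2)"
    and nz: "0 \<notin> set r" "0 \<notin> set ps" "0 \<notin> set a1" "0 \<notin> set a2" "0 \<notin> set t1" "0 \<notin> set t2" "t2 \<noteq> []"
    using ok by auto
  obtain v where v: "s 4 = reg v" using ok by auto
  obtain t t3 where t2: "t2 = t # t3" "t \<noteq> 0" using nz by (cases t2) auto
  have r0: "0 \<notin> set (tl ?r')"
    using set_split_number[of r] nz(1) by (cases ?r') auto
  let ?s1 = "s(0 := ([], ?r'), 3 := (rev ?es, []), 5 := reg ?fl)"
  have 1: "exec (read_number 3) s (5 * length ?es + 1) ?s1"
    by (rule exec_read_number[where l = "[]" and fl = fl and r = r]) (use s in auto)
  let ?s2 = "?s1(0 := ([], tl ?r'))"
  have 2: "exec (Act [put 0 0 Move_Right]) ?s1 1 ?s2"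
    by (rule exec_Act) auto
  let ?s3 = "?s2(3 := ([], ?es))"
  have 3: "exec (rewind 3) ?s2 (3 * length ?es + 6) ?s3"
    by (rule exec_rewind[where l = "rev ?es" and r = "[]"]) (use es0 in auto)
  have "\<exists>v'. exec accumulate ?s3 (12 * ?w + 3 * length ?es + 40)
      (?s3(2 := (?a, drop ?w a2), 3 := ([], []), 4 := reg v'))"
    by (rule exec_accumulate) (use s nz v es0 in auto)
  then obtain v' where 4: "exec accumulate ?s3 (12 * ?w + 3 * length ?es + 40)
      (?s3(2 := (?a, drop ?w a2), 3 := ([], []), 4 := reg v'))" (is "exec _ _ _ ?s4") ..
  let ?s5 = "?s4(9 := (t # rev t1, t3))"
  have 5: "exec (Act [copy 9 Move_Right]) ?s4 1 ?s5"
    by (rule exec_Act) (use s t2 in auto)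
  have nz': "0 \<notin> set t3" "0 \<notin> set (drop ?w a2)"
    using nz t2 drop_nonzero by auto
  have "\<exists>s'. exec (Cond (\<lambda>x. x 9 = 0) (rewind 9 ;; rewind 2) Skip) ?s5
      (3 * (length a1 + ?w) + 3 * length t1 + 20) s' \<and> state_ok ps (tl ?r')
       (entry_step ps (a1, a2, t1, t2, fl) ?es) s'"
  proof (cases "t3 = []")
    case True
    let ?s6 = "?s5(9 := ([], rev (t # rev t1)))"
    let ?s7 = "?s6(2 := ([], rev ?a @ drop ?w a2))"
    have "exec (rewind 9 ;; rewind 2) ?s5 ((3 * length (t # rev t1) + 6) + (3 * length ?a + 6) + 1) ?s7"
    proof (rule exec_Seq')
      show "exec (rewind 9) ?s5 (3 * length (t # rev t1) + 6) ?s6"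
        by (rule exec_rewind[where l = "t # rev t1" and r = "[]"]) (use nz t2 True in auto)
      show "exec (rewind 2) ?s6 (3 * length ?a + 6) ?s7"
        by (rule exec_rewind[where l = ?a and r = "drop ?w a2"]) (use nz nz' in auto)
    qed
    then have "exec (Cond (\<lambda>x. x 9 = 0) (rewind 9 ;; rewind 2) Skip) ?s5
       (3 * (length a1 + ?w) + 3 * length t1 + 20) ?s7"
      by (rule exec_CondT[rotated]) (use True in auto)
    moreover have "state_ok ps (tl ?r') (entry_step ps (a1, a2, t1, t2, fl) ?es) ?s7"
      using True t2 s nz nz' r0 by (auto simp: Let_def)
    ultimately show ?thesis by metis
  next
    case False
    then obtain u t4 where t3: "t3 = u # t4" by (cases t3) auto
    have "exec (Cond (\<lambda>x. x 9 = 0) (rewind 9 ;; rewind 2) Skip) ?s5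
       (3 * (length a1 + ?w) + 3 * length t1 + 20) ?s5"
      by (rule exec_CondF[OF _ exec_Skip[of _ 0]]) (use t3 nz' in auto)
    moreover have "state_ok ps (tl ?r') (entry_step ps (a1, a2, t1, t2, fl) ?es) ?s5"
      using t3 t2 s nz nz' r0 by (auto simp: Let_def)
    ultimately show ?thesis by metis
  qed
  then obtain s' where 6: "exec (Cond (\<lambda>x. x 9 = 0) (rewind 9 ;; rewind 2) Skip) ?s5
      (3 * (length a1 + ?w) + 3 * length t1 + 20) s'"
    and ok': "state_ok ps (tl ?r') (entry_step ps (a1, a2, t1, t2, fl) ?es) s'" by blast
  have "exec entry_body s ((5 * length ?es + 1) + (1 + ((3 * length ?es + 6) +
     ((12 * ?w + 3 * length ?es + 40) + (1 + (3 * (length a1 + ?w) + 3 * length t1 + 20) + 1) + 1) + 1) + 1) + 1) s'"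
    unfolding entry_body_def by (intro exec_Seq') (rule 1 2 3 4 5 6)+
  then have "exec entry_body s T s'"
    by (rule exec_mono) (use T length_split_number[of r] in linarith)
  with ok' show ?thesis by blast
qed

function entries :: "nat list \<Rightarrow> nat list list" where
  "entries r = (if r = [] then [] else fst (split_number r) # entries (tl (snd (split_number r))))"
  by auto

text \<open>A nonempty rest loses its first symbol; with an empty rest all of \<open>r\<close> has
  been consumed. This also covers a number without digits.\<close>

lemma length_rest_less: "r \<noteq> [] \<Longrightarrow> length (tl (snd (split_number r))) < length r"
  using length_split_number[of r] by (cases "snd (split_number r)") auto

termination
  by (relation "measure length") (auto simp: length_rest_less[simplified])

declare entries.simps [simp del]

definition read_entries :: com where
  "read_entries = Loop (\<lambda>x. x 0 \<noteq> 0) entry_body"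

fun state_size :: "state \<Rightarrow> nat" where
  "state_size (a1, a2, t1, t2, fl) = length a1 + length a2"

fun types_size :: "state \<Rightarrow> nat" where
  "types_size (a1, a2, t1, t2, fl) = length t1 + length t2"

lemma state_size_step: "state_size (entry_step ps st es) \<le> state_size st + length ps"
  by (cases st) (auto simp: Let_def)

lemma types_size_step: "state_ok ps r st s \<Longrightarrow> types_size (entry_step ps st es) = types_size st"
  by (cases st) (auto simp: Let_def)

text \<open>An entry lengthens the accumulators by at most \<open>length ps\<close> and consumes at
  least one input symbol. So \<open>state_size st + length ps * length r\<close> never grows, and
  its bound \<open>M\<close> limits tape 2 during the whole run.\<close>

lemma exec_read_entries:
  assumes "state_ok ps r st s" "length r \<le> L" "state_size st + length ps * length r \<le> M"
    "types_size st \<le> N" "length r * (15 * length ps + 11 * L + 3 * M + 3 * N + 82) + 1 \<le> T"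
  shows "\<exists>s'. exec read_entries s T s' \<and> state_ok ps [] (foldl (entry_step ps) st (entries r)) s'"
  using assms
proof (induction r arbitrary: st s T rule: length_induct)
  case (1 r)
  obtain a1 a2 t1 t2 fl where st: "st = (a1, a2, t1, t2, fl)" by (metis prod.collapse)
  show ?case
  proof (cases "r = []")
    case True
    then have "exec read_entries s T s"
      unfolding read_entries_def by (intro exec_LoopF) (use 1(2,6) st in auto)
    then show ?thesis using True 1(2) by (subst entries.simps) auto
  next
    case False
    let ?K = "15 * length ps + 11 * L + 3 * M + 3 * N + 80"
    let ?r' = "tl (snd (split_number r))" and ?st' = "entry_step ps st (fst (split_number r))"
    have less: "length ?r' < length r" using length_rest_less False .
    obtain s1 where s1: "exec entry_body s ?K s1" "state_ok ps ?r' ?st' s1"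
      using exec_entry_body[of ps r a1 a2 t1 t2 fl s ?K] 1(2-5) unfolding st by auto
    have "length ps * length ?r' + length ps \<le> length ps * length r"
      using less by (metis Suc_leI mult_Suc_right mult_le_mono2 add.commute)
    then have size: "state_size ?st' + length ps * length ?r' \<le> M"
      using state_size_step[of ps st "fst (split_number r)"] 1(4) by linarith
    have types: "types_size ?st' \<le> N" using types_size_step[OF 1(2)] 1(5) by simp
    obtain s2 where s2: "exec read_entries s1 (length ?r' * (?K + 2) + 1) s2"
      "state_ok ps [] (foldl (entry_step ps) ?st' (entries ?r')) s2"
      using 1(1)[rule_format, OF less s1(2) _ size types, of "length ?r' * (?K + 2) + 1"] less 1(3) by auto
    have "exec read_entries s T s2"
      unfolding read_entries_def
    proof (rule exec_LoopT)
      show "reads s 0 \<noteq> 0" using 1(2) False by (cases r) (auto simp: st)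
      show "exec entry_body s ?K s1" by (fact s1)
      show "exec (Loop (\<lambda>x. x 0 \<noteq> 0) entry_body) s1 (length ?r' * (?K + 2) + 1) s2"
        using s2(1) by (simp only: read_entries_def)
      have aux: "K + (b * (K + 2) + 1) + 2 \<le> T" if "b < a" "a * (K + 2) + 1 \<le> T" for a b K :: nat
      proof -
        have "Suc b * (K + 2) \<le> a * (K + 2)" using that(1) by (intro mult_le_mono1) simp
        then show ?thesis using that(2) by simp
      qed
      show "?K + (length ?r' * (?K + 2) + 1) + 2 \<le> T"
        by (rule aux[OF less]) (use 1(6) in \<open>simp add: algebra_simps\<close>)
    qed
    then show ?thesis using s2(2) False by (subst entries.simps) auto
  qed
qed

section \<open>The types of the entries\<close>

text \<open>Row by row, the diagonal sits at the multiples of \<open>n + 1\<close>. The type word is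
  therefore periodic and can be written without tracking where rows end.\<close>

definition diagonal_types :: "nat \<Rightarrow> nat \<Rightarrow> nat list" where
  "diagonal_types n m = 3 # concat (replicate m (replicate n 4 @ [3]))"

text \<open>For \<open>n \<ge> 1\<close> the length is \<open>1 + (n - 1) * (n + 1) = n * n\<close>,
  and the corner has index \<open>n - 1\<close>.\<close>

definition entry_types :: "nat \<Rightarrow> nat list" where
  "entry_types n = (diagonal_types n (n - 1))[n - 1 := 5]"

lemma diagonal_types_nonzero [simp]: "0 \<notin> set (diagonal_types n m)"
  by (auto simp: diagonal_types_def)

lemma length_diagonal_types: "length (diagonal_types n m) = Suc (m * Suc n)"
  by (induction m) (auto simp: diagonal_types_def)

lemma entry_types_nonzero: "0 \<notin> set (entry_types n)"
  unfolding entry_types_def using set_update_subset_insert by fastforce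

lemma length_entry_types: "length (entry_types n) = Suc ((n - 1) * Suc n)"
  by (simp add: entry_types_def length_diagonal_types)

text \<open>This includes \<open>n = 0\<close>, which occurs on words that encode no instance, and
  supplies the condition on \<open>t2\<close> in \<open>state_ok\<close>.\<close>

lemma entry_types_nonempty: "entry_types n \<noteq> []"
  using length_entry_types[of n] by auto

definition put_row_types :: com where
  "put_row_types = Loop (\<lambda>x. x 7 \<noteq> 0) (Act [copy 7 Move_Right, put 9 4 Move_Right])"

lemma exec_put_row_types:
  assumes "s 7 = (l, replicate m 1)" "s 9 = (k, [])"
    "s' = s(7 := (replicate m 1 @ l, []), 9 := (replicate m 4 @ k, []))" "3 * m + 1 \<le> T"
  shows "exec put_row_types s T s'"
  using assms unfolding put_row_types_def
proof (induction m arbitrary: s l k T)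
  case 0
  then show ?case by (intro exec_LoopF') (auto simp: fun_eq_iff)
next
  case (Suc m)
  show ?case
    by (rule exec_Loop_Act[OF _ Suc.IH[where l = "1 # l" and k = "4 # k" and T = "3 * m + 1"]])
      (use Suc.prems in \<open>auto simp: fun_eq_iff replicate_app_Cons_same\<close>)
qed

definition put_rows_types :: com where
  "put_rows_types = Loop (\<lambda>x. x 8 \<noteq> 0)
     (put_row_types ;; Act [put 9 3 Move_Right, copy 8 Move_Right] ;; rewind 7)"

lemma exec_put_rows_types:
  assumes "s 7 = ([], replicate n 1)" "s 8 = (l, replicate m 1)" "s 9 = (k, [])"
    "s' = s(8 := (replicate m 1 @ l, []), 9 := (rev (concat (replicate m (replicate n 4 @ [3]))) @ k, []))"
    "m * (6 * n + 14) + 1 \<le> T"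
  shows "exec put_rows_types s T s'"
  using assms unfolding put_rows_types_def
proof (induction m arbitrary: s l k T)
  case 0
  then show ?case by (intro exec_LoopF') (auto simp: fun_eq_iff)
next
  case (Suc m)
  let ?s1 = "s(7 := (replicate n 1, []), 9 := (replicate n 4 @ k, []))"
  let ?s2 = "?s1(8 := (1 # l, replicate m 1), 9 := (3 # replicate n 4 @ k, []))"
  let ?s3 = "?s2(7 := ([], replicate n 1))"
  show ?case
  proof (rule exec_LoopT)
    show "exec (put_row_types ;; Act [put 9 3 Move_Right, copy 8 Move_Right] ;; rewind 7) s
       ((3 * n + 1) + (1 + (3 * n + 6) + 1) + 1) ?s3"
    proof (intro exec_Seq')
      show "exec put_row_types s (3 * n + 1) ?s1"
        by (rule exec_put_row_types) (use Suc.prems in auto)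
      show "exec (Act [put 9 3 Move_Right, copy 8 Move_Right]) ?s1 1 ?s2"
        by (rule exec_Act) (use Suc.prems in \<open>auto simp: fun_eq_iff\<close>)
      show "exec (rewind 7) ?s2 (3 * n + 6) ?s3"
        by (rule exec_rewind[where l = "replicate n 1" and r = "[]"]) auto
    qed
    show "exec (Loop (\<lambda>x. x 8 \<noteq> 0)
       (put_row_types ;; Act [put 9 3 Move_Right, copy 8 Move_Right] ;; rewind 7)) ?s3 (m * (6 * n + 14) + 1) s'"
      by (rule Suc.IH[where l = "1 # l" and k = "3 # replicate n 4 @ k"])
        (use Suc.prems in \<open>auto simp: fun_eq_iff replicate_app_Cons_same\<close>)
  qed (use Suc.prems in auto)
qed

definition skip_to_corner :: com where
  "skip_to_corner = Loop (\<lambda>x. x 7 \<noteq> 0) (Act [copy 7 Move_Right, copy 9 Move_Right])"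

lemma exec_skip_to_corner:
  assumes "s 7 = (l, replicate m 1)" "s 9 = (k, r)" "0 \<notin> set r" "m \<le> length r"
    "s' = s(7 := (replicate m 1 @ l, []), 9 := (rev (take m r) @ k, drop m r))" "3 * m + 1 \<le> T"
  shows "exec skip_to_corner s T s'"
  using assms unfolding skip_to_corner_def
proof (induction m arbitrary: s l k r T)
  case 0
  then show ?case by (intro exec_LoopF') (auto simp: fun_eq_iff)
next
  case (Suc m)
  then obtain x r' where r: "r = x # r'" by (cases r) auto
  show ?case
    by (rule exec_Loop_Act[OF _ Suc.IH[where l = "1 # l" and k = "x # k" and r = r' and T = "3 * m + 1"]])
      (use Suc.prems r in \<open>auto simp: fun_eq_iff replicate_app_Cons_same\<close>)
qed

text \<open>The move on tape 7 leaves \<open>n - 1\<close> marks from the head on, so the walk along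
  tape 9 ends at the corner.\<close>

definition build_types :: com where
  "build_types = Act [put 9 3 Move_Right] ;; put_rows_types ;; rewind 9 ;; Act [copy 7 Move_Right] ;;
     skip_to_corner ;; Act [put 9 5 Stay] ;; rewind 9"

lemma exec_build_types:
  assumes s: "s 7 = ([], replicate n 1)" "s 8 = (l, replicate (n - 1) 1)" "s 9 = ([], [])"
    and T: "20 * n * n + 40 * n + 60 \<le> T"
  shows "\<exists>z7 z8. exec build_types s T (s(7 := z7, 8 := z8, 9 := ([], entry_types n)))"
proof -
  let ?m = "n - 1" and ?d = "diagonal_types n (n - 1)"
  let ?s1 = "s(9 := ([3], []))"
  let ?s2 = "?s1(8 := (replicate ?m 1 @ l, []), 9 := (rev ?d, []))"
  let ?s3 = "?s2(9 := ([], ?d))"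
  let ?s4 = "?s3(7 := (replicate (n - ?m) 1, replicate ?m 1))"
  let ?s5 = "?s4(7 := (replicate ?m 1 @ replicate (n - ?m) 1, []), 9 := (rev (take ?m ?d), drop ?m ?d))"
  let ?s6 = "?s5(9 := (rev (take ?m ?d), 5 # drop (Suc ?m) ?d))"
  let ?s7 = "?s6(9 := ([], entry_types n))"
  \<comment> \<open>\<open>n - ?m\<close> is 1, but 0 for \<open>n = 0\<close>, where the blank
    pushed onto the empty left half is dropped.\<close>
  have z7: "zact (hd0 (replicate n 1)) Move_Right ([], replicate n 1) = (replicate (n - ?m) 1, replicate ?m 1)"
    by (cases n) auto
  have len: "?m < length ?d" by (simp add: length_diagonal_types)
  have "exec build_types s (1 + ((?m * (6 * n + 14) + 1) + ((3 * length ?d + 6) + (1 + ((3 * ?m + 1) + (1 +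
     (3 * ?m + 6) + 1) + 1) + 1) + 1) + 1) + 1) ?s7"
    unfolding build_types_def
  proof (intro exec_Seq')
    show "exec (Act [put 9 3 Move_Right]) s 1 ?s1"
      by (rule exec_Act) (use s in auto)
    show "exec put_rows_types ?s1 (?m * (6 * n + 14) + 1) ?s2"
      by (rule exec_put_rows_types[where n = n and l = l and k = "[3]"])
        (use s in \<open>auto simp: fun_eq_iff diagonal_types_def\<close>)
    show "exec (rewind 9) ?s2 (3 * length ?d + 6) ?s3"
      by (rule exec_rewind[where l = "rev ?d" and r = "[]"]) auto
    show "exec (Act [copy 7 Move_Right]) ?s3 1 ?s4"
      by (rule exec_Act) (use s z7 in simp_all)
    show "exec skip_to_corner ?s4 (3 * ?m + 1) ?s5"
      by (rule exec_skip_to_corner[where l = "replicate (n - ?m) 1" and k = "[]" and r = ?d])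
        (use len in \<open>auto simp: fun_eq_iff\<close>)
    show "exec (Act [put 9 5 Stay]) ?s5 1 ?s6"
      by (rule exec_Act) (auto simp: fun_eq_iff tl_drop drop_Suc)
    show "exec (rewind 9) ?s6 (3 * ?m + 6) ?s7"
      by (rule exec_rewind[where l = "rev (take ?m ?d)" and r = "5 # drop (Suc ?m) ?d"])
        (use len drop_nonzero[of ?d] diagonal_types_nonzero[of n ?m] in
          \<open>auto simp: entry_types_def upd_conv_take_nth_drop dest: in_set_takeD\<close>)
  qed
  moreover have "?m * (6 * n + 14) \<le> 6 * n * n + 14 * n" by (cases n) (auto simp: algebra_simps)
  moreover have "length ?d \<le> n * n + n + 1"
    by (cases n) (auto simp: length_diagonal_types algebra_simps)
  ultimately have "exec build_types s T ?s7"
    by (elim exec_mono) (use T in linarith)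
  moreover have "?s7 = s(7 := (replicate ?m 1 @ replicate (n - ?m) 1, []),
      8 := (replicate ?m 1 @ l, []), 9 := ([], entry_types n))"
    by (simp add: fun_eq_iff)
  ultimately have run: "exec build_types s T (s(7 := (replicate ?m 1 @ replicate (n - ?m) 1, []),
      8 := (replicate ?m 1 @ l, []), 9 := ([], entry_types n)))"
    by (simp only:)
  show ?thesis by (rule exI, rule exI, rule run)
qed

section \<open>The decision procedure\<close>

text \<open>This is the negated criterion: the corner counts only if no other off-diagonal entry was
  nonzero. Diagonal sums, which are the number of matrices modulo p on instances, are passed
  over.\<close>

fun nonzero_left :: "nat \<Rightarrow> nat \<Rightarrow> nat list \<Rightarrow> nat list \<Rightarrow> bool" where
  "nonzero_left w fl [] r \<longleftrightarrow> False"
| "nonzero_left w fl (t # ts) r \<longleftrightarrow>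
     2 \<in> set (take w r) \<and> (t = 4 \<or> t = 5 \<and> fl = 0) \<or> nonzero_left w fl ts (drop w r)"

definition check_digit :: "(nat \<Rightarrow> nat) \<Rightarrow> nat" where
  "check_digit x = (if x 2 = 2 \<and> (x 9 = 4 \<or> x 9 = 5 \<and> x 5 = 0) then 1 else x 6)"

text \<open>The accumulators are read for the last time here. Overwriting them with 1 gives the left
  half of tape 2 a simple form, even where digits are only implicit blanks.\<close>

definition check_entry :: com where
  "check_entry = Loop (\<lambda>x. x 1 \<noteq> 0)
     (Act [copy 1 Move_Right, put 2 1 Move_Right, (6, check_digit, Stay)])"

lemma exec_check_entry:
  assumes "s 1 = (l, ps)" "0 \<notin> set ps" "s 2 = (k, r)" "s 6 = reg b" "b \<le> 1"
    "s' = s(1 := (rev ps @ l, []), 2 := (replicate (length ps) 1 @ k, drop (length ps) r),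
       6 := reg (if 2 \<in> set (take (length ps) r) \<and> (zread (s 9) = 4 \<or> zread (s 9) = 5 \<and> zread (s 5) = 0)
         then 1 else b))"
    "3 * length ps + 1 \<le> T"
  shows "exec check_entry s T s'"
  using assms unfolding check_entry_def
proof (induction ps arbitrary: s l k r b T)
  case Nil
  then show ?case by (intro exec_LoopF') (auto simp: fun_eq_iff)
next
  case (Cons p ps)
  let ?b = "if hd0 r = 2 \<and> (zread (s 9) = 4 \<or> zread (s 9) = 5 \<and> zread (s 5) = 0) then 1 else b"
  show ?case
    by (rule exec_Loop_Act[OF _ Cons.IH[where l = "p # l" and k = "1 # k" and r = "tl r" and b = ?b
            and T = "3 * length ps + 1"]])
      (use Cons.prems in \<open>cases r; auto simp: fun_eq_iff check_digit_def replicate_app_Cons_same\<close>)+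
qed

definition check_entries :: com where
  "check_entries = Loop (\<lambda>x. x 9 \<noteq> 0) (check_entry ;; rewind 1 ;; Act [copy 9 Move_Right])"

lemma exec_check_entries:
  assumes "s 1 = ([], ps)" "0 \<notin> set ps" "s 2 = (k, r)" "s 5 = reg fl" "s 6 = reg b" "b \<le> 1"
    "s 9 = (l, ts)" "0 \<notin> set ts" "length ts * (6 * length ps + 13) + 1 \<le> T"
  shows "\<exists>s'. exec check_entries s T s' \<and>
    s' 6 = reg (if nonzero_left (length ps) fl ts r then 1 else b)"
  using assms
proof (induction ts arbitrary: s k r b l T)
  case Nil
  then have "exec check_entries s T s"
    unfolding check_entries_def by (intro exec_LoopF') auto
  then show ?case using Nil by auto
next
  case (Cons t ts)
  let ?w = "length ps"
  let ?b = "if 2 \<in> set (take ?w r) \<and> (t = 4 \<or> t = 5 \<and> fl = 0) then 1 else b"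
  let ?s1 = "s(1 := (rev ps, []), 2 := (replicate ?w 1 @ k, drop ?w r), 6 := reg ?b)"
  let ?s2 = "?s1(1 := ([], ps))"
  let ?s3 = "?s2(9 := (t # l, ts))"
  have 1: "exec (check_entry ;; rewind 1 ;; Act [copy 9 Move_Right]) s
     ((3 * ?w + 1) + ((3 * ?w + 6) + 1 + 1) + 1) ?s3"
  proof (intro exec_Seq')
    show "exec check_entry s (3 * ?w + 1) ?s1"
      by (rule exec_check_entry[where l = "[]" and k = k and r = r and b = b and ps = ps])
        (use Cons.prems in auto)
    show "exec (rewind 1) ?s1 (3 * ?w + 6) ?s2"
      by (rule exec_rewind[where l = "rev ps" and r = "[]"]) (use Cons.prems in auto)
    show "exec (Act [copy 9 Move_Right]) ?s2 1 ?s3"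
      by (rule exec_Act) (use Cons.prems in auto)
  qed
  have "\<exists>s'. exec check_entries ?s3 (length ts * (6 * ?w + 13) + 1) s' \<and>
      s' 6 = reg (if nonzero_left ?w fl ts (drop ?w r) then 1 else ?b)"
    by (rule Cons.IH) (use Cons.prems in auto)
  then obtain s' where 2: "exec check_entries ?s3 (length ts * (6 * ?w + 13) + 1) s'"
    "s' 6 = reg (if nonzero_left ?w fl ts (drop ?w r) then 1 else ?b)" by (elim exE conjE)
  have "exec check_entries s T s'"
    unfolding check_entries_def
  proof (rule exec_LoopT)
    show "exec (check_entry ;; rewind 1 ;; Act [copy 9 Move_Right]) s
      ((3 * ?w + 1) + ((3 * ?w + 6) + 1 + 1) + 1) ?s3" by (rule 1)
    show "exec (Loop (\<lambda>x. x 9 \<noteq> 0) (check_entry ;; rewind 1 ;; Act [copy 9 Move_Right])) ?s3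
      (length ts * (6 * ?w + 13) + 1) s'" using 2(1) by (simp only: check_entries_def)
  qed (use Cons.prems in auto)
  moreover have "s' 6 = reg (if nonzero_left ?w fl (t # ts) r then 1 else b)"
    using 2(2) by (auto split: if_splits)
  ultimately show ?case by (intro exI conjI)
qed

text \<open>The move on tape 8 leaves \<open>n - 1\<close> marks, one for each period of the type
  word.\<close>

definition setup_com :: com where
  "setup_com = read_unary ;; Act [put 0 0 Move_Right] ;; rewind 7 ;; rewind 8 ;; Act [copy 8 Move_Right] ;;
     read_number 1 ;; Act [put 0 0 Move_Right] ;; rewind 1 ;; build_types"

definition decision_com :: com where
  "decision_com = setup_com ;; read_entries ;; check_entries"

definition input_symbols :: "bool list \<Rightarrow> nat list" where
  "input_symbols w = map (\<lambda>b. if b then 2 else 1) w"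

text \<open>The specification covers words that encode nothing. If such a word ends inside a matrix,
  tapes 2 and 9 are not rewound, and only the positions from the heads on are checked.\<close>

definition accepts :: "nat list \<Rightarrow> bool" where
  "accepts r \<longleftrightarrow>
     (let n = length (takeWhile (\<lambda>x. x = 2) r);
          r1 = tl (drop n r); ps = fst (split_number r1); r2 = tl (snd (split_number r1))
      in case foldl (entry_step ps) ([], [], [], entry_types n, 0) (entries r2) of
           (a1, a2, t1, t2, fl) \<Rightarrow> \<not> nonzero_left (length ps) fl t2 a2)"

lemma exec_setup_com:
  fixes r :: "nat list"
  defines "n \<equiv> length (takeWhile (\<lambda>x. x = 2) r)"
  defines "r1 \<equiv> tl (drop n r)"
  defines "ps \<equiv> fst (split_number r1)"
  assumes s: "s = (\<lambda>_. ([], []))(0 := ([], r))" and r: "0 \<notin> set r" "length r \<le> L"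
    and T: "20 * L * L + 60 * L + 120 \<le> T"
  shows "\<exists>s'. exec setup_com s T s' \<and>
     state_ok ps (tl (snd (split_number r1))) ([], [], [], entry_types n, 0) s'"
proof -
  let ?r' = "snd (split_number r1)"
  let ?s1 = "s(0 := ([], drop n r), 7 := (replicate n 1, []), 8 := (replicate n 1, []))"
  let ?s2 = "?s1(0 := ([], r1))"
  let ?s3 = "?s2(7 := ([], replicate n 1))"
  let ?s4 = "?s3(8 := ([], replicate n 1))"
  let ?s5 = "?s4(8 := (replicate (n - (n - 1)) 1, replicate (n - 1) 1))"
  let ?s6 = "?s5(0 := ([], ?r'), 1 := (rev ps, []))"
  let ?s7 = "?s6(0 := ([], tl ?r'))"
  let ?s8 = "?s7(1 := ([], ps))"
  have z8: "zact (hd0 (replicate n 1)) Move_Right ([], replicate n 1) =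
      (replicate (n - (n - 1)) 1, replicate (n - 1) 1)"
    by (cases n) auto
  have len: "n \<le> length r" "length ps + length ?r' \<le> length r"
  proof -
    show "n \<le> length r" by (simp add: n_def length_takeWhile_le)
    then show "length ps + length ?r' \<le> length r"
      using length_split_number[of r1] by (simp add: ps_def r1_def)
  qed
  have "\<exists>z7 z8. exec build_types ?s8 (20 * n * n + 40 * n + 60) (?s8(7 := z7, 8 := z8, 9 := ([], entry_types n)))"
    by (rule exec_build_types[where l = "replicate (n - (n - 1)) 1"]) (use s in auto)
  then obtain z7 z8 where 9: "exec build_types ?s8 (20 * n * n + 40 * n + 60)
      (?s8(7 := z7, 8 := z8, 9 := ([], entry_types n)))" (is "exec _ _ _ ?s9") by (elim exE)
  have "exec setup_com s ((3 * n + 1) + (1 + ((3 * n + 6) + ((3 * n + 6) + (1 + ((5 * length ps + 1) +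
     (1 + ((3 * length ps + 6) + (20 * n * n + 40 * n + 60) + 1) + 1) + 1) + 1) + 1) + 1) + 1) + 1) ?s9"
    unfolding setup_com_def
  proof (intro exec_Seq')
    show "exec read_unary s (3 * n + 1) ?s1"
      by (rule exec_read_unary[where r = r and l = "[]" and l' = "[]" and n = n])
        (use s in \<open>auto simp: n_def\<close>)
    show "exec (Act [put 0 0 Move_Right]) ?s1 1 ?s2"
      by (rule exec_Act) (auto simp: r1_def fun_eq_iff)
    show "exec (rewind 7) ?s2 (3 * n + 6) ?s3"
      by (rule exec_rewind[where l = "replicate n 1" and r = "[]"]) auto
    show "exec (rewind 8) ?s3 (3 * n + 6) ?s4"
      by (rule exec_rewind[where l = "replicate n 1" and r = "[]"]) auto
    show "exec (Act [copy 8 Move_Right]) ?s4 1 ?s5"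
      by (rule exec_Act) (use z8 in simp_all)
    show "exec (read_number 1) ?s5 (5 * length ps + 1) ?s6"
      by (rule exec_read_number[where l = "[]" and r = r1 and fl = 0])
        (use s in \<open>auto simp: ps_def reg_0 fun_eq_iff\<close>)
    show "exec (Act [put 0 0 Move_Right]) ?s6 1 ?s7"
      by (rule exec_Act) (auto simp: fun_eq_iff)
    show "exec (rewind 1) ?s7 (3 * length ps + 6) ?s8"
      by (rule exec_rewind[where l = "rev ps" and r = "[]"])
        (use split_number_nonzero[of r1] in \<open>auto simp: ps_def\<close>)
    show "exec build_types ?s8 (20 * n * n + 40 * n + 60) ?s9" by (rule 9)
  qed
  moreover have "n * n \<le> L * L" using len(1) r(2) by (intro mult_le_mono) auto
  ultimately have "exec setup_com s T ?s9"
    by (elim exec_mono) (use T len r(2) in linarith)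
  moreover have "set (tl ?r') \<subseteq> set r"
  proof -
    have "set (tl ?r') \<subseteq> set ?r'" by (cases ?r') auto
    also have "\<dots> \<subseteq> set r1" by (rule set_split_number)
    also have "\<dots> \<subseteq> set (drop n r)" unfolding r1_def by (cases "drop n r") auto
    also have "\<dots> \<subseteq> set r" by (rule set_drop_subset)
    finally show ?thesis .
  qed
  then have "state_ok ps (tl ?r') ([], [], [], entry_types n, 0) ?s9"
    using r(1) s split_number_nonzero[of r1] entry_types_nonzero[of n] entry_types_nonempty[of n]
    by (auto simp: ps_def reg_0 intro: exI[of _ 0])
  ultimately show ?thesis by (intro exI conjI)
qed

text \<open>Only the head moves along the type word. So the part remaining at the end is short
  enough to bound the final check.\<close>

lemma types_foldl:
  "foldl (entry_step ps) (a1, a2, t1, t2, fl) ess = (b1, b2, u1, u2, gl) \<Longrightarrow> t2 \<noteq> [] \<Longrightarrow>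
    u1 @ u2 = t1 @ t2 \<and> u2 \<noteq> []"
proof (induction ess arbitrary: a1 a2 t1 t2 fl)
  case (Cons es ess)
  obtain t t3 where t2: "t2 = t # t3" using Cons.prems(2) by (cases t2) auto
  show ?case
  proof (cases "t3 = []")
    case True
    then show ?thesis using Cons.prems t2 by (auto simp: Let_def dest!: Cons.IH)
  next
    case False
    then show ?thesis using Cons.prems t2 by (auto simp: Let_def dest!: Cons.IH)
  qed
qed simp

text \<open>The bound is cubic: at most \<open>L\<close> entries, each possibly with rewinds of
  tapes of length about \<open>L * L\<close>, and a final check of about \<open>L * L\<close>
  accumulators of width up to \<open>L\<close>. The factor 1000 is a generous choice covering the
  lower terms.\<close>

lemma exec_decision_com:
  "\<exists>s'. exec decision_com (init_store w) (1000 * (length w + 1) ^ 3) s' \<and>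
    (zread (s' 6) = 0 \<longleftrightarrow> accepts (input_symbols w))"
proof -
  define r where "r = input_symbols w"
  define L where "L = length w"
  define n where "n = length (takeWhile (\<lambda>x. x = 2) r)"
  define r1 where "r1 = tl (drop n r)"
  define ps where "ps = fst (split_number r1)"
  define r2 where "r2 = tl (snd (split_number r1))"
  obtain b1 b2 u1 u2 gl where fin:
    "foldl (entry_step ps) ([], [], [], entry_types n, 0) (entries r2) = (b1, b2, u1, u2, gl)"
    by (rule prod_cases5)
  have s: "init_store w = (\<lambda>_. ([], []))(0 := ([], r))"
    by (simp add: init_store_def input_symbols_def r_def)
  have r: "0 \<notin> set r" "length r = L" by (auto simp: r_def input_symbols_def L_def)
  have n: "n \<le> L" using length_takeWhile_le[of _ r] by (simp add: n_def r(2))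
  have lens: "length ps \<le> L" "length r2 \<le> L"
    using length_split_number[of r1] r(2) by (auto simp: ps_def r2_def r1_def)
  have types: "length (entry_types n) \<le> L * L + 1"
  proof -
    have "(n - 1) * Suc n \<le> n * n" by (cases n) auto
    also have "\<dots> \<le> L * L" using n by (intro mult_le_mono)
    finally show ?thesis by (simp add: length_entry_types)
  qed
  have "\<exists>s1. exec setup_com (init_store w) (20 * L * L + 60 * L + 120) s1 \<and>
      state_ok ps r2 ([], [], [], entry_types n, 0) s1"
    unfolding ps_def r2_def r1_def n_def by (rule exec_setup_com) (use s r in auto)
  then obtain s1 where 1: "exec setup_com (init_store w) (20 * L * L + 60 * L + 120) s1"
    "state_ok ps r2 ([], [], [], entry_types n, 0) s1" by (elim exE conjE)
  have prod: "length ps * length r2 \<le> L * L" using lens by (intro mult_le_mono)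
  let ?T2 = "L * (6 * (L * L) + 26 * L + 85) + 1"
  have "length r2 * (15 * length ps + 11 * L + 3 * (L * L) + 3 * (L * L + 1) + 82)
      \<le> L * (6 * (L * L) + 26 * L + 85)"
    using lens by (intro mult_le_mono) auto
  then have "\<exists>s2. exec read_entries s1 ?T2 s2 \<and>
      state_ok ps [] (foldl (entry_step ps) ([], [], [], entry_types n, 0) (entries r2)) s2"
    using prod types lens by (intro exec_read_entries[OF 1(2), of L "L * L" "L * L + 1"]) auto
  then obtain s2 where 2: "exec read_entries s1 ?T2 s2" "state_ok ps [] (b1, b2, u1, u2, gl) s2"
    unfolding fin by (elim exE conjE)
  have "u1 @ u2 = entry_types n"
    using types_foldl[OF fin entry_types_nonempty] by simp
  then have "length u2 \<le> L * L + 1"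
    using types by (metis le_add2 le_trans length_append)
  then have "length u2 * (6 * length ps + 13) \<le> (L * L + 1) * (6 * L + 13)"
    using lens by (intro mult_le_mono) auto
  then have "\<exists>s3. exec check_entries s2 ((L * L + 1) * (6 * L + 13) + 1) s3 \<and>
      s3 6 = reg (if nonzero_left (length ps) gl u2 b2 then 1 else 0)"
    using 2(2) by (intro exec_check_entries) auto
  then obtain s3 where 3: "exec check_entries s2 ((L * L + 1) * (6 * L + 13) + 1) s3"
    "s3 6 = reg (if nonzero_left (length ps) gl u2 b2 then 1 else 0)" by (elim exE conjE)
  have "exec decision_com (init_store w) ((20 * L * L + 60 * L + 120) + (?T2 +
      ((L * L + 1) * (6 * L + 13) + 1) + 1) + 1) s3"
    unfolding decision_com_def by (intro exec_Seq') (rule 1 2 3)+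
  moreover have "(L + 1) ^ 3 = L * L * L + 3 * (L * L) + 3 * L + 1"
    by (simp add: power3_eq_cube algebra_simps)
  then have "(20 * L * L + 60 * L + 120) + (?T2 + ((L * L + 1) * (6 * L + 13) + 1) + 1) + 1 \<le> 1000 * (L + 1) ^ 3"
    by (simp add: algebra_simps)
  ultimately have "exec decision_com (init_store w) (1000 * (L + 1) ^ 3) s3"
    by (rule exec_mono)
  moreover have "accepts r \<longleftrightarrow> \<not> nonzero_left (length ps) gl u2 b2"
    using fin by (simp add: accepts_def Let_def ps_def r2_def r1_def n_def)
  then have "zread (s3 6) = 0 \<longleftrightarrow> accepts r" using 3(2) by simp
  ultimately show ?thesis unfolding L_def r_def by (intro exI conjI)
qed

section \<open>Alphabet of the procedure and membership in P\<close>

lemma writes_below_simps [simp]: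
  "writes_below K (\<lambda>x. x i)" "a < K \<Longrightarrow> writes_below K (\<lambda>_. a)"
  by (simp_all add: writes_below_def)

text \<open>The tapes are 0 to 9 and the symbols 0 to 5, the largest being the corner type.\<close>

lemma wf_decision_com: "wf_com 10 6 decision_com"
proof -
  have "writes_below 6 (\<lambda>x. digit (x 0))"
    "writes_below 6 (\<lambda>x. if x 0 = 2 \<and> x 9 = 4 then 1 else x 5)"
    "writes_below 6 (\<lambda>x. result_digit (column b (x 1) (x 3) (x 2) (int (x 4) - 1)))"
    "writes_below 6 check_digit" for b
    by (auto simp: writes_below_def digit_def result_digit_def check_digit_def)
  \<comment> \<open>Tape 4 must be allowed every symbol below 6, so carries up to 4 are considered,
    not only those that occur.\<close>
  moreover have "writes_below 6 (\<lambda>x. nat (column b (x 1) (x 3) (x 2) (int (x 4) - 1) div 2 + 1))" for b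
    unfolding writes_below_def
  proof (intro allI impI)
    fix x :: "nat \<Rightarrow> nat" assume "\<forall>i. x i < 6"
    then have "int (x 4) < 6" by (metis of_nat_less_iff of_nat_numeral)
    then have "column b (x 1) (x 3) (x 2) (int (x 4) - 1) < 8"
      using bit_value_bounds[of "x 1"] bit_value_bounds[of "x 2"] bit_value_bounds[of "x 3"] by (simp add: column_def)
    then show "nat (column b (x 1) (x 3) (x 2) (int (x 4) - 1) div 2 + 1) < 6" by simp
  qed
  ultimately show ?thesis
    by (simp add: decision_com_def setup_com_def read_unary_def rewind_def read_number_def build_types_def
        put_rows_types_def put_row_types_def skip_to_corner_def read_entries_def entry_body_def
        accumulate_def pass_def rewind_both_def erase_def check_entries_def check_entry_def del: One_nat_def)
qed

theorem accepts_PTIME: "{w. accepts (input_symbols w)} \<in> PTIME"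
proof (rule program_PTIME[OF wf_decision_com])
  fix w :: "bool list"
  have "poly ([:1000:] * [:1, 1:] ^ 3) (length w) = 1000 * (length w + 1) ^ 3"
    by simp
  then show "\<exists>s'. exec decision_com (init_store w) (poly ([:1000:] * [:1, 1:] ^ 3) (length w)) s' \<and>
      (zread (s' 6) = 0 \<longleftrightarrow> accepts (input_symbols w))"
    using exec_decision_com[of w] by (simp only:)
qed simp_all

section \<open>What the procedure computes\<close>

fun digits_value :: "nat list \<Rightarrow> int" where
  "digits_value [] = 0"
| "digits_value (d # ds) = bit_value d + 2 * digits_value ds"

lemma digits_value_bounds: "0 \<le> digits_value ds \<and> digits_value ds < 2 ^ length ds"
proof (induction ds)
  case (Cons d ds)
  then show ?case using bit_value_bounds[of d] by auto
qed simp

lemma digits_value_eq_0: "digits_value ds = 0 \<longleftrightarrow> 2 \<notin> set ds"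
proof (induction ds)
  case (Cons d ds)
  then show ?case using digits_value_bounds[of ds] by (auto simp: bit_value_def)
qed simp

lemma digits_value_take_Suc:
  "digits_value (take (Suc n) r) = bit_value (hd0 r) + 2 * digits_value (take n (tl r))"
  by (cases r) (auto simp: bit_value_def)

text \<open>The invariant of column addition: the outgoing carry has weight
  \<open>2 ^ length ps\<close>.\<close>

lemma digits_value_add_pass:
  "digits_value (fst (add_pass b ps es r c)) + 2 ^ length ps * snd (add_pass b ps es r c) =
     digits_value (take (length ps) r) +
     (if b then digits_value (take (length ps) es) - digits_value ps else digits_value ps) + c"
proof (induction ps arbitrary: es r c)
  case (Cons p ps)
  define d where "d = column b p (hd0 es) (hd0 r) c"
  have "bit_value (result_digit d) = d mod 2" by (simp add: bit_value_def result_digit_def mod2_eq_if)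
  then have "bit_value (result_digit d) + 2 * (d div 2) = d" by simp
  moreover have "d = bit_value (hd0 r) + (if b then bit_value (hd0 es) - bit_value p else bit_value p) + c"
    by (simp add: d_def column_def)
  \<comment> \<open>The linear arithmetic of one column: \<open>B\<close> is the digit written,
    \<open>k\<close> the carry into the next column, \<open>Y\<close> the weighted outgoing
    carry.\<close>
  moreover have "B + 2 * V + 2 * Y = R0 + 2 * R + (if b then (E0 + 2 * E) - (P0 + 2 * P) else P0 + 2 * P) + c"
    if "B + 2 * k = d" "d = R0 + (if b then E0 - P0 else P0) + c" "V + Y = R + (if b then E - P else P) + k"
    for B V Y R0 R E0 E P0 P k :: int
    using that by (cases b) auto
  ultimately have "bit_value (result_digit d) + 2 * digits_value (fst (add_pass b ps (tl es) (tl r) (d div 2))) +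
      2 * (2 ^ length ps * snd (add_pass b ps (tl es) (tl r) (d div 2))) =
    bit_value (hd0 r) + 2 * digits_value (take (length ps) (tl r)) +
      (if b then (bit_value (hd0 es) + 2 * digits_value (take (length ps) (tl es))) - (bit_value p + 2 * digits_value ps)
       else bit_value p + 2 * digits_value ps) + c"
    using Cons.IH[of "tl es" "tl r" "d div 2"] by blast
  then show ?case
    by (simp only: add_pass.simps fst_conv snd_conv digits_value.simps length_Cons
        digits_value_take_Suc power_Suc d_def[symmetric] mult.assoc)
qed simp

text \<open>Both summands are below \<open>p\<close>, so \<open>a + e < 2 * p\<close> and at most
  one subtraction of \<open>p\<close> is due.\<close>

lemma digits_value_add_mod:
  fixes ps es r :: "nat list"
  defines "p \<equiv> digits_value ps" and "a \<equiv> digits_value (take (length ps) r)" and "e \<equiv> digits_value es"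
  assumes len: "length es \<le> length ps" and a: "a < p" and e: "e < p"
  shows "digits_value (add_mod ps es r) = (a + e) mod p"
proof -
  let ?A = "add_pass True ps es r 0" and ?w = "length ps"
  let ?B = "add_pass False ps [] (fst ?A) 0"
  let ?P = "(2::int) ^ ?w"
  have a0: "0 \<le> a" and e0: "0 \<le> e" and p: "p < ?P"
    using digits_value_bounds by (auto simp: a_def e_def p_def)
  have x: "0 \<le> digits_value (fst ?A)" "digits_value (fst ?A) < ?P"
    and y: "0 \<le> digits_value (fst ?B)" "digits_value (fst ?B) < ?P"
    using digits_value_bounds[of "fst ?A"] digits_value_bounds[of "fst ?B"] by auto
  have A: "digits_value (fst ?A) + ?P * snd ?A = a + e - p"
    using digits_value_add_pass[of True ps es r 0] len by (simp add: a_def e_def p_def)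
  have B: "digits_value (fst ?B) + ?P * snd ?B = digits_value (fst ?A) + p"
    using digits_value_add_pass[of False ps "[]" "fst ?A" 0] by (simp add: p_def)
  \<comment> \<open>Numbers in \<open>{0..<?P}\<close> that agree modulo \<open>?P\<close> are
    equal; this identifies the result without computing the carry of the second pass.\<close>
  have unique: "u = v" if "u + ?P * k = v" "0 \<le> u" "u < ?P" "0 \<le> v" "v < ?P" for u v k
  proof -
    have "(u + ?P * k) mod ?P = u mod ?P" by (rule mod_mult_self2)
    then show ?thesis using that by simp
  qed
  show ?thesis
  proof (cases "snd ?A = -1")
    case True
    have lt: "a + e < p" using A True x by simp
    have "digits_value (fst ?B) = a + e"
      by (rule unique[of _ "snd ?B - 1"]) (use A B True y a0 e0 lt p in \<open>auto simp: algebra_simps\<close>)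
    then show ?thesis using True lt a0 e0 by (simp add: add_mod_def)
  next
    case False
    \<comment> \<open>Otherwise the digits represent \<open>a + e - p + ?P\<close>, which forces the
      excluded carry -1.\<close>
    have ge: "0 \<le> a + e - p"
    proof (rule ccontr)
      assume neg: "\<not> 0 \<le> a + e - p"
      have "digits_value (fst ?A) = a + e - p + ?P"
        by (rule unique[of _ "snd ?A + 1"]) (use A neg x a0 e0 p in \<open>auto simp: algebra_simps\<close>)
      then have "?P * snd ?A = ?P * (- 1)" using A by simp
      then have "snd ?A = - 1" by (simp only: mult_cancel_left) auto
      with False show False by simp
    qed
    have "digits_value (fst ?A) = a + e - p"
      by (rule unique[of _ "snd ?A"]) (use A ge x a e p in auto)
    moreover have "(a + e - p) mod p = a + e - p"
      by (rule mod_pos_pos_trivial) (use ge a e in auto)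
    then have "(a + e) mod p = a + e - p" by (simp only: minus_mod_self2)
    ultimately show ?thesis using False by (simp add: add_mod_def)
  qed
qed

definition segment :: "nat \<Rightarrow> nat list \<Rightarrow> nat \<Rightarrow> nat list" where
  "segment w r q = take w (drop (q * w) r)"

lemma segment_0: "segment w (x @ y) 0 = x" if "length x = w"
  using that by (simp add: segment_def)

lemma segment_Suc: "segment w (x @ y) (Suc q) = segment w y q" if "length x = w"
  using that by (simp add: segment_def)

lemma nonzero_left_iff:
  "nonzero_left w fl ts r \<longleftrightarrow>
     (\<exists>q<length ts. digits_value (segment w r q) \<noteq> 0 \<and> (ts ! q = 4 \<or> ts ! q = 5 \<and> fl = 0))"
proof (induction ts arbitrary: r)
  case (Cons t ts)
  have "segment w (drop w r) q = segment w r (Suc q)" for q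
    by (simp add: segment_def add.commute)
  moreover have "digits_value (segment w r 0) \<noteq> 0 \<longleftrightarrow> 2 \<in> set (take w r)"
    by (simp add: segment_def digits_value_eq_0)
  moreover have "(\<exists>q<length (t # ts). P q) \<longleftrightarrow> P 0 \<or> (\<exists>q<length ts. P (Suc q))" for P
    by (auto simp: less_Suc_eq_0_disj)
  ultimately show ?case by (simp only: nonzero_left.simps Cons.IH) simp
qed simp

fun add_row :: "nat list \<Rightarrow> nat list \<Rightarrow> nat list list \<Rightarrow> nat list" where
  "add_row ps r [] = []"
| "add_row ps r (es # ess) = add_mod ps es r @ add_row ps (drop (length ps) r) ess"

definition nonzero_noncorner :: "nat list \<Rightarrow> nat list list \<Rightarrow> bool" where
  "nonzero_noncorner ts ess \<longleftrightarrow> (\<exists>q<length ts. ts ! q = 4 \<and> 2 \<in> set (ess ! q))"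

lemma nonzero_noncorner_Cons:
  "nonzero_noncorner (t # ts) (es # ess) \<longleftrightarrow> t = 4 \<and> 2 \<in> set es \<or> nonzero_noncorner ts ess"
  by (auto simp: nonzero_noncorner_def less_Suc_eq_0_disj)

text \<open>The entries use up the types exactly, so the last step rewinds and both heads are back
  at the left end.\<close>

lemma foldl_entry_step_row:
  "length ess = length t2 \<Longrightarrow> t2 \<noteq> [] \<Longrightarrow>
   foldl (entry_step ps) (a1, a2, t1, t2, fl) ess =
     ([], a1 @ add_row ps a2 ess @ drop (length ess * length ps) a2, [], t1 @ t2,
      if nonzero_noncorner t2 ess then 1 else fl)"
proof (induction ess arbitrary: a1 a2 t1 t2 fl)
  case (Cons es ess)
  then obtain t t3 where t2: "t2 = t # t3" by (cases t2) auto
  show ?case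
  proof (cases "t3 = []")
    case True
    then show ?thesis using Cons.prems t2 by (simp add: nonzero_noncorner_Cons) (simp add: nonzero_noncorner_def)
  next
    case False
    have "foldl (entry_step ps) (a1 @ add_mod ps es a2, drop (length ps) a2, t1 @ [t], t3,
         if t = 4 \<and> 2 \<in> set es then 1 else fl) ess =
      ([], (a1 @ add_mod ps es a2) @ add_row ps (drop (length ps) a2) ess @
        drop (length ess * length ps) (drop (length ps) a2), [], (t1 @ [t]) @ t3,
       if nonzero_noncorner t3 ess then 1 else if t = 4 \<and> 2 \<in> set es then 1 else fl)"
      by (rule Cons.IH) (use Cons.prems t2 False in auto)
    then show ?thesis
      using False t2 by (auto simp: nonzero_noncorner_Cons add.commute)
  qed
qed simp

lemma segment_add_row:
  "q < length ess \<Longrightarrow> segment (length ps) (add_row ps r ess @ z) q = add_mod ps (ess ! q) (drop (q * length ps) r)"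
proof (induction ess arbitrary: r q)
  case (Cons es ess)
  then show ?case
    by (cases q) (auto simp: segment_0 segment_Suc add.commute)
qed simp

text \<open>\<open>digits_value_add_mod\<close> needs accumulators below \<open>p\<close>. This
  holds for the empty tape, and each reduction restores it for the next matrix.\<close>

lemma foldl_entry_step_rows:
  assumes "ts \<noteq> []"
    and "\<And>ess. ess \<in> set mats \<Longrightarrow> length ess = length ts"
    and "\<And>ess es. ess \<in> set mats \<Longrightarrow> es \<in> set ess \<Longrightarrow> length es \<le> length ps \<and> digits_value es < digits_value ps"
    and "\<And>q. q < length ts \<Longrightarrow> digits_value (segment (length ps) a q) < digits_value ps"
  shows "\<exists>a'. foldl (entry_step ps) ([], a, [], ts, fl) (concat mats) =
       ([], a', [], ts, if \<exists>ess\<in>set mats. nonzero_noncorner ts ess then 1 else fl) \<and>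
     (\<forall>q<length ts. digits_value (segment (length ps) a' q) =
       (digits_value (segment (length ps) a q) + (\<Sum>ess\<leftarrow>mats. digits_value (ess ! q))) mod digits_value ps)"
  using assms
proof (induction mats arbitrary: a fl)
  case Nil
  then show ?case using digits_value_bounds by (auto intro!: exI[of _ a])
next
  case (Cons ess mats)
  let ?a = "add_row ps a ess @ drop (length ess * length ps) a"
  let ?fl = "if nonzero_noncorner ts ess then 1 else fl"
  have len: "length ess = length ts" using Cons.prems(2) by simp
  have step: "foldl (entry_step ps) ([], a, [], ts, fl) ess = ([], ?a, [], ts, ?fl)"
    using foldl_entry_step_row[of ess ts ps "[]" a "[]" fl] len Cons.prems(1) by simp
  have val: "digits_value (segment (length ps) ?a q) =
      (digits_value (segment (length ps) a q) + digits_value (ess ! q)) mod digits_value ps"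
    if q: "q < length ts" for q
  proof -
    have "ess ! q \<in> set ess" using q len by simp
    then have "digits_value (add_mod ps (ess ! q) (drop (q * length ps) a)) =
       (digits_value (take (length ps) (drop (q * length ps) a)) + digits_value (ess ! q)) mod digits_value ps"
      using Cons.prems(3)[of ess "ess ! q"] Cons.prems(4)[OF q]
      by (intro digits_value_add_mod) (auto simp: segment_def)
    then show ?thesis using segment_add_row[of q ess ps a] q len by (simp add: segment_def[of _ a])
  qed
  \<comment> \<open>Some accumulator exists and lies below the modulus, so the modulus is positive
    and remainders are again below it.\<close>
  have pos: "0 < digits_value ps"
    using Cons.prems(1,4) digits_value_bounds[of "segment (length ps) a 0"] by fastforce
  have "\<exists>a'. foldl (entry_step ps) ([], ?a, [], ts, ?fl) (concat mats) =
       ([], a', [], ts, if \<exists>ess\<in>set mats. nonzero_noncorner ts ess then 1 else ?fl) \<and>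
     (\<forall>q<length ts. digits_value (segment (length ps) a' q) =
       (digits_value (segment (length ps) ?a q) + (\<Sum>ess\<leftarrow>mats. digits_value (ess ! q))) mod digits_value ps)"
    by (rule Cons.IH) (use Cons.prems val pos in auto)
  then obtain a' where a': "foldl (entry_step ps) ([], ?a, [], ts, ?fl) (concat mats) =
       ([], a', [], ts, if \<exists>ess\<in>set mats. nonzero_noncorner ts ess then 1 else ?fl)"
     "\<And>q. q < length ts \<Longrightarrow> digits_value (segment (length ps) a' q) =
       (digits_value (segment (length ps) ?a q) + (\<Sum>ess\<leftarrow>mats. digits_value (ess ! q))) mod digits_value ps"
    by (elim exE conjE) blast
  show ?case
    using a' step val by (intro exI[of _ a']) (auto simp: mod_simps add.assoc)
qed

section \<open>The encoding of instances\<close>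

definition number_digits :: "nat \<Rightarrow> nat list" where
  "number_digits m = input_symbols (binary_digits m)"

lemma digits_value_number_digits: "digits_value (number_digits m) = int m"
proof (induction m rule: binary_digits.induct)
  case (1 m)
  show ?case
  proof (cases "m = 0")
    case True
    then show ?thesis by (subst number_digits_def, subst binary_digits.simps) (simp add: input_symbols_def)
  next
    case False
    have "number_digits m = (if odd m then 2 else 1) # number_digits (m div 2)"
      using False by (subst number_digits_def, subst binary_digits.simps)
        (simp add: input_symbols_def number_digits_def)
    then have "digits_value (number_digits m) = int (m mod 2) + 2 * int (m div 2)"
      using 1[OF False] by (auto simp: bit_value_def odd_iff_mod_2_eq_one)
    then show ?thesis by (simp add: zmod_int zdiv_int)
  qed
qed

text \<open>An entry below p thus has no more digits than p and fits into an accumulator.\<close>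

lemma length_binary_digits_mono: "m \<le> k \<Longrightarrow> length (binary_digits m) \<le> length (binary_digits k)"
proof (induction m arbitrary: k rule: binary_digits.induct)
  case (1 m)
  show ?case
  proof (cases "m = 0")
    case True
    then show ?thesis by (subst binary_digits.simps) simp
  next
    case False
    then have "length (binary_digits (m div 2)) \<le> length (binary_digits (k div 2))"
      using 1 by (intro "1.IH") (auto simp: div_le_mono)
    then show ?thesis using False 1(2) by (subst (1 2) binary_digits.simps) auto
  qed
qed

lemma input_symbols_append [simp]: "input_symbols (x @ y) = input_symbols x @ input_symbols y"
  by (simp add: input_symbols_def)

lemma split_number_enc_binary:
  "split_number (input_symbols (enc_binary m) @ r) = (number_digits m, 1 # r)"
proof -
  have "split_number (input_symbols (concat (map (\<lambda>b. [True, b]) bs) @ [False]) @ r) = (input_symbols bs, 1 # r)" for bs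
    by (induction bs) (cases r; auto simp: input_symbols_def digit_def)+
  then show ?thesis by (simp add: enc_binary_def number_digits_def)
qed

lemma enc_binary_nonempty: "input_symbols (enc_binary m) @ r \<noteq> []"
  by (simp add: enc_binary_def input_symbols_def)

lemma entries_enc_binary: "entries (input_symbols (concat (map enc_binary ms))) = map number_digits ms"
proof (induction ms)
  case Nil
  then show ?case by (subst entries.simps) (simp add: input_symbols_def)
next
  case (Cons m ms)
  then show ?case
    by (subst entries.simps) (simp add: split_number_enc_binary enc_binary_nonempty[simplified])
qed

definition matrix_entries :: "int mat \<Rightarrow> nat list" where
  "matrix_entries A = concat (map (\<lambda>i. map (\<lambda>j. nat (A $$ (i, j))) [0..<dim_col A]) [0..<dim_row A])"

lemma enc_mat_entries: "enc_mat A = concat (map enc_binary (matrix_entries A))"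
  by (simp add: enc_mat_def matrix_entries_def map_concat comp_def)

lemma concat_nth_uniform:
  "(\<And>xs. xs \<in> set xss \<Longrightarrow> length xs = n) \<Longrightarrow> i < length xss \<Longrightarrow> j < n \<Longrightarrow> concat xss ! (i * n + j) = xss ! i ! j"
proof (induction xss arbitrary: i)
  case (Cons xs xss)
  then show ?case by (cases i) (auto simp: nth_append)
qed simp

lemma matrix_entries_nth:
  assumes "A \<in> carrier_mat n n" "i < n" "j < n"
  shows "matrix_entries A ! (i * n + j) = nat (A $$ (i, j))"
proof -
  have "matrix_entries A ! (i * n + j) =
      map (\<lambda>i. map (\<lambda>j. nat (A $$ (i, j))) [0..<n]) [0..<n] ! i ! j"
    unfolding matrix_entries_def using assms by (subst concat_nth_uniform) auto
  then show ?thesis using assms by simp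
qed

lemma length_matrix_entries: "A \<in> carrier_mat n n \<Longrightarrow> length (matrix_entries A) = n * n"
  by (simp add: matrix_entries_def length_concat comp_def sum_list_triv)

lemma accepts_enc_instance:
  "accepts (input_symbols (enc_instance (n, p, Cs))) \<longleftrightarrow>
     (case foldl (entry_step (number_digits p)) ([], [], [], entry_types n, 0)
         (concat (map (\<lambda>C. map number_digits (matrix_entries C)) Cs)) of
        (a1, a2, t1, t2, fl) \<Rightarrow> \<not> nonzero_left (length (number_digits p)) fl t2 a2)"
proof -
  let ?r = "input_symbols (enc_instance (n, p, Cs))"
  let ?ms = "concat (map matrix_entries Cs)"
  have "concat (map enc_mat Cs) = concat (map enc_binary ?ms)"
    by (induction Cs) (auto simp: enc_mat_entries)
  then have r: "?r = replicate n 2 @ 1 # input_symbols (enc_binary p) @ input_symbols (concat (map enc_binary ?ms))"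
    by (simp add: enc_instance_def enc_unary_def) (simp add: input_symbols_def)
  have n: "length (takeWhile (\<lambda>x. x = 2) ?r) = n"
  proof -
    have "takeWhile (\<lambda>x. x = 2) (replicate n 2 @ 1 # z) = replicate n 2" for z :: "nat list"
      by (induction n) auto
    then show ?thesis unfolding r by simp
  qed
  have "tl (drop n ?r) = input_symbols (enc_binary p) @ input_symbols (concat (map enc_binary ?ms))"
    unfolding r by simp
  then have split: "split_number (tl (drop n ?r)) = (number_digits p, 1 # input_symbols (concat (map enc_binary ?ms)))"
    by (simp only: split_number_enc_binary)
  have "map number_digits ?ms = concat (map (\<lambda>C. map number_digits (matrix_entries C)) Cs)"
    by (simp add: map_concat comp_def)
  then show ?thesis
    by (simp only: accepts_def n Let_def split fst_conv snd_conv list.sel entries_enc_binary)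
qed

section \<open>Entry types as a function of the matrix position\<close>

lemma diagonal_types_Suc: "diagonal_types n (Suc m) = (3 # replicate n 4) @ diagonal_types n m"
  by (simp add: diagonal_types_def)

lemma diagonal_types_nth:
  "q \<le> m * Suc n \<Longrightarrow> diagonal_types n m ! q = (if q mod Suc n = 0 then 3 else 4)"
proof (induction m arbitrary: q)
  case 0
  then show ?case by (simp add: diagonal_types_def)
next
  case (Suc m)
  show ?case
  proof (cases "q < Suc n")
    case True
    then show ?thesis unfolding diagonal_types_Suc by (cases q) (auto simp: nth_append)
  next
    case False
    then have "q mod Suc n = (q - Suc n) mod Suc n" by (simp add: le_mod_geq)
    then show ?thesis using False Suc.IH[of "q - Suc n"] Suc.prems
      unfolding diagonal_types_Suc by (auto simp: nth_append)
  qed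
qed

text \<open>Since \<open>i * n + j = i * (n + 1) + (j - i)\<close> over the integers and
  \<open>j - i\<close> is smaller than \<open>n + 1\<close> in absolute value, the index is a
  multiple of \<open>n + 1\<close> only on the diagonal.\<close>

lemma entry_types_nth:
  assumes n: "2 \<le> n" and ij: "i < n" "j < n"
  shows "entry_types n ! (i * n + j) = (if i = j then 3 else if i = 0 \<and> j = n - 1 then 5 else 4)"
proof -
  have "i * n + j < n * n"
  proof -
    have "i * n + j < i * n + n" using ij by simp
    also have "\<dots> = Suc i * n" by simp
    also have "\<dots> \<le> n * n" using ij by (intro mult_le_mono) auto
    finally show ?thesis .
  qed
  moreover have size: "Suc ((n - 1) * Suc n) = n * n" using n by (cases n) auto
  ultimately have q: "i * n + j \<le> (n - 1) * Suc n" by simp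
  have "(i * n + j) mod Suc n = 0 \<longleftrightarrow> i = j"
  proof
    assume "(i * n + j) mod Suc n = 0"
    then have "int (Suc n) dvd int (i * n + j)" by (metis dvd_eq_mod_eq_0 of_nat_dvd_iff)
    moreover have "int (i * n + j) = int i * int (Suc n) + (int j - int i)" by (simp add: algebra_simps)
    ultimately have "int (Suc n) dvd int j - int i" by (metis dvd_add_right_iff dvd_triv_right)
    then show "i = j"
      using dvd_imp_le_int[of "int j - int i" "int (Suc n)"] ij by (cases "i = j") auto
  next
    assume "i = j"
    then have "i * n + j = i * Suc n" by simp
    then show "(i * n + j) mod Suc n = 0" by (metis mod_mult_self2_is_0)
  qed
  moreover have "i * n + j = n - 1 \<longleftrightarrow> i = 0 \<and> j = n - 1"
    using n ij by (cases i) auto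
  ultimately show ?thesis
    using diagonal_types_nth[OF q] q n by (auto simp: entry_types_def nth_list_update length_diagonal_types)
qed

text \<open>The procedure knows nothing of the Heisenberg shape: the result holds for all matrices
  with reduced entries, and every position off the diagonal and the corner is treated like those of
  a and c.\<close>

theorem accepts_enc_instance_iff:
  assumes n: "2 \<le> n" and p: "0 < p"
    and Cs: "\<And>C. C \<in> set Cs \<Longrightarrow> C \<in> carrier_mat n n"
      "\<And>C i j. C \<in> set Cs \<Longrightarrow> i < n \<Longrightarrow> j < n \<Longrightarrow> C $$ (i, j) \<in> {0..<int p}"
  defines "nc \<equiv> {(i, j). i < n \<and> j < n \<and> i \<noteq> j \<and> \<not> (i = 0 \<and> j = n - 1)}"
  shows "accepts (input_symbols (enc_instance (n, p, Cs))) \<longleftrightarrow>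
     (\<forall>ij\<in>nc. int p dvd (\<Sum>C\<leftarrow>Cs. C $$ ij)) \<and>
     ((\<exists>C\<in>set Cs. \<exists>ij\<in>nc. C $$ ij \<noteq> 0) \<or> int p dvd (\<Sum>C\<leftarrow>Cs. C $$ (0, n - 1)))"
proof -
  let ?ps = "number_digits p" and ?ts = "entry_types n"
  let ?row = "\<lambda>C. map number_digits (matrix_entries C)"
  have tl: "length ?ts = n * n" using n by (cases n) (auto simp: length_entry_types)
  have nc_less: "i < n \<and> j < n" if "(i, j) \<in> nc" for i j using that by (simp add: nc_def)
  have lenr: "length (?row C) = n * n" if "C \<in> set Cs" for C
    using length_matrix_entries Cs(1)[OF that] by simp
  have idx: "\<exists>i<n. \<exists>j<n. q = i * n + j" if "q < n * n" for q
    using that n by (intro exI[of _ "q div n"] exI[of _ "q mod n"] conjI)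
      (auto simp: less_mult_imp_div_less)
  have idx': "i * n + j < n * n" if "i < n" "j < n" for i j
  proof -
    have "i * n + j < Suc i * n" using that by simp
    also have "\<dots> \<le> n * n" using that by (intro mult_le_mono) auto
    finally show ?thesis .
  qed
  have val: "digits_value (?row C ! (i * n + j)) = C $$ (i, j)" if "C \<in> set Cs" "i < n" "j < n" for C i j
    using that Cs idx' length_matrix_entries[OF Cs(1)[OF that(1)]]
    by (simp add: matrix_entries_nth digits_value_number_digits)
  have small: "length es \<le> length ?ps \<and> digits_value es < digits_value ?ps"
    if C: "C \<in> set Cs" and es: "es \<in> set (?row C)" for C es
  proof -
    obtain q where q: "q < n * n" "es = ?row C ! q"
      using es lenr[OF C] by (metis in_set_conv_nth)
    obtain i j where ij: "i < n" "j < n" "q = i * n + j" using idx[OF q(1)] by blast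
    have m: "es = number_digits (nat (C $$ (i, j)))"
      using q ij lenr[OF C] matrix_entries_nth[OF Cs(1)[OF C] ij(1,2)] by simp
    have "nat (C $$ (i, j)) < p" using Cs(2)[OF C ij(1,2)] p by auto
    then show ?thesis unfolding m
      using length_binary_digits_mono[of "nat (C $$ (i, j))" p] Cs(2)[OF C ij(1,2)]
      by (simp only: digits_value_number_digits) (simp add: number_digits_def input_symbols_def)
  qed
  have "\<exists>a'. foldl (entry_step ?ps) ([], [], [], ?ts, 0) (concat (map ?row Cs)) =
       ([], a', [], ?ts, if \<exists>ess\<in>set (map ?row Cs). nonzero_noncorner ?ts ess then 1 else 0) \<and>
     (\<forall>q<length ?ts. digits_value (segment (length ?ps) a' q) =
       (digits_value (segment (length ?ps) [] q) + (\<Sum>ess\<leftarrow>map ?row Cs. digits_value (ess ! q))) mod digits_value ?ps)"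
  proof (rule foldl_entry_step_rows)
    show "length ess = length ?ts" if "ess \<in> set (map ?row Cs)" for ess
      using that lenr tl by auto
    show "length es \<le> length ?ps \<and> digits_value es < digits_value ?ps"
      if "ess \<in> set (map ?row Cs)" "es \<in> set ess" for ess es
      using that small by auto
    show "digits_value (segment (length ?ps) [] q) < digits_value ?ps" for q
      using p by (simp add: segment_def digits_value_number_digits)
  qed (rule entry_types_nonempty)
  then obtain a' where a': "foldl (entry_step ?ps) ([], [], [], ?ts, 0) (concat (map ?row Cs)) =
       ([], a', [], ?ts, if \<exists>ess\<in>set (map ?row Cs). nonzero_noncorner ?ts ess then 1 else 0)"
     "\<And>q. q < n * n \<Longrightarrow> digits_value (segment (length ?ps) a' q) =
       (\<Sum>C\<leftarrow>Cs. digits_value (?row C ! q)) mod int p"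
    unfolding tl by (elim exE conjE) (simp add: segment_def digits_value_number_digits comp_def)
  have seg: "digits_value (segment (length ?ps) a' (i * n + j)) = (\<Sum>C\<leftarrow>Cs. C $$ (i, j)) mod int p"
    if "i < n" "j < n" for i j
    using a'(2)[OF idx'[OF that]] val that by (simp cong: map_cong)
  have all_q: "(\<exists>q<n*n. P q) \<longleftrightarrow> (\<exists>i<n. \<exists>j<n. P (i * n + j))" for P
    using idx idx' by metis
  have flag: "(\<exists>ess\<in>set (map ?row Cs). nonzero_noncorner ?ts ess) \<longleftrightarrow> (\<exists>C\<in>set Cs. \<exists>ij\<in>nc. C $$ ij \<noteq> 0)"
  proof -
    have "nonzero_noncorner ?ts (?row C) \<longleftrightarrow> (\<exists>ij\<in>nc. C $$ ij \<noteq> 0)" if C: "C \<in> set Cs" for C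
    proof -
      have "nonzero_noncorner ?ts (?row C) \<longleftrightarrow>
         (\<exists>i<n. \<exists>j<n. ?ts ! (i * n + j) = 4 \<and> digits_value (?row C ! (i * n + j)) \<noteq> 0)"
        unfolding nonzero_noncorner_def tl all_q by (simp only: digits_value_eq_0 not_not)
      also have "\<dots> \<longleftrightarrow> (\<exists>i<n. \<exists>j<n. (i, j) \<in> nc \<and> C $$ (i, j) \<noteq> 0)"
      proof -
        have "?ts ! (i * n + j) = 4 \<and> digits_value (?row C ! (i * n + j)) \<noteq> 0 \<longleftrightarrow>
            (i, j) \<in> nc \<and> C $$ (i, j) \<noteq> 0" if "i < n" "j < n" for i j
          using that by (simp add: val[OF C] entry_types_nth[OF n] nc_def)
        then show ?thesis by blast
      qed
      also have "\<dots> \<longleftrightarrow> (\<exists>ij\<in>nc. C $$ ij \<noteq> 0)"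
        using nc_less by (metis surj_pair)
      finally show ?thesis .
    qed
    then show ?thesis by simp
  qed
  define fl :: nat where "fl = (if \<exists>C\<in>set Cs. \<exists>ij\<in>nc. C $$ ij \<noteq> 0 then 1 else 0)"
  define D where "D ij \<longleftrightarrow> int p dvd (\<Sum>C\<leftarrow>Cs. C $$ ij)" for ij
  have "accepts (input_symbols (enc_instance (n, p, Cs))) \<longleftrightarrow> \<not> nonzero_left (length ?ps) fl ?ts a'"
    unfolding accepts_enc_instance a'(1) flag fl_def[symmetric] by simp
  also have "\<dots> \<longleftrightarrow> \<not> (\<exists>i<n. \<exists>j<n. digits_value (segment (length ?ps) a' (i * n + j)) \<noteq> 0 \<and>
       (?ts ! (i * n + j) = 4 \<or> ?ts ! (i * n + j) = 5 \<and> fl = 0))"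
    unfolding nonzero_left_iff tl all_q ..
  also have "\<dots> \<longleftrightarrow> \<not> (\<exists>i<n. \<exists>j<n. \<not> D (i, j) \<and> ((i, j) \<in> nc \<or> (i, j) = (0, n - 1) \<and> fl = 0))"
  proof -
    have "digits_value (segment (length ?ps) a' (i * n + j)) \<noteq> 0 \<and>
        (?ts ! (i * n + j) = 4 \<or> ?ts ! (i * n + j) = 5 \<and> fl = 0) \<longleftrightarrow>
      \<not> D (i, j) \<and> ((i, j) \<in> nc \<or> (i, j) = (0, n - 1) \<and> fl = 0)" if "i < n" "j < n" for i j
      using that n by (auto simp: seg entry_types_nth nc_def D_def dvd_eq_mod_eq_0)
    then show ?thesis by blast
  qed
  also have "\<dots> \<longleftrightarrow> (\<forall>ij\<in>nc. D ij) \<and> (fl \<noteq> 0 \<or> D (0, n - 1))"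
  proof -
    have "0 < n" "n - 1 < n" using n by auto
    show ?thesis
    proof
      assume L: "\<not> (\<exists>i<n. \<exists>j<n. \<not> D (i, j) \<and> ((i, j) \<in> nc \<or> (i, j) = (0, n - 1) \<and> fl = 0))"
      have "D (i, j)" if "(i, j) \<in> nc" for i j using L nc_less[OF that] that by blast
      moreover have "fl \<noteq> 0 \<or> D (0, n - 1)"
      proof (rule ccontr)
        assume "\<not> (fl \<noteq> 0 \<or> D (0, n - 1))"
        then have "\<exists>i<n. \<exists>j<n. \<not> D (i, j) \<and> ((i, j) \<in> nc \<or> (i, j) = (0, n - 1) \<and> fl = 0)"
          using \<open>0 < n\<close> \<open>n - 1 < n\<close> by (intro exI[of _ 0] exI[of _ "n - 1"] conjI) auto
        with L show False by contradiction
      qed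
      ultimately show "(\<forall>ij\<in>nc. D ij) \<and> (fl \<noteq> 0 \<or> D (0, n - 1))" by auto
    qed (auto, metis gr0I)
  qed
  finally show ?thesis by (simp add: D_def fl_def)
qed

section \<open>Spherical equations over Heisenberg groups\<close>

type_synonym heis_coords = "int vec \<times> int \<times> int vec"

fun heis_of :: "nat \<Rightarrow> heis_coords \<Rightarrow> int mat" where
  "heis_of n (a, b, c) = heis_mat n a b c"

lemma heis_of_carrier: "heis_of n x \<in> carrier_mat n n"
  by (cases x) (simp add: heis_mat_carrier)

definition residue_coords :: "nat \<Rightarrow> nat \<Rightarrow> heis_coords set" where
  "residue_coords m p = residue_vecs m p \<times> {0..<int p} \<times> residue_vecs m p"

lemma carrier_heisenberg: "carrier (heisenberg n p) = heis_of n ` residue_coords (n - 2) p"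
  by (force simp: heisenberg_def residue_coords_def)

lemma residue_vecs_carrier: "v \<in> residue_vecs m p \<Longrightarrow> v \<in> carrier_vec m"
  by (simp add: residue_vecs_def)

fun conj_coords :: "nat \<Rightarrow> heis_coords \<Rightarrow> heis_coords \<Rightarrow> heis_coords" where
  "conj_coords p (z1, z2, z3) (a, b, c) = (a, (b + (a \<bullet> z3 - z1 \<bullet> c)) mod int p, c)"

lemma conj_coords_residue:
  "0 < p \<Longrightarrow> x \<in> residue_coords m p \<Longrightarrow> conj_coords p z x \<in> residue_coords m p"
  by (cases z; cases x) (auto simp: residue_coords_def)

text \<open>No inverse is computed: with \<open>y\<close> the claimed conjugate,
  \<open>x z = z y\<close> follows by comparing corners modulo p, and \<open>z\<close> is cancelled
  on the left.\<close>

lemma heis_conj: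
  assumes n: "2 \<le> n" and p: "2 \<le> p"
    and z: "z \<in> residue_coords (n - 2) p" and x: "x \<in> residue_coords (n - 2) p"
  defines "G \<equiv> heisenberg n p"
  shows "inv\<^bsub>G\<^esub> (heis_of n z) \<otimes>\<^bsub>G\<^esub> heis_of n x \<otimes>\<^bsub>G\<^esub> heis_of n z = heis_of n (conj_coords p z x)"
proof -
  interpret group G unfolding G_def by (rule group_heisenberg[OF n p])
  let ?y = "conj_coords p z x"
  obtain z1 z2 z3 where zc: "z = (z1, z2, z3)" by (cases z)
  obtain a b c where xc: "x = (a, b, c)" by (cases x)
  have v: "z1 \<in> carrier_vec (n - 2)" "z3 \<in> carrier_vec (n - 2)" "a \<in> carrier_vec (n - 2)" "c \<in> carrier_vec (n - 2)"
    using z x residue_vecs_carrier by (auto simp: zc xc residue_coords_def)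
  have y: "?y \<in> residue_coords (n - 2) p" using conj_coords_residue p x by simp
  have G: "heis_of n z \<in> carrier G" "heis_of n x \<in> carrier G" "heis_of n ?y \<in> carrier G"
    using z x y by (auto simp: G_def carrier_heisenberg)
  let ?s = "b + (a \<bullet> z3 - z1 \<bullet> c)"
  have "(z2 + ?s mod int p + z1 \<bullet> c) mod int p = (?s mod int p + (z2 + z1 \<bullet> c)) mod int p"
    by (simp only: ac_simps)
  also have "\<dots> = (?s + (z2 + z1 \<bullet> c)) mod int p" by (rule mod_add_left_eq)
  also have "?s + (z2 + z1 \<bullet> c) = b + z2 + a \<bullet> z3" by simp
  finally have "heis_of n x \<otimes>\<^bsub>G\<^esub> heis_of n z = heis_of n z \<otimes>\<^bsub>G\<^esub> heis_of n ?y"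
    unfolding G_def xc zc heis_of.simps conj_coords.simps
    using v by (simp only: heis_mult_closed_form[OF n p] comm_add_vec[of z1 "n - 2" a] comm_add_vec[of z3 "n - 2" c])
  then have "inv\<^bsub>G\<^esub> (heis_of n z) \<otimes>\<^bsub>G\<^esub> heis_of n x \<otimes>\<^bsub>G\<^esub> heis_of n z =
      inv\<^bsub>G\<^esub> (heis_of n z) \<otimes>\<^bsub>G\<^esub> (heis_of n z \<otimes>\<^bsub>G\<^esub> heis_of n ?y)"
    using G by (simp add: m_assoc)
  also have "\<dots> = inv\<^bsub>G\<^esub> (heis_of n z) \<otimes>\<^bsub>G\<^esub> heis_of n z \<otimes>\<^bsub>G\<^esub> heis_of n ?y"
    by (rule m_assoc[symmetric]) (use G in auto)
  also have "\<dots> = heis_of n ?y" using G by (simp only: l_inv l_one)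
  finally show ?thesis .
qed

section \<open>Products of Heisenberg matrices in coordinates\<close>

fun upper_sum :: "nat \<Rightarrow> heis_coords list \<Rightarrow> int vec" where
  "upper_sum m [] = 0\<^sub>v m"
| "upper_sum m ((a, b, c) # xs) = a + upper_sum m xs"

fun right_sum :: "nat \<Rightarrow> heis_coords list \<Rightarrow> int vec" where
  "right_sum m [] = 0\<^sub>v m"
| "right_sum m ((a, b, c) # xs) = c + right_sum m xs"

text \<open>For a list of coordinates (a_i, b_i, c_i) this is the sum of all a_i.c_j with i < j, the
  contribution of the matrix products to the corner.\<close>

fun cross_sum :: "nat \<Rightarrow> heis_coords list \<Rightarrow> int" where
  "cross_sum m [] = 0"
| "cross_sum m ((a, b, c) # xs) = a \<bullet> right_sum m xs + cross_sum m xs"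

definition corner_sum :: "heis_coords list \<Rightarrow> int" where
  "corner_sum xs = (\<Sum>(a, b, c)\<leftarrow>xs. b)"

lemma corner_sum_simps [simp]: "corner_sum [] = 0" "corner_sum ((a, b, c) # xs) = b + corner_sum xs"
  by (simp_all add: corner_sum_def)

text \<open>Sums leave the range of the residues, so products are formed over the integers and
  reduced once at the end.\<close>

definition vector_coords :: "nat \<Rightarrow> heis_coords set" where
  "vector_coords m = carrier_vec m \<times> UNIV \<times> carrier_vec m"

lemma residue_vector_coords: "residue_coords m p \<subseteq> vector_coords m"
  by (auto simp: residue_coords_def vector_coords_def residue_vecs_carrier)

lemma sums_carrier:
  "set xs \<subseteq> vector_coords m \<Longrightarrow> upper_sum m xs \<in> carrier_vec m \<and> right_sum m xs \<in> carrier_vec m"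
  by (induction xs) (auto simp: vector_coords_def)

lemma upper_sum_index:
  "set xs \<subseteq> vector_coords m \<Longrightarrow> k < m \<Longrightarrow> upper_sum m xs $ k = (\<Sum>(a, b, c)\<leftarrow>xs. a $ k)"
proof (induction xs)
  case (Cons x xs)
  then show ?case using sums_carrier[of xs m] by (cases x) (auto simp: vector_coords_def)
qed simp

lemma right_sum_index:
  "set xs \<subseteq> vector_coords m \<Longrightarrow> k < m \<Longrightarrow> right_sum m xs $ k = (\<Sum>(a, b, c)\<leftarrow>xs. c $ k)"
proof (induction xs)
  case (Cons x xs)
  then show ?case using sums_carrier[of xs m] by (cases x) (auto simp: vector_coords_def)
qed simp

lemma prod_heis_of:
  assumes n: "2 \<le> n" and xs: "set xs \<subseteq> vector_coords (n - 2)"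
  shows "foldr (*) (map (heis_of n) xs) (1\<^sub>m n) =
     heis_mat n (upper_sum (n - 2) xs) (corner_sum xs + cross_sum (n - 2) xs) (right_sum (n - 2) xs)"
  using xs
proof (induction xs)
  case Nil
  show ?case using n by (auto simp: heis_mat_def intro!: eq_matI)
next
  case (Cons x xs)
  obtain a b c where x: "x = (a, b, c)" by (cases x)
  have "a \<in> carrier_vec (n - 2)" "c \<in> carrier_vec (n - 2)"
    using Cons.prems by (auto simp: x vector_coords_def)
  then show ?case using Cons sums_carrier[of xs "n - 2"] heis_mat_mult[OF n]
    by (simp add: x algebra_simps)
qed

lemma list_prod_heisenberg:
  assumes p: "2 \<le> p" and Ms: "set Ms \<subseteq> carrier_mat n n"
  shows "list_prod (heisenberg n p) Ms = map_mat (\<lambda>x. x mod int p) (foldr (*) Ms (1\<^sub>m n))"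
  using Ms
proof (induction Ms)
  case Nil
  show ?case using p by (auto simp: list_prod_def heisenberg_def intro!: eq_matI)
next
  case (Cons M Ms)
  have "foldr (*) Ms (1\<^sub>m n) \<in> carrier_mat n n"
    using Cons.prems by (induction Ms) auto
  moreover have "M \<in> carrier_mat n n" using Cons.prems by simp
  ultimately show ?case
    using Cons map_mat_mod_mult(2)[of M n _ "int p"]
    by (simp add: list_prod_def) (simp add: heisenberg_def)
qed

lemma mod_heis_mat_eq_one:
  assumes n: "2 \<le> n" and p: "2 \<le> p" and "a \<in> carrier_vec (n - 2)" "c \<in> carrier_vec (n - 2)"
  shows "map_mat (\<lambda>x. x mod int p) (heis_mat n a b c) = 1\<^sub>m n \<longleftrightarrow>
     (\<forall>k<n - 2. int p dvd a $ k) \<and> int p dvd b \<and> (\<forall>k<n - 2. int p dvd c $ k)" (is "?l = 1\<^sub>m n \<longleftrightarrow> ?r")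
proof
  assume eq: "?l = 1\<^sub>m n"
  have ent: "heis_mat n a b c $$ (i, j) mod int p = 0" if "i < n" "j < n" "i \<noteq> j" for i j
  proof -
    have "?l $$ (i, j) = 0" using eq that by simp
    then show ?thesis using that heis_mat_carrier[of n a b c] by simp
  qed
  have k: "Suc k < n" "Suc k \<noteq> n - 1" if "k < n - 2" for k using that by auto
  have "int p dvd a $ k" if "k < n - 2" for k
    using ent[of 0 "Suc k"] k[OF that] by (simp add: heis_mat_def dvd_eq_mod_eq_0)
  moreover have "int p dvd c $ k" if "k < n - 2" for k
    using ent[of "Suc k" "n - 1"] k[OF that] n by (simp add: heis_mat_def dvd_eq_mod_eq_0)
  moreover have "int p dvd b" using ent[of 0 "n - 1"] n by (simp add: heis_mat_def dvd_eq_mod_eq_0)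
  ultimately show ?r by blast
next
  assume r: ?r
  then have dvds: "\<And>k. k < n - 2 \<Longrightarrow> int p dvd a $ k" "\<And>k. k < n - 2 \<Longrightarrow> int p dvd c $ k" "int p dvd b"
    by blast+
  show "?l = 1\<^sub>m n"
  proof (rule eq_matI)
    fix i j assume "i < dim_row (1\<^sub>m n :: int mat)" "j < dim_col (1\<^sub>m n :: int mat)"
    then have ij: "i < n" "j < n" by simp_all
    have ent: "?l $$ (i, j) = heis_mat n a b c $$ (i, j) mod int p"
      using ij heis_mat_carrier[of n a b c] by simp
    consider "i = j" | "i = 0" "j = n - 1" "i \<noteq> j" | "i = 0" "j \<noteq> 0" "j \<noteq> n - 1"
      | "j = n - 1" "i \<noteq> 0" "i \<noteq> j" | "i \<noteq> 0" "j \<noteq> n - 1" "i \<noteq> j" by metis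
    then show "?l $$ (i, j) = 1\<^sub>m n $$ (i, j)"
    proof cases
      case 1
      then show ?thesis unfolding ent using ij p by (simp add: heis_mat_def)
    next
      case 2
      then show ?thesis unfolding ent using ij dvds(3) by (simp add: heis_mat_def)
    next
      case 3
      then have "int p dvd a $ (j - 1)" using ij by (intro dvds) auto
      then show ?thesis unfolding ent using ij 3 by (simp add: heis_mat_def)
    next
      case 4
      then have "int p dvd c $ (i - 1)" using ij by (intro dvds) auto
      then show ?thesis unfolding ent using ij 4 by (simp add: heis_mat_def)
    next
      case 5
      then show ?thesis unfolding ent using ij by (simp add: heis_mat_def)
    qed
  qed (simp_all add: heis_mat_def)
qed

definition corner_shift :: "heis_coords list \<Rightarrow> heis_coords list \<Rightarrow> int" where
  "corner_shift zs xs = sum_list (map2 (\<lambda>(z1, z2, z3) (a, b, c). a \<bullet> z3 - z1 \<bullet> c) zs xs)"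

lemma corner_shift_simps [simp]:
  "corner_shift [] [] = 0"
  "corner_shift ((z1, z2, z3) # zs) ((a, b, c) # xs) = a \<bullet> z3 - z1 \<bullet> c + corner_shift zs xs"
  by (simp_all add: corner_shift_def)

text \<open>Conjugation fixes all a and c, hence also the cross terms. The corners agree only modulo
  p because \<open>conj_coords\<close> reduces each of them.\<close>

lemma conj_coords_sums:
  assumes "length zs = length xs"
  shows "upper_sum m (map2 (conj_coords p) zs xs) = upper_sum m xs"
    "right_sum m (map2 (conj_coords p) zs xs) = right_sum m xs"
    "cross_sum m (map2 (conj_coords p) zs xs) = cross_sum m xs"
    "corner_sum (map2 (conj_coords p) zs xs) mod int p = (corner_sum xs + corner_shift zs xs) mod int p"
proof -
  have "upper_sum m (map2 (conj_coords p) zs xs) = upper_sum m xs \<and>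
      right_sum m (map2 (conj_coords p) zs xs) = right_sum m xs \<and>
      cross_sum m (map2 (conj_coords p) zs xs) = cross_sum m xs \<and>
      corner_sum (map2 (conj_coords p) zs xs) mod int p = (corner_sum xs + corner_shift zs xs) mod int p"
    using assms
  proof (induction zs xs rule: list_induct2)
    case (Cons z zs x xs)
    obtain z1 z2 z3 where z: "z = (z1, z2, z3)" by (cases z)
    obtain a b c where x: "x = (a, b, c)" by (cases x)
    have "(b + (a \<bullet> z3 - z1 \<bullet> c) + corner_sum (map2 (conj_coords p) zs xs)) mod int p =
       (b + (a \<bullet> z3 - z1 \<bullet> c) + (corner_sum xs + corner_shift zs xs)) mod int p"
      using Cons.IH by (metis mod_add_right_eq)
    then show ?case using Cons.IH by (simp add: z x mod_simps algebra_simps)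
  qed simp
  then show "upper_sum m (map2 (conj_coords p) zs xs) = upper_sum m xs"
    "right_sum m (map2 (conj_coords p) zs xs) = right_sum m xs"
    "cross_sum m (map2 (conj_coords p) zs xs) = cross_sum m xs"
    "corner_sum (map2 (conj_coords p) zs xs) mod int p = (corner_sum xs + corner_shift zs xs) mod int p"
    by blast+
qed

lemma list_in_image: "set ys \<subseteq> f ` A \<Longrightarrow> \<exists>xs. set xs \<subseteq> A \<and> ys = map f xs"
  using lists_image[of f A] unfolding lists_eq_set by blast

text \<open>The conjugators enter through \<open>corner_shift\<close> alone, so the existential
  quantifier can be moved to the corner condition.\<close>

lemma spherical_solvable_iff_shift:
  assumes n: "2 \<le> n" and p: "2 \<le> p" and xs: "set xs \<subseteq> residue_coords (n - 2) p"
  shows "spherical_solvable (n, p, map (heis_of n) xs) \<longleftrightarrow>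
     (\<forall>k<n - 2. int p dvd upper_sum (n - 2) xs $ k) \<and> (\<forall>k<n - 2. int p dvd right_sum (n - 2) xs $ k) \<and>
     (\<exists>zs. length zs = length xs \<and> set zs \<subseteq> residue_coords (n - 2) p \<and>
        int p dvd corner_sum xs + corner_shift zs xs + cross_sum (n - 2) xs)"
proof -
  let ?G = "heisenberg n p"
  let ?conj = "\<lambda>Z C. inv\<^bsub>?G\<^esub> Z \<otimes>\<^bsub>?G\<^esub> C \<otimes>\<^bsub>?G\<^esub> Z"
  have sol: "list_prod ?G (map2 ?conj (map (heis_of n) zs) (map (heis_of n) xs)) = 1\<^sub>m n \<longleftrightarrow>
      (\<forall>k<n - 2. int p dvd upper_sum (n - 2) xs $ k) \<and> (\<forall>k<n - 2. int p dvd right_sum (n - 2) xs $ k) \<and>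
      int p dvd corner_sum xs + corner_shift zs xs + cross_sum (n - 2) xs"
    if zs: "length zs = length xs" "set zs \<subseteq> residue_coords (n - 2) p" for zs
  proof -
    let ?ys = "map2 (conj_coords p) zs xs"
    have "map2 ?conj (map (heis_of n) zs) (map (heis_of n) xs) = map (heis_of n) ?ys"
      using zs xs
    proof (induction zs xs rule: list_induct2)
      case (Cons z zs x xs)
      then show ?case using heis_conj[OF n p, of z x] by simp
    qed simp
    moreover have ys: "set ?ys \<subseteq> vector_coords (n - 2)"
      using xs conj_coords_residue[of p _ "n - 2"] p residue_vector_coords[of "n - 2" p]
      by (fastforce dest: set_zip_rightD)
    moreover have "set (map (heis_of n) ?ys) \<subseteq> carrier_mat n n"
      using heis_of_carrier by auto
    moreover have "(corner_sum ?ys + cross_sum (n - 2) xs) mod int p =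
        (corner_sum xs + corner_shift zs xs + cross_sum (n - 2) xs) mod int p"
      by (rule mod_add_cong[OF conj_coords_sums(4)[OF zs(1)] refl])
    then have "int p dvd corner_sum ?ys + cross_sum (n - 2) xs \<longleftrightarrow>
        int p dvd corner_sum xs + corner_shift zs xs + cross_sum (n - 2) xs"
      by (simp only: dvd_eq_mod_eq_0)
    ultimately show ?thesis
      using list_prod_heisenberg[OF p, of "map (heis_of n) ?ys" n] prod_heis_of[OF n ys] sums_carrier[OF ys]
        mod_heis_mat_eq_one[OF n p] conj_coords_sums(1-3)[OF zs(1)] by (simp only:) blast
  qed
  show ?thesis
  proof
    assume "spherical_solvable (n, p, map (heis_of n) xs)"
    then have "\<exists>Zs. length Zs = length (map (heis_of n) xs) \<and> set Zs \<subseteq> carrier ?G \<and>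
        list_prod ?G (map2 ?conj Zs (map (heis_of n) xs)) = 1\<^sub>m n"
      unfolding spherical_solvable_def Let_def prod.case .
    then obtain Zs where Zs: "length Zs = length (map (heis_of n) xs)" "set Zs \<subseteq> carrier ?G"
      "list_prod ?G (map2 ?conj Zs (map (heis_of n) xs)) = 1\<^sub>m n"
      by (elim exE conjE)
    obtain zs where zs: "set zs \<subseteq> residue_coords (n - 2) p" "Zs = map (heis_of n) zs"
      using list_in_image[OF Zs(2)[unfolded carrier_heisenberg]] by blast
    have "length zs = length xs" using Zs(1) zs(2) by simp
    with sol[OF this zs(1)] Zs(3) zs
    show "(\<forall>k<n - 2. int p dvd upper_sum (n - 2) xs $ k) \<and> (\<forall>k<n - 2. int p dvd right_sum (n - 2) xs $ k) \<and>
      (\<exists>zs. length zs = length xs \<and> set zs \<subseteq> residue_coords (n - 2) p \<and>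
        int p dvd corner_sum xs + corner_shift zs xs + cross_sum (n - 2) xs)"
      by blast
  next
    assume "(\<forall>k<n - 2. int p dvd upper_sum (n - 2) xs $ k) \<and> (\<forall>k<n - 2. int p dvd right_sum (n - 2) xs $ k) \<and>
      (\<exists>zs. length zs = length xs \<and> set zs \<subseteq> residue_coords (n - 2) p \<and>
        int p dvd corner_sum xs + corner_shift zs xs + cross_sum (n - 2) xs)"
    then obtain zs where zs: "length zs = length xs" "set zs \<subseteq> residue_coords (n - 2) p"
      "list_prod ?G (map2 ?conj (map (heis_of n) zs) (map (heis_of n) xs)) = 1\<^sub>m n"
      using sol by blast
    show "spherical_solvable (n, p, map (heis_of n) xs)"
      unfolding spherical_solvable_def Let_def prod.case
    proof (intro exI[of _ "map (heis_of n) zs"] conjI)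
      show "set (map (heis_of n) zs) \<subseteq> carrier ?G"
        using zs(2) unfolding carrier_heisenberg by auto
    qed (use zs in simp_all)
  qed
qed

section \<open>Which corners can be reached by conjugation\<close>

definition noncorner_nonzero :: "nat \<Rightarrow> heis_coords list \<Rightarrow> bool" where
  "noncorner_nonzero m xs \<longleftrightarrow> (\<exists>(a, b, c)\<in>set xs. \<exists>k<m. a $ k \<noteq> 0 \<or> c $ k \<noteq> 0)"

text \<open>Here primality makes the nonzero residue \<open>a\<close> invertible: with a Bezout
  coefficient \<open>x\<close> of \<open>a\<close>, the solution is \<open>x * t\<close> reduced
  modulo p.\<close>

lemma exists_residue_solution:
  fixes p :: nat and a t :: int
  assumes "prime p" "0 \<le> a" "a < int p" "a \<noteq> 0"
  shows "\<exists>u\<in>{0..<int p}. int p dvd a * u - t"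
proof -
  have "\<not> int p dvd a" using assms zdvd_imp_le[of "int p" a] by auto
  then have "coprime a (int p)"
    using assms(1) by (metis coprime_commute prime_imp_coprime prime_nat_int_transfer)
  then obtain x y where xy: "x * a + y * int p = 1" using bezout_int[of a "int p"] by auto
  have "a * ((x * t) mod int p) - t = a * (x * t - int p * ((x * t) div int p)) - t"
    by (simp add: minus_mult_div_eq_mod)
  also have "\<dots> = (x * a - 1) * t - int p * (a * ((x * t) div int p))"
    by (simp add: algebra_simps)
  also have "x * a - 1 = int p * (- y)" using xy by (simp add: algebra_simps)
  finally have "int p dvd a * ((x * t) mod int p) - t"
    by (simp add: mult.assoc)
  moreover have "(x * t) mod int p \<in> {0..<int p}" using assms by simp
  ultimately show ?thesis by blast
qed

lemma zero_coords: "0 < p \<Longrightarrow> (0\<^sub>v m, 0, 0\<^sub>v m) \<in> residue_coords m p"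
  by (simp add: residue_coords_def residue_vecs_def)

lemma corner_shift_zero:
  "set xs \<subseteq> vector_coords m \<Longrightarrow> corner_shift (replicate (length xs) (0\<^sub>v m, 0, 0\<^sub>v m)) xs = 0"
  by (induction xs) (auto simp: vector_coords_def)

text \<open>One coefficient with a nonzero entry can produce every residue, while all others are
  conjugated by the identity.\<close>

lemma exists_corner_shift:
  assumes "prime p" "set xs \<subseteq> residue_coords m p" "noncorner_nonzero m xs"
  shows "\<exists>zs. length zs = length xs \<and> set zs \<subseteq> residue_coords m p \<and> int p dvd corner_shift zs xs - t"
  using assms(2,3)
proof (induction xs)
  case Nil
  then show ?case by (simp add: noncorner_nonzero_def)
next
  case (Cons x xs)
  obtain a b c where x: "x = (a, b, c)" by (cases x)
  have p: "0 < p" using assms(1) by (simp add: prime_gt_0_nat)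
  have ac: "a \<in> residue_vecs m p" "c \<in> residue_vecs m p"
    using Cons.prems(1) by (auto simp: x residue_coords_def)
  have dim: "dim_vec a = m" "dim_vec c = m" using ac by (auto simp: residue_vecs_def)
  have xs: "set xs \<subseteq> vector_coords m" using Cons.prems(1) residue_vector_coords by fastforce
  let ?zero = "(0\<^sub>v m, 0, 0\<^sub>v m) :: heis_coords"
  have zeros: "set (replicate (length xs) ?zero) \<subseteq> residue_coords m p"
    using zero_coords[OF p] by auto
  \<comment> \<open>A multiple of the \<open>k\<close>-th unit vector: its scalar product isolates
    the chosen nonzero coordinate.\<close>
  let ?e = "\<lambda>k u. vec m (\<lambda>i. if i = k then u else 0) :: int vec"
  have e: "?e k u \<in> residue_vecs m p" if "u \<in> {0..<int p}" for k u
    using that p by (auto simp: residue_vecs_def)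
  have scalar: "a \<bullet> ?e k u = a $ k * u" "?e k u \<bullet> c = c $ k * u" if "k < m" for k u
    using that dim by (simp_all add: scalar_prod_def if_distrib[of "\<lambda>x. _ * x"] if_distrib[of "\<lambda>x. x * _"] cong: if_cong)
  have zsc: "0\<^sub>v m \<bullet> c = 0" "a \<bullet> 0\<^sub>v m = 0"
    using ac residue_vecs_carrier by auto
  consider (upper) k where "k < m" "a $ k \<noteq> 0" | (right) k where "k < m" "c $ k \<noteq> 0" | (tail) "noncorner_nonzero m xs"
    using Cons.prems(2) by (auto simp: noncorner_nonzero_def x)
  then show ?case
  proof cases
    case upper
    then obtain u where u: "u \<in> {0..<int p}" "int p dvd a $ k * u - t"
      using exists_residue_solution[OF assms(1), of "a $ k" t] ac by (auto simp: residue_vecs_def)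
    have "corner_shift ((0\<^sub>v m, 0, ?e k u) # replicate (length xs) ?zero) (x # xs) = a $ k * u"
      using scalar upper corner_shift_zero[OF xs] by (simp add: x zsc)
    moreover have "(0\<^sub>v m, 0, ?e k u) \<in> residue_coords m p"
      using zero_coords[OF p, of m] e[OF u(1)] by (simp add: residue_coords_def)
    ultimately show ?thesis using u zeros
      by (intro exI[of _ "(0\<^sub>v m, 0, ?e k u) # replicate (length xs) ?zero"]) simp
  next
    case right
    \<comment> \<open>The target is \<open>- t\<close> because \<open>z1 \<bullet> c\<close> enters
      the shift with a minus sign.\<close>
    then obtain u where u: "u \<in> {0..<int p}" "int p dvd c $ k * u - - t"
      using exists_residue_solution[OF assms(1), of "c $ k" "- t"] ac by (auto simp: residue_vecs_def)
    have "corner_shift ((?e k u, 0, 0\<^sub>v m) # replicate (length xs) ?zero) (x # xs) = - (c $ k * u)"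
      using scalar right corner_shift_zero[OF xs] by (simp add: x zsc)
    moreover have "(?e k u, 0, 0\<^sub>v m) \<in> residue_coords m p"
      using zero_coords[OF p, of m] e[OF u(1)] by (simp add: residue_coords_def)
    moreover have "int p dvd - (c $ k * u) - t"
    proof -
      have eq: "- (c $ k * u) - t = - (c $ k * u - - t)" by simp
      show ?thesis unfolding eq dvd_minus_iff by (rule u(2))
    qed
    ultimately show ?thesis using u zeros
      by (intro exI[of _ "(?e k u, 0, 0\<^sub>v m) # replicate (length xs) ?zero"]) simp
  next
    case tail
    then obtain zs where zs: "length zs = length xs" "set zs \<subseteq> residue_coords m p"
      "int p dvd corner_shift zs xs - t"
      using Cons by auto
    have "corner_shift (?zero # zs) (x # xs) = corner_shift zs xs" by (simp add: x zsc)
    then show ?thesis using zs zero_coords[OF p, of m] by (intro exI[of _ "?zero # zs"]) simp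
  qed
qed

text \<open>The matrices are then central: every cross term and every shift is a scalar product with
  a zero vector.\<close>

lemma noncorner_zero_sums:
  assumes "set xs \<subseteq> vector_coords m" "\<not> noncorner_nonzero m xs" "length zs = length xs"
    "set zs \<subseteq> vector_coords m"
  shows "cross_sum m xs = 0" "corner_shift zs xs = 0"
proof -
  have zero: "a = 0\<^sub>v m" "c = 0\<^sub>v m" if mem: "(a, b, c) \<in> set xs" for a b c
  proof -
    have dim: "dim_vec a = m" "dim_vec c = m" using assms(1) mem by (auto simp: vector_coords_def)
    have "a $ k = 0 \<and> c $ k = 0" if "k < m" for k
    proof (rule ccontr)
      assume "\<not> (a $ k = 0 \<and> c $ k = 0)"
      then have "noncorner_nonzero m xs"
        unfolding noncorner_nonzero_def using mem that by (intro bexI[of _ "(a, b, c)"]) auto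
      with assms(2) show False ..
    qed
    then show "a = 0\<^sub>v m" "c = 0\<^sub>v m" using dim by auto
  qed
  then have zero': "\<forall>x\<in>set xs. fst x = 0\<^sub>v m \<and> snd (snd x) = 0\<^sub>v m" by (metis prod.collapse)
  show "cross_sum m xs = 0"
    using assms(1) zero'
  proof (induction xs)
    case (Cons x xs)
    then have "cross_sum m xs = 0" by simp
    then show ?case using Cons.prems sums_carrier[of xs m] by (cases x) simp
  qed simp
  show "corner_shift zs xs = 0"
    using assms(3,4) zero'
  proof (induction zs xs rule: list_induct2)
    case (Cons z zs x xs)
    then have "corner_shift zs xs = 0" by simp
    then show ?case using Cons.prems by (cases z; cases x) (simp add: vector_coords_def)
  qed simp
qed

text \<open>This removes \<open>cross_sum\<close> from the condition: an available shift absorbs it,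
  and otherwise it is zero.\<close>

lemma spherical_solvable_coords_iff:
  assumes n: "2 \<le> n" and p: "prime p" and xs: "set xs \<subseteq> residue_coords (n - 2) p"
  shows "spherical_solvable (n, p, map (heis_of n) xs) \<longleftrightarrow>
     (\<forall>k<n - 2. int p dvd upper_sum (n - 2) xs $ k) \<and> (\<forall>k<n - 2. int p dvd right_sum (n - 2) xs $ k) \<and>
     (noncorner_nonzero (n - 2) xs \<or> int p dvd corner_sum xs)"
proof -
  let ?m = "n - 2"
  have p2: "2 \<le> p" using p by (simp add: prime_ge_2_nat)
  have "(\<exists>zs. length zs = length xs \<and> set zs \<subseteq> residue_coords ?m p \<and>
        int p dvd corner_sum xs + corner_shift zs xs + cross_sum ?m xs) \<longleftrightarrow>
      noncorner_nonzero ?m xs \<or> int p dvd corner_sum xs"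
  proof (cases "noncorner_nonzero ?m xs")
    case True
    from exists_corner_shift[OF p xs this, of "- corner_sum xs - cross_sum ?m xs"]
    obtain zs where "length zs = length xs" "set zs \<subseteq> residue_coords ?m p"
      "int p dvd corner_shift zs xs - (- corner_sum xs - cross_sum ?m xs)" by blast
    then show ?thesis using True by (intro iffI exI[of _ zs]) (auto simp: algebra_simps)
  next
    case False
    have sums: "cross_sum ?m xs = 0 \<and> corner_shift zs xs = 0"
      if "length zs = length xs" "set zs \<subseteq> residue_coords ?m p" for zs
      using noncorner_zero_sums[of xs ?m zs] that xs False residue_vector_coords[of ?m p] by blast
    let ?zs = "replicate (length xs) (0\<^sub>v ?m, 0, 0\<^sub>v ?m) :: heis_coords list"
    have zs: "length ?zs = length xs" "set ?zs \<subseteq> residue_coords ?m p"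
      using zero_coords[of p ?m] p2 by auto
    show ?thesis
    proof
      assume "\<exists>zs. length zs = length xs \<and> set zs \<subseteq> residue_coords ?m p \<and>
        int p dvd corner_sum xs + corner_shift zs xs + cross_sum ?m xs"
      then show "noncorner_nonzero ?m xs \<or> int p dvd corner_sum xs" using sums by auto
    next
      assume "noncorner_nonzero ?m xs \<or> int p dvd corner_sum xs"
      then have "int p dvd corner_sum xs + corner_shift ?zs xs + cross_sum ?m xs"
        using sums[OF zs] False by auto
      with zs show "\<exists>zs. length zs = length xs \<and> set zs \<subseteq> residue_coords ?m p \<and>
        int p dvd corner_sum xs + corner_shift zs xs + cross_sum ?m xs" by blast
    qed
  qed
  then show ?thesis unfolding spherical_solvable_iff_shift[OF n p2 xs] by simp
qed

section \<open>The criterion in terms of matrix entries\<close>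

theorem spherical_solvable_iff:
  assumes n: "2 \<le> n" and p: "prime p" and Cs: "set Cs \<subseteq> carrier (heisenberg n p)"
  defines "nc \<equiv> {(i, j). i < n \<and> j < n \<and> i \<noteq> j \<and> \<not> (i = 0 \<and> j = n - 1)}"
  shows "spherical_solvable (n, p, Cs) \<longleftrightarrow>
     (\<forall>ij\<in>nc. int p dvd (\<Sum>C\<leftarrow>Cs. C $$ ij)) \<and>
     ((\<exists>C\<in>set Cs. \<exists>ij\<in>nc. C $$ ij \<noteq> 0) \<or> int p dvd (\<Sum>C\<leftarrow>Cs. C $$ (0, n - 1)))"
proof -
  obtain xs where xs: "set xs \<subseteq> residue_coords (n - 2) p" "Cs = map (heis_of n) xs"
    using list_in_image[OF Cs[unfolded carrier_heisenberg]] by blast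
  have vec: "set xs \<subseteq> vector_coords (n - 2)" using xs(1) residue_vector_coords by blast
  have entry: "heis_of n (a, b, c) $$ (i, j) =
      (if i = 0 then a $ (j - 1) else if j = n - 1 then c $ (i - 1) else 0)" if "(i, j) \<in> nc" for a b c i j
    using that by (auto simp: nc_def heis_mat_def)
  have upper: "(0, Suc k) \<in> nc" and right: "(Suc k, n - 1) \<in> nc" if "k < n - 2" for k
    using that by (auto simp: nc_def)
  \<comment> \<open>The last alternative is the middle block, column 0 and the last row off the
    diagonal, where a Heisenberg matrix is zero and the conditions hold trivially.\<close>
  have nc: "i = 0 \<and> j - 1 < n - 2 \<or> i \<noteq> 0 \<and> j = n - 1 \<and> i - 1 < n - 2 \<or> i \<noteq> 0 \<and> j \<noteq> n - 1"
    if "(i, j) \<in> nc" for i j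
    using that by (auto simp: nc_def)
  have sum_entry: "(\<Sum>C\<leftarrow>Cs. C $$ (i, j)) =
      (if i = 0 then upper_sum (n - 2) xs $ (j - 1) else if j = n - 1 then right_sum (n - 2) xs $ (i - 1) else 0)"
    if "(i, j) \<in> nc" for i j
  proof -
    have "(\<Sum>C\<leftarrow>Cs. C $$ (i, j)) =
        (\<Sum>(a, b, c)\<leftarrow>xs. if i = 0 then a $ (j - 1) else if j = n - 1 then c $ (i - 1) else 0)"
      unfolding xs(2) map_map comp_def
      by (intro arg_cong[of _ _ sum_list] map_cong refl) (use entry[OF that] in auto)
    then show ?thesis
      using nc[OF that] upper_sum_index[OF vec] right_sum_index[OF vec] by (auto simp: case_prod_unfold)
  qed
  have "(\<forall>ij\<in>nc. int p dvd (\<Sum>C\<leftarrow>Cs. C $$ ij)) \<longleftrightarrow>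
     (\<forall>k<n - 2. int p dvd upper_sum (n - 2) xs $ k) \<and> (\<forall>k<n - 2. int p dvd right_sum (n - 2) xs $ k)" (is "?l \<longleftrightarrow> ?r")
  proof
    assume ?l
    then have "int p dvd (\<Sum>C\<leftarrow>Cs. C $$ (0, Suc k))" "int p dvd (\<Sum>C\<leftarrow>Cs. C $$ (Suc k, n - 1))"
      if "k < n - 2" for k using upper[OF that] right[OF that] by blast+
    then show ?r using sum_entry[OF upper] sum_entry[OF right] by simp
  next
    assume r: ?r
    show ?l
    proof
      fix ij assume "ij \<in> nc"
      then obtain i j where ij: "ij = (i, j)" "(i, j) \<in> nc" by (cases ij) auto
      show "int p dvd (\<Sum>C\<leftarrow>Cs. C $$ ij)"
        using nc[OF ij(2)] r unfolding ij(1) sum_entry[OF ij(2)] by auto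
    qed
  qed
  moreover have "(\<exists>C\<in>set Cs. \<exists>ij\<in>nc. C $$ ij \<noteq> 0) \<longleftrightarrow> noncorner_nonzero (n - 2) xs" (is "?l \<longleftrightarrow> ?r")
  proof
    assume ?l
    then obtain a b c i j where abc: "(a, b, c) \<in> set xs" "(i, j) \<in> nc" "heis_of n (a, b, c) $$ (i, j) \<noteq> 0"
      unfolding xs(2) by auto
    then show ?r using nc[OF abc(2)] unfolding entry[OF abc(2)] noncorner_nonzero_def
      by (intro bexI[of _ "(a, b, c)"]) (auto split: if_splits)
  next
    assume ?r
    then obtain a b c k where abc: "(a, b, c) \<in> set xs" "k < n - 2" "a $ k \<noteq> 0 \<or> c $ k \<noteq> 0"
      by (auto simp: noncorner_nonzero_def)
    have "heis_of n (a, b, c) $$ (0, Suc k) = a $ k" "heis_of n (a, b, c) $$ (Suc k, n - 1) = c $ k"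
      using entry[OF upper[OF abc(2)]] entry[OF right[OF abc(2)]] by simp_all
    then have "\<exists>ij\<in>nc. heis_of n (a, b, c) $$ ij \<noteq> 0"
      using abc(3) upper[OF abc(2)] right[OF abc(2)] by metis
    moreover have "heis_of n (a, b, c) \<in> set Cs" using abc(1) unfolding xs(2) by (metis image_eqI list.set_map)
    ultimately show ?l by blast
  qed
  moreover have "(\<Sum>C\<leftarrow>Cs. C $$ (0, n - 1)) = corner_sum xs"
  proof -
    have "heis_of n x $$ (0, n - 1) = fst (snd x)" for x using n by (cases x) (auto simp: heis_mat_def)
    then show ?thesis by (simp add: xs(2) comp_def corner_sum_def case_prod_unfold)
  qed
  ultimately show ?thesis
    using spherical_solvable_coords_iff[OF n p xs(1)] unfolding xs(2)[symmetric] by simp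
qed

lemma heisenberg_entries:
  assumes p: "2 \<le> p" and C: "C \<in> carrier (heisenberg n p)" and ij: "i < n" "j < n"
  shows "C $$ (i, j) \<in> {0..<int p}"
proof -
  obtain a b c where C: "C = heis_mat n a b c" "a \<in> residue_vecs (n - 2) p" "b \<in> {0..<int p}"
    "c \<in> residue_vecs (n - 2) p"
    using C by (auto simp: heisenberg_def)
  have a: "a $ k \<in> {0..<int p}" and c: "c $ k \<in> {0..<int p}" if "k < n - 2" for k
    using C that by (auto simp: residue_vecs_def)
  consider "i = j" | "i \<noteq> j" "i = 0" "j = n - 1" | "i = 0" "j - 1 < n - 2" "i \<noteq> j" "j \<noteq> n - 1"
    | "i \<noteq> 0" "j = n - 1" "i - 1 < n - 2" "i \<noteq> j" | "i \<noteq> 0" "j \<noteq> n - 1" "i \<noteq> j"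
    using ij by linarith
  then show ?thesis
    using ij p C(1,3) a c by cases (simp_all add: heis_mat_def)
qed

theorem theorem44:
  shows "in_P spherical_instances enc_instance spherical_solvable"
  unfolding in_P_def
proof (intro bexI[of _ "{w. accepts (input_symbols w)}"] ballI)
  fix x assume "x \<in> spherical_instances"
  then obtain n p Cs where x: "x = (n, p, Cs)" and n: "2 \<le> n" and p: "prime p"
    and Cs: "set Cs \<subseteq> carrier (heisenberg n p)"
    by (auto simp: spherical_instances_def)
  have p2: "2 \<le> p" using p by (rule prime_ge_2_nat)
  have mat: "C \<in> carrier_mat n n" if "C \<in> set Cs" for C
    using Cs that heis_mat_carrier by (auto simp: heisenberg_def)
  have entries: "C $$ (i, j) \<in> {0..<int p}" if "C \<in> set Cs" "i < n" "j < n" for C i j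
    using heisenberg_entries[OF p2 _ that(2,3)] Cs that(1) by blast
  have "accepts (input_symbols (enc_instance (n, p, Cs))) \<longleftrightarrow> spherical_solvable (n, p, Cs)"
    unfolding spherical_solvable_iff[OF n p Cs]
    by (rule accepts_enc_instance_iff) (use n p2 mat entries in auto)
  then show "enc_instance x \<in> {w. accepts (input_symbols w)} \<longleftrightarrow> spherical_solvable x"
    by (simp add: x)
qed (rule accepts_PTIME)

end
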